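(* Let $X$ and $Y$ be metric spaces with bounded geometry. Assume that all sparse subspaces of $Y$ contain no block-rank-one ghost projections in their Roe algebras, i.e. for every sparse subspace $Y'\subseteq Y$ the Roe algebra $C^*(Y')$ contains no block-rank-one ghost projection. Then the following are equivalent: (1) $X$ is coarsely equivalent to $Y$; (2) $C^*_u(X)$ is stably $*$-isomorphic to $C^*_u(Y)$; (3) $C^*_s(X)$ is $*$-isomorphic to $C^*_s(Y)$; (4) $UC^*(X)$ is $*$-isomorphic to $UC^*(Y)$; (5) $C^*(X)$ is $*$-isomorphic to $C^*(Y)$.
   Context: All metric spaces are non-empty and discrete. $(X,d)$ has bounded geometry if $\sup_{x\in X}|B(x,R)|<\infty$ for each $R>0$ (closed balls). A map $f:X\to Y$ is a coarse embedding if there are non-decreasing unbounded $\rho_\pm:[0,\infty)\to[0,\infty)$ with $\rho_-(d_X(x,y))\le d_Y(f(x),f(y))\le\rho_+(d_X(x,y))$ for all $x,y$; $X$ and $Y$ are coarsely equivalent if there is a coarse embedding $f:X\to Y$ and $C>0$ such that every point of $Y$ is within distance $C$ of $f(X)$. $(X,d)$ is sparse if there is a partition $X=\bigsqcup_{n\in\mathbb N}X_n$ with $0<|X_n|<\infty$ and $d(X_n,X_m)\to\infty$ as $n+m\to\infty$, $n\ne m$. Let $H_0$ be an infinite-dimensional separable Hilbert space. A block-rank-one projection on a sparse space $X$ is a projection of the form $P=\bigoplus_nP_n\in\mathfrak B(\bigoplus_n\ell^2(X_n;H_0))=\mathfrak B(\ell^2(X;H_0))$ for some decomposition $X=\bigsqcup_nX_n$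 as in the definition of sparse, each $P_n$ being a rank-one projection $P_n\eta=\langle\eta,\xi_n\rangle\xi_n$ with $\xi_n\in\ell^2(X_n;H_0)$ a unit vector. It is a ghost if $\lim_n\sup_{x\in X_n}\|\xi_n(x)\|^2=0$. Write $T\in\mathfrak B(\ell^2(X;H_0))$ as a matrix $(T_{x,y})_{x,y\in X}$ with entries in $\mathfrak B(H_0)$ (similarly for $\ell^2(X)$ with scalar entries). $T$ has finite propagation if $\sup\{d(x,y):T_{x,y}\ne0\}<\infty$. - $C^*(X)$ (Roe algebra): norm closure in $\mathfrak B(\ell^2(X;H_0))$ of finite propagation operators with all $T_{x,y}$ compact. - $UC^*(X)$ (uniform algebra): norm closure of finite propagation $T\in\mathfrak B(\ell^2(X;H_0))$ for which there is $N\in\mathbb N$ with $\mathrm{rank}(T_{x,y})\le N$ for all $x,y$. - $C^*_s(X)$ (stable Roe algebra): norm closure of finite propagation $T\in\mathfrak B(\ell^2(X;H_0))$ for which there is a finite-dimensional subspace $H\subseteq H_0$ with $T_{x,y}\in\mathfrak B(H)$ for all $x,y$. - $C^*_u(X)$ (uniform Roe algebra): norm closure of finite propagation operators in $\mathfrak B(\ell^2(X))$. $A,B$ are stably $*$-isomorphic if $A\otimes\mathfrak K\cong B\otimes\mathfrak K$, with $\mathfrak K$ the compact operators on a separable infinite-dimensional Hilbert space. *)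

theory Defs
  imports "HOL-Analysis.Analysis"
begin

section \<open>Complex Hilbert spaces\<close>

text \<open>The real inner product of the library class is the real part of the complex one, so norm,
  topology and completeness are those of the library.  The complex inner product is linear in
  its first argument.\<close>

class chilbert_space = real_inner + complete_space +
  fixes scaleC :: "complex \<Rightarrow> 'a \<Rightarrow> 'a"  (infixr "*\<^sub>C" 75)
    and cinner :: "'a \<Rightarrow> 'a \<Rightarrow> complex"
  assumes scaleC_add_right: "c *\<^sub>C (x + y) = c *\<^sub>C x + c *\<^sub>C y"
    and scaleC_add_left: "(b + c) *\<^sub>C x = b *\<^sub>C x + c *\<^sub>C x"
    and scaleC_scaleC: "b *\<^sub>C (c *\<^sub>C x) = (b * c) *\<^sub>C x"
    and scaleC_one: "1 *\<^sub>C x = x"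
    and scaleR_scaleC: "scaleR r x = complex_of_real r *\<^sub>C x"
    and cinner_commute: "cinner x y = cnj (cinner y x)"
    and cinner_add_left: "cinner (x + y) z = cinner x z + cinner y z"
    and cinner_scaleC_left: "cinner (c *\<^sub>C x) y = c * cinner x y"
    and inner_eq_Re_cinner: "inner x y = Re (cinner x y)"

global_interpretation complex_vector: vector_space "scaleC :: complex \<Rightarrow> 'a \<Rightarrow> 'a::chilbert_space"
  defines cspan = complex_vector.span
    and cdependent = complex_vector.dependent
  by unfold_locales (simp_all add: scaleC_add_right scaleC_add_left scaleC_scaleC scaleC_one)

instantiation complex :: chilbert_space
begin

definition scaleC_complex :: "complex \<Rightarrow> complex \<Rightarrow> complex"
  where "scaleC_complex c x = c * x"

definition cinner_complex :: "complex \<Rightarrow> complex \<Rightarrow> complex"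
  where "cinner_complex x y = x * cnj y"

instance
  by standard
    (simp_all add: scaleC_complex_def cinner_complex_def algebra_simps scaleR_conv_of_real
      inner_complex_def)

end

lemma cinner_self: "cinner x x = complex_of_real ((norm x)\<^sup>2)"
proof -
  have "Im (cinner x x) = 0"
    using arg_cong[OF cinner_commute[of x x], of Im] by simp
  moreover have "Re (cinner x x) = (norm x)\<^sup>2"
    by (simp add: inner_eq_Re_cinner[symmetric] power2_norm_eq_inner)
  ultimately show ?thesis by (simp add: complex_eq_iff)
qed

lemma cinner_scaleC_right: "cinner x (c *\<^sub>C y) = cnj c * cinner x y"
  by (metis cinner_commute cinner_scaleC_left complex_cnj_mult)

lemma norm_scaleC: "norm (c *\<^sub>C x) = cmod c * norm x"
proof -
  have "complex_of_real ((norm (c *\<^sub>C x))\<^sup>2) = c * cnj c * cinner x x"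
    unfolding cinner_self[symmetric] by (simp add: cinner_scaleC_left cinner_scaleC_right)
  also have "\<dots> = complex_of_real ((cmod c * norm x)\<^sup>2)"
    by (simp add: cinner_self power_mult_distrib flip: complex_norm_square)
  finally have "(norm (c *\<^sub>C x))\<^sup>2 = (cmod c * norm x)\<^sup>2"
    using of_real_eq_iff by blast
  then show ?thesis by (simp add: power2_eq_iff_nonneg)
qed

lemma norm_cinner_le: "cmod (cinner x y) \<le> (norm x)\<^sup>2 + (norm y)\<^sup>2"
proof -
  have am_gm: "2 * (a * b) \<le> a\<^sup>2 + b\<^sup>2" for a b :: real
    using sum_squares_bound[of a b] by simp
  have "\<bar>Re (cinner x y)\<bar> \<le> norm x * norm y"
    by (metis inner_eq_Re_cinner Cauchy_Schwarz_ineq2)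
  moreover have "\<bar>Im (cinner x y)\<bar> \<le> norm x * norm y"
  proof -
    have "Im (cinner x y) = inner x (\<i> *\<^sub>C y)"
      by (simp add: inner_eq_Re_cinner cinner_scaleC_right)
    then have "\<bar>Im (cinner x y)\<bar> \<le> norm x * norm (\<i> *\<^sub>C y)"
      by (metis Cauchy_Schwarz_ineq2)
    then show ?thesis by (simp add: norm_scaleC)
  qed
  ultimately have "cmod (cinner x y) \<le> 2 * (norm x * norm y)"
    using cmod_le[of "cinner x y"] by linarith
  then show ?thesis using am_gm[of "norm x" "norm y"] by linarith
qed


section \<open>The Hilbert space of square-summable functions\<close>

typedef (overloaded) ('a, 'h::real_normed_vector) ell2 =
  "{f :: 'a \<Rightarrow> 'h. (\<lambda>x. (norm (f x))\<^sup>2) summable_on UNIV}"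
  morphisms ell2_fun Abs_ell2
  by (rule exI[of _ "\<lambda>_. 0"]) simp

setup_lifting type_definition_ell2

lemma ell2_summable: "(\<lambda>x. (norm (ell2_fun f x))\<^sup>2) summable_on A"
  using ell2_fun[of f] summable_on_subset_banach by blast

lemma square_summable_add:
  fixes f g :: "'a \<Rightarrow> 'h::real_normed_vector"
  assumes "(\<lambda>x. (norm (f x))\<^sup>2) summable_on A" "(\<lambda>x. (norm (g x))\<^sup>2) summable_on A"
  shows "(\<lambda>x. (norm (f x + g x))\<^sup>2) summable_on A"
proof (rule summable_on_comparison_test)
  show "(\<lambda>x. 2 * (norm (f x))\<^sup>2 + 2 * (norm (g x))\<^sup>2) summable_on A"
    using assms by (intro summable_on_add summable_on_cmult_right)
  fix x
  have "(norm (f x + g x))\<^sup>2 \<le> (norm (f x) + norm (g x))\<^sup>2"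
    by (simp add: norm_triangle_ineq power_mono)
  also have "\<dots> \<le> 2 * (norm (f x))\<^sup>2 + 2 * (norm (g x))\<^sup>2"
    using sum_squares_bound[of "norm (f x)" "norm (g x)"] by (simp add: power2_sum)
  finally show "(norm (f x + g x))\<^sup>2 \<le> 2 * (norm (f x))\<^sup>2 + 2 * (norm (g x))\<^sup>2" .
qed simp

lemma square_summable_scaleC:
  fixes f :: "'a \<Rightarrow> 'h::chilbert_space"
  assumes "(\<lambda>x. (norm (f x))\<^sup>2) summable_on A"
  shows "(\<lambda>x. (norm (c *\<^sub>C f x))\<^sup>2) summable_on A"
  using summable_on_cmult_right[OF assms, of "(cmod c)\<^sup>2"]
  by (simp add: norm_scaleC power_mult_distrib)

lemma ell2_cinner_summable:
  fixes f g :: "('a, 'h::chilbert_space) ell2"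
  shows "(\<lambda>x. cinner (ell2_fun f x) (ell2_fun g x)) summable_on UNIV"
  by (rule abs_summable_summable, rule summable_on_comparison_test[OF
        summable_on_add[OF ell2_summable[of f] ell2_summable[of g]]])
    (simp_all add: norm_cinner_le)

instantiation ell2 :: (type, chilbert_space) ab_group_add
begin

lift_definition zero_ell2 :: "('a, 'b) ell2" is "\<lambda>_. 0" by simp
lift_definition plus_ell2 :: "('a, 'b) ell2 \<Rightarrow> ('a, 'b) ell2 \<Rightarrow> ('a, 'b) ell2"
  is "\<lambda>f g x. f x + g x" by (rule square_summable_add)
lift_definition uminus_ell2 :: "('a, 'b) ell2 \<Rightarrow> ('a, 'b) ell2"
  is "\<lambda>f x. - f x" by simp
lift_definition minus_ell2 :: "('a, 'b) ell2 \<Rightarrow> ('a, 'b) ell2 \<Rightarrow> ('a, 'b) ell2"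
  is "\<lambda>f g x. f x - g x"
  using square_summable_add[where g = "\<lambda>x. - g x" for g] by fastforce

instance by standard (transfer; auto simp: fun_eq_iff)+

end

instantiation ell2 :: (type, chilbert_space) real_vector
begin

lift_definition scaleR_ell2 :: "real \<Rightarrow> ('a, 'b) ell2 \<Rightarrow> ('a, 'b) ell2"
  is "\<lambda>r f x. r *\<^sub>R f x"
  by (simp add: scaleR_scaleC square_summable_scaleC)

instance
  by standard (transfer; simp add: fun_eq_iff scaleR_add_right scaleR_add_left)+

end

instantiation ell2 :: (type, chilbert_space) real_inner
begin

definition inner_ell2 :: "('a, 'b) ell2 \<Rightarrow> ('a, 'b) ell2 \<Rightarrow> real"
  where "inner_ell2 f g = (\<Sum>\<^sub>\<infinity>x. inner (ell2_fun f x) (ell2_fun g x))"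
definition norm_ell2 :: "('a, 'b) ell2 \<Rightarrow> real"
  where "norm_ell2 f = sqrt (\<Sum>\<^sub>\<infinity>x. (norm (ell2_fun f x))\<^sup>2)"
definition dist_ell2 :: "('a, 'b) ell2 \<Rightarrow> ('a, 'b) ell2 \<Rightarrow> real"
  where "dist_ell2 f g = norm (f - g)"
definition sgn_ell2 :: "('a, 'b) ell2 \<Rightarrow> ('a, 'b) ell2"
  where "sgn_ell2 f = f /\<^sub>R norm f"
definition uniformity_ell2 :: "(('a, 'b) ell2 \<times> ('a, 'b) ell2) filter"
  where "uniformity_ell2 = (INF e\<in>{0<..}. principal {(f, g). dist f g < e})"
definition open_ell2 :: "('a, 'b) ell2 set \<Rightarrow> bool"
  where "open_ell2 U = (\<forall>f\<in>U. eventually (\<lambda>(f', g). f' = f \<longrightarrow> g \<in> U) uniformity)"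

lemma ell2_inner_summable:
  fixes f g :: "('a, 'b) ell2"
  shows "(\<lambda>x. inner (ell2_fun f x) (ell2_fun g x)) summable_on UNIV"
  using summable_on_Re[OF ell2_cinner_summable[of f g]] by (simp add: inner_eq_Re_cinner)

instance
proof
  fix f g h :: "('a, 'b) ell2" and r :: real
  show "sgn f = f /\<^sub>R norm f" by (rule sgn_ell2_def)
  show "dist f g = norm (f - g)" by (rule dist_ell2_def)
  show "(uniformity :: (('a, 'b) ell2 \<times> ('a, 'b) ell2) filter)
      = (INF e\<in>{0<..}. principal {(f, g). dist f g < e})"
    by (rule uniformity_ell2_def)
  show "open U = (\<forall>f\<in>U. eventually (\<lambda>(f', g). f' = f \<longrightarrow> g \<in> U) uniformity)"
    for U :: "('a, 'b) ell2 set"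
    by (rule open_ell2_def)
  show "inner f g = inner g f" by (simp add: inner_ell2_def inner_commute)
  show "inner (f + g) h = inner f h + inner g h"
    unfolding inner_ell2_def plus_ell2.rep_eq inner_add_left
    by (rule infsum_add[OF ell2_inner_summable ell2_inner_summable])
  show "inner (r *\<^sub>R f) g = r * inner f g"
    unfolding inner_ell2_def scaleR_ell2.rep_eq inner_scaleR_left by (rule infsum_cmult_right')
  show "0 \<le> inner f f" unfolding inner_ell2_def by (rule infsum_nonneg) simp
  show "inner f f = 0 \<longleftrightarrow> f = 0"
  proof
    assume "inner f f = 0"
    then have "inner (ell2_fun f x) (ell2_fun f x) = 0" for x
      using nonneg_infsum_le_0D[of "\<lambda>x. inner (ell2_fun f x) (ell2_fun f x)" UNIV x]
      by (simp add: inner_ell2_def ell2_inner_summable)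
    then have "ell2_fun f = ell2_fun 0" by (simp add: fun_eq_iff zero_ell2.rep_eq)
    then show "f = 0" by (simp add: ell2_fun_inject)
  qed (simp add: inner_ell2_def zero_ell2.rep_eq)
  show "norm f = sqrt (inner f f)"
    by (simp add: norm_ell2_def inner_ell2_def power2_norm_eq_inner)
qed

end

lemma norm_ell2_sq: "(norm f)\<^sup>2 = (\<Sum>\<^sub>\<infinity>x. (norm (ell2_fun f x))\<^sup>2)"
  for f :: "('a, 'h::chilbert_space) ell2"
  unfolding norm_ell2_def by (rule real_sqrt_pow2) (rule infsum_nonneg, simp)

lemma sum_norm_sq_le_norm_ell2:
  fixes f :: "('a, 'h::chilbert_space) ell2"
  assumes "finite S"
  shows "(\<Sum>x\<in>S. (norm (ell2_fun f x))\<^sup>2) \<le> (norm f)\<^sup>2"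
  unfolding norm_ell2_sq by (rule finite_sum_le_infsum[OF ell2_summable assms]) simp_all

lemma norm_ell2_fun_le: "norm (ell2_fun f x) \<le> norm f" for f :: "('a, 'h::chilbert_space) ell2"
  using sum_norm_sq_le_norm_ell2[of "{x}" f] by (simp add: power2_le_iff_abs_le)

instantiation ell2 :: (type, chilbert_space) chilbert_space
begin

lift_definition scaleC_ell2 :: "complex \<Rightarrow> ('a, 'b) ell2 \<Rightarrow> ('a, 'b) ell2"
  is "\<lambda>c f x. c *\<^sub>C f x" by (rule square_summable_scaleC)

definition cinner_ell2 :: "('a, 'b) ell2 \<Rightarrow> ('a, 'b) ell2 \<Rightarrow> complex"
  where "cinner_ell2 f g = (\<Sum>\<^sub>\<infinity>x. cinner (ell2_fun f x) (ell2_fun g x))"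

instance
proof
  fix f g h :: "('a, 'b) ell2" and b c :: complex and r :: real
  show "c *\<^sub>C (f + g) = c *\<^sub>C f + c *\<^sub>C g" by transfer (simp add: scaleC_add_right)
  show "(b + c) *\<^sub>C f = b *\<^sub>C f + c *\<^sub>C f" by transfer (simp add: scaleC_add_left)
  show "b *\<^sub>C c *\<^sub>C f = (b * c) *\<^sub>C f" by transfer (simp add: scaleC_scaleC)
  show "1 *\<^sub>C f = f" by transfer (simp add: scaleC_one)
  show "r *\<^sub>R f = complex_of_real r *\<^sub>C f" by transfer (simp add: scaleR_scaleC)
  show "cinner f g = cnj (cinner g f)"
    unfolding cinner_ell2_def infsum_cnj[symmetric] by (subst cinner_commute) simp
  show "cinner (f + g) h = cinner f h + cinner g h"
    unfolding cinner_ell2_def plus_ell2.rep_eq cinner_add_left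
    by (rule infsum_add[OF ell2_cinner_summable ell2_cinner_summable])
  show "cinner (c *\<^sub>C f) g = c * cinner f g"
    unfolding cinner_ell2_def scaleC_ell2.rep_eq cinner_scaleC_left by (rule infsum_cmult_right')
  show "inner f g = Re (cinner f g)"
    unfolding cinner_ell2_def inner_ell2_def inner_eq_Re_cinner
    by (rule infsum_Re[OF ell2_cinner_summable])
next
  fix F :: "nat \<Rightarrow> ('a, 'b) ell2"
  assume F: "Cauchy F"
  have "Cauchy (\<lambda>n. ell2_fun (F n) x)" for x
  proof (rule metric_CauchyI)
    fix e :: real assume "0 < e"
    then obtain M where M: "\<forall>m\<ge>M. \<forall>n\<ge>M. dist (F m) (F n) < e"
      using F by (meson Cauchy_def)
    have "dist (ell2_fun (F m) x) (ell2_fun (F n) x) < e" if "m \<ge> M" "n \<ge> M" for m n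
      using norm_ell2_fun_le[of "F m - F n" x] M[rule_format, OF that]
      by (simp add: dist_norm minus_ell2.rep_eq)
    then show "\<exists>M. \<forall>m\<ge>M. \<forall>n\<ge>M. dist (ell2_fun (F m) x) (ell2_fun (F n) x) < e" by blast
  qed
  then have "\<forall>x. \<exists>l. (\<lambda>n. ell2_fun (F n) x) \<longlonglongrightarrow> l"
    by (simp add: Cauchy_convergent convergent_def[symmetric])
  then obtain l where l: "(\<lambda>n. ell2_fun (F n) x) \<longlonglongrightarrow> l x" for x by metis
  have bound: "(\<Sum>x\<in>S. (norm (ell2_fun (F m) x - l x))\<^sup>2) \<le> e\<^sup>2"
    if S: "finite S" and m: "m \<ge> M" and e: "0 < e"
      and M: "\<forall>m\<ge>M. \<forall>n\<ge>M. dist (F m) (F n) < e" for S m M e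
  proof (rule tendsto_upperbound)
    show "(\<lambda>n. \<Sum>x\<in>S. (norm (ell2_fun (F m) x - ell2_fun (F n) x))\<^sup>2)
        \<longlonglongrightarrow> (\<Sum>x\<in>S. (norm (ell2_fun (F m) x - l x))\<^sup>2)"
      by (intro tendsto_intros l)
    show "\<forall>\<^sub>F n in sequentially.
        (\<Sum>x\<in>S. (norm (ell2_fun (F m) x - ell2_fun (F n) x))\<^sup>2) \<le> e\<^sup>2"
    proof (rule eventually_sequentiallyI)
      fix n assume "n \<ge> M"
      then have "norm (F m - F n) \<le> e" using M m by (force simp: dist_norm)
      then have "(norm (F m - F n))\<^sup>2 \<le> e\<^sup>2" by (simp add: power_mono)
      then show "(\<Sum>x\<in>S. (norm (ell2_fun (F m) x - ell2_fun (F n) x))\<^sup>2) \<le> e\<^sup>2"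
        using sum_norm_sq_le_norm_ell2[OF S, of "F m - F n"] by (simp add: minus_ell2.rep_eq)
    qed
  qed simp
  have diff_summable: "(\<lambda>x. (norm (ell2_fun (F m) x - l x))\<^sup>2) summable_on UNIV"
    if "m \<ge> M" "0 < e" "\<forall>m\<ge>M. \<forall>n\<ge>M. dist (F m) (F n) < e" for m M e
    by (rule nonneg_bdd_above_summable_on) (auto intro!: bdd_aboveI2 bound that)
  obtain M1 where M1: "\<forall>m\<ge>M1. \<forall>n\<ge>M1. dist (F m) (F n) < 1"
    using F unfolding Cauchy_def by (meson zero_less_one)
  have "(\<lambda>x. (norm (ell2_fun (F M1) x - (ell2_fun (F M1) x - l x)))\<^sup>2) summable_on UNIV"
    using square_summable_add[of "ell2_fun (F M1)" UNIV "\<lambda>x. - (ell2_fun (F M1) x - l x)"]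
      ell2_summable[of "F M1" UNIV] diff_summable[OF order_refl _ M1]
    by (simp add: norm_minus_commute)
  then obtain L where L: "ell2_fun L = l"
    using Abs_ell2_inverse[of l] by fastforce
  have "F \<longlonglongrightarrow> L"
  proof (rule metric_LIMSEQ_I)
    fix e :: real assume "0 < e"
    then have e: "0 < e / 2" by simp
    then obtain M where M: "\<forall>m\<ge>M. \<forall>n\<ge>M. dist (F m) (F n) < e / 2"
      using F by (meson Cauchy_def)
    have "dist (F m) L < e" if m: "m \<ge> M" for m
    proof -
      have "(norm (F m - L))\<^sup>2 \<le> (e / 2)\<^sup>2"
        unfolding norm_ell2_sq
        by (rule infsum_le_finite_sums)
          (use ell2_summable[of "F m - L" UNIV] bound[OF _ m e M] L in \<open>auto simp: minus_ell2.rep_eq\<close>)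
      then have "norm (F m - L) \<le> e / 2" using e by (simp add: power2_le_iff_abs_le)
      then show ?thesis using \<open>0 < e\<close> by (simp add: dist_norm)
    qed
    then show "\<exists>M. \<forall>m\<ge>M. dist (F m) L < e" by blast
  qed
  then show "convergent F" by (auto simp: convergent_def)
qed

end

lift_definition ell2_single :: "'a \<Rightarrow> 'h \<Rightarrow> ('a, 'h::real_normed_vector) ell2"
  is "\<lambda>y v x. if x = y then v else 0"
proof -
  fix y :: 'a and v :: 'h
  have "(\<lambda>x. (norm (if x = y then v else 0))\<^sup>2) summable_on {y}"
    by (rule summable_on_finite) simp
  then show "(\<lambda>x. (norm (if x = y then v else 0))\<^sup>2) summable_on UNIV"
    by (rule iffD1[OF summable_on_cong_neutral, rotated -1]) auto
qed

lemma norm_ell2_single: "norm (ell2_single y v) = norm v" for v :: "'h::chilbert_space"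
proof -
  have "(\<Sum>\<^sub>\<infinity>x. (norm (ell2_fun (ell2_single y v) x))\<^sup>2) = (\<Sum>\<^sub>\<infinity>x\<in>{y}. (norm v)\<^sup>2)"
    by (rule infsum_cong_neutral) (auto simp: ell2_single.rep_eq)
  then show ?thesis by (simp add: norm_ell2_def)
qed


section \<open>Operators on Hilbert spaces\<close>

text \<open>The library type of bounded linear maps is real-linear; the bounded operators of a complex
  Hilbert space are its complex-linear elements.  Its norm is the operator norm.\<close>

definition bounded_operators :: "('h::chilbert_space \<Rightarrow>\<^sub>L 'h) set" where
  "bounded_operators = {T. \<forall>c v. blinfun_apply T (c *\<^sub>C v) = c *\<^sub>C blinfun_apply T v}"

lift_definition op_scaleC :: "complex \<Rightarrow> ('h::chilbert_space \<Rightarrow>\<^sub>L 'h) \<Rightarrow> ('h \<Rightarrow>\<^sub>L 'h)"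
  is "\<lambda>c T v. c *\<^sub>C T v"
proof -
  fix c :: complex and T :: "'h \<Rightarrow> 'h"
  assume T: "bounded_linear T"
  have "bounded_linear (\<lambda>v :: 'h. c *\<^sub>C v)"
    by (rule bounded_linear_intro[where K = "cmod c"])
      (simp_all add: scaleC_add_right scaleR_scaleC scaleC_scaleC norm_scaleC mult.commute)
  from bounded_linear_compose[OF this T] show "bounded_linear (\<lambda>v. c *\<^sub>C T v)" .
qed

text \<open>\<open>is_adjoint S T\<close> says \<open>S = T*\<close>.  Adjoints of bounded operators exist, are unique, and stay in
  each algebra considered below, so preserving this relation is preserving the involution.\<close>

definition is_adjoint :: "('h::chilbert_space \<Rightarrow>\<^sub>L 'h) \<Rightarrow> ('h \<Rightarrow>\<^sub>L 'h) \<Rightarrow> bool" where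
  "is_adjoint S T \<longleftrightarrow>
     (\<forall>v w. cinner (blinfun_apply T v) w = cinner v (blinfun_apply S w))"

definition compact_operators :: "('h::chilbert_space \<Rightarrow>\<^sub>L 'h) set" where
  "compact_operators =
     {T \<in> bounded_operators. compact (closure (blinfun_apply T ` cball 0 1))}"

definition rank_at_most :: "('h::chilbert_space \<Rightarrow>\<^sub>L 'h) \<Rightarrow> nat \<Rightarrow> bool" where
  "rank_at_most T N \<longleftrightarrow>
     (\<exists>B. \<not> cdependent B \<and> cspan B = range (blinfun_apply T) \<and> finite B \<and> card B \<le> N)"

text \<open>\<open>op_on V\<close> is the algebra of operators of a subspace \<open>V\<close>, seen inside the operators of the
  whole space by extending with zero on the orthogonal complement.\<close>

definition op_on :: "'h::chilbert_space set \<Rightarrow> ('h \<Rightarrow>\<^sub>L 'h) set" where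
  "op_on V = {T \<in> bounded_operators. (\<forall>v. blinfun_apply T v \<in> V) \<and>
     (\<forall>v. (\<forall>w\<in>V. cinner v w = 0) \<longrightarrow> blinfun_apply T v = 0)}"

definition star_isomorphism ::
  "('h::chilbert_space \<Rightarrow>\<^sub>L 'h) set \<Rightarrow> ('k::chilbert_space \<Rightarrow>\<^sub>L 'k) set \<Rightarrow>
   (('h \<Rightarrow>\<^sub>L 'h) \<Rightarrow> ('k \<Rightarrow>\<^sub>L 'k)) \<Rightarrow> bool" where
  "star_isomorphism A B \<phi> \<longleftrightarrow> bij_betw \<phi> A B \<and>
     (\<forall>S\<in>A. \<forall>T\<in>A. \<phi> (S + T) = \<phi> S + \<phi> T) \<and>
     (\<forall>c. \<forall>T\<in>A. \<phi> (op_scaleC c T) = op_scaleC c (\<phi> T)) \<and>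
     (\<forall>S\<in>A. \<forall>T\<in>A. \<phi> (S o\<^sub>L T) = \<phi> S o\<^sub>L \<phi> T) \<and>
     (\<forall>S\<in>A. \<forall>T\<in>A. is_adjoint S T \<longrightarrow> is_adjoint (\<phi> S) (\<phi> T))"

definition star_isomorphic ::
  "('h::chilbert_space \<Rightarrow>\<^sub>L 'h) set \<Rightarrow> ('k::chilbert_space \<Rightarrow>\<^sub>L 'k) set \<Rightarrow> bool" where
  "star_isomorphic A B \<longleftrightarrow> (\<exists>\<phi>. star_isomorphism A B \<phi>)"

text \<open>The tensor product of \<open>H\<close> with \<open>\<ell>\<^sup>2(\<nat>)\<close> is \<open>\<ell>\<^sup>2(\<nat>; H)\<close>, where \<open>v \<otimes> \<eta>\<close> is the function
  \<open>n \<mapsto> \<eta>(n) v\<close>.\<close>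

lift_definition ell2_tensor ::
  "'h::chilbert_space \<Rightarrow> ('n, complex) ell2 \<Rightarrow> ('n, 'h) ell2" is "\<lambda>v \<eta> n. \<eta> n *\<^sub>C v"
  unfolding norm_scaleC power_mult_distrib by (rule summable_on_cmult_left)

definition is_tensor_op ::
  "('h::chilbert_space \<Rightarrow>\<^sub>L 'h) \<Rightarrow> (('n, complex) ell2 \<Rightarrow>\<^sub>L ('n, complex) ell2) \<Rightarrow>
   (('n, 'h) ell2 \<Rightarrow>\<^sub>L ('n, 'h) ell2) \<Rightarrow> bool" where
  "is_tensor_op a k T \<longleftrightarrow> T \<in> bounded_operators \<and>
     (\<forall>v \<eta>. blinfun_apply T (ell2_tensor v \<eta>)
        = ell2_tensor (blinfun_apply a v) (blinfun_apply k \<eta>))"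

text \<open>The C*-tensor product of a concrete C*-algebra with the compact operators on \<open>\<ell>\<^sup>2(\<nat>)\<close>
  (these are nuclear, so the spatial norm is the only C*-norm).  The real span of the elementary
  tensors is also their complex span, as they are closed under complex multiples.\<close>

definition stabilization ::
  "('h::chilbert_space \<Rightarrow>\<^sub>L 'h) set \<Rightarrow> ((nat, 'h) ell2 \<Rightarrow>\<^sub>L (nat, 'h) ell2) set" where
  "stabilization A =
     closure (span {T. \<exists>a\<in>A. \<exists>k\<in>compact_operators. is_tensor_op a k T})"

definition stably_star_isomorphic ::
  "('h::chilbert_space \<Rightarrow>\<^sub>L 'h) set \<Rightarrow> ('k::chilbert_space \<Rightarrow>\<^sub>L 'k) set \<Rightarrow> bool" where
  "stably_star_isomorphic A B \<longleftrightarrow> star_isomorphic (stabilization A) (stabilization B)"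


section \<open>Coarse geometry\<close>

text \<open>Metric spaces are given as subsets of a type of class \<open>metric_space\<close>, with the restricted
  metric.\<close>

definition bounded_geometry :: "'a::metric_space set \<Rightarrow> bool" where
  "bounded_geometry X \<longleftrightarrow>
     (\<forall>R>0. \<exists>N::nat. \<forall>x\<in>X. finite (X \<inter> cball x R) \<and> card (X \<inter> cball x R) \<le> N)"

definition control_function :: "(real \<Rightarrow> real) \<Rightarrow> bool" where
  "control_function \<rho> \<longleftrightarrow>
     \<rho> ` {0..} \<subseteq> {0..} \<and> mono_on {0..} \<rho> \<and> \<not> bdd_above (\<rho> ` {0..})"

definition coarse_embedding ::
  "'a::metric_space set \<Rightarrow> 'b::metric_space set \<Rightarrow> ('a \<Rightarrow> 'b) \<Rightarrow> bool" where
  "coarse_embedding X Y f \<longleftrightarrow> f ` X \<subseteq> Y \<and>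
     (\<exists>\<rho>\<^sub>1 \<rho>\<^sub>2. control_function \<rho>\<^sub>1 \<and> control_function \<rho>\<^sub>2 \<and>
        (\<forall>x\<in>X. \<forall>y\<in>X. \<rho>\<^sub>1 (dist x y) \<le> dist (f x) (f y) \<and> dist (f x) (f y) \<le> \<rho>\<^sub>2 (dist x y)))"

definition coarsely_equivalent :: "'a::metric_space set \<Rightarrow> 'b::metric_space set \<Rightarrow> bool" where
  "coarsely_equivalent X Y \<longleftrightarrow>
     (\<exists>f. coarse_embedding X Y f \<and> (\<exists>C>0. \<forall>y\<in>Y. \<exists>x\<in>X. dist y (f x) \<le> C))"

definition sparse_decomposition :: "'a::metric_space set \<Rightarrow> (nat \<Rightarrow> 'a set) \<Rightarrow> bool" where
  "sparse_decomposition X D \<longleftrightarrow>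
     disjoint_family D \<and> (\<Union>n. D n) = X \<and> (\<forall>n. finite (D n) \<and> D n \<noteq> {}) \<and>
     (\<forall>R. \<exists>N. \<forall>n m. n \<noteq> m \<and> N \<le> n + m \<longrightarrow> R \<le> setdist (D n) (D m))"

definition sparse_space :: "'a::metric_space set \<Rightarrow> bool" where
  "sparse_space X \<longleftrightarrow> (\<exists>D. sparse_decomposition X D)"


section \<open>Roe algebras\<close>

text \<open>For a subset \<open>X\<close> of the type \<open>'a\<close>, the space \<open>\<ell>\<^sup>2(X; H)\<close> is the space of square-summable
  functions on \<open>'a\<close> vanishing outside \<open>X\<close>, and its operators are extended by zero as above.\<close>

definition ell2_on :: "'a set \<Rightarrow> ('a, 'h::chilbert_space) ell2 set" where
  "ell2_on X = {f. \<forall>x. x \<notin> X \<longrightarrow> ell2_fun f x = 0}"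

lift_definition matrix_entry ::
  "(('a, 'h::chilbert_space) ell2 \<Rightarrow>\<^sub>L ('a, 'h) ell2) \<Rightarrow> 'a \<Rightarrow> 'a \<Rightarrow> ('h \<Rightarrow>\<^sub>L 'h)"
  is "\<lambda>T x y v. ell2_fun (T (ell2_single y v)) x"
proof -
  fix T :: "('a, 'h) ell2 \<Rightarrow> ('a, 'h) ell2" and x y :: 'a
  assume T: "bounded_linear T"
  have eval: "bounded_linear (\<lambda>f :: ('a, 'h) ell2. ell2_fun f x)"
    by (rule bounded_linear_intro[where K = 1])
      (simp_all add: plus_ell2.rep_eq scaleR_ell2.rep_eq norm_ell2_fun_le)
  have single: "bounded_linear (ell2_single y :: 'h \<Rightarrow> ('a, 'h) ell2)"
    by (rule bounded_linear_intro[where K = 1])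
      (auto simp: norm_ell2_single ell2_fun_inject[symmetric] fun_eq_iff ell2_single.rep_eq
        plus_ell2.rep_eq scaleR_ell2.rep_eq)
  show "bounded_linear (\<lambda>v. ell2_fun (T (ell2_single y v)) x)"
    by (rule bounded_linear_compose[OF eval bounded_linear_compose[OF T single]])
qed

definition finite_propagation ::
  "(('a::metric_space, 'h::chilbert_space) ell2 \<Rightarrow>\<^sub>L ('a, 'h) ell2) \<Rightarrow> bool" where
  "finite_propagation T \<longleftrightarrow> bdd_above {dist x y | x y. matrix_entry T x y \<noteq> 0}"

text \<open>The argument of type \<open>'h itself\<close> only serves to fix the coefficient Hilbert space.\<close>

definition roe_algebra ::
  "'h::chilbert_space itself \<Rightarrow> 'a::metric_space set \<Rightarrow> (('a, 'h) ell2 \<Rightarrow>\<^sub>L ('a, 'h) ell2) set" where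
  "roe_algebra H\<^sub>0 X = closure {T \<in> op_on (ell2_on X). finite_propagation T \<and>
     (\<forall>x y. matrix_entry T x y \<in> compact_operators)}"

definition uniform_algebra ::
  "'h::chilbert_space itself \<Rightarrow> 'a::metric_space set \<Rightarrow> (('a, 'h) ell2 \<Rightarrow>\<^sub>L ('a, 'h) ell2) set" where
  "uniform_algebra H\<^sub>0 X = closure {T \<in> op_on (ell2_on X). finite_propagation T \<and>
     (\<exists>N. \<forall>x y. rank_at_most (matrix_entry T x y) N)}"

definition stable_roe_algebra ::
  "'h::chilbert_space itself \<Rightarrow> 'a::metric_space set \<Rightarrow> (('a, 'h) ell2 \<Rightarrow>\<^sub>L ('a, 'h) ell2) set" where
  "stable_roe_algebra H\<^sub>0 X = closure {T \<in> op_on (ell2_on X). finite_propagation T \<and>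
     (\<exists>F :: 'h set. finite F \<and> (\<forall>x y. matrix_entry T x y \<in> op_on (cspan F)))}"

definition uniform_roe_algebra ::
  "'a::metric_space set \<Rightarrow> (('a, complex) ell2 \<Rightarrow>\<^sub>L ('a, complex) ell2) set" where
  "uniform_roe_algebra X = closure {T \<in> op_on (ell2_on X). finite_propagation T}"

text \<open>As \<open>\<xi> n\<close> is supported in \<open>D n\<close>, the coefficient \<open>cinner \<eta> (\<xi> n)\<close> is that of the restriction
  of \<open>\<eta>\<close> to \<open>D n\<close>, so the last condition says that \<open>P\<close> is the direct sum of the rank-one projections
  onto the lines spanned by the \<open>\<xi> n\<close>.\<close>

definition block_rank_one_projection ::
  "'a::metric_space set \<Rightarrow> (nat \<Rightarrow> 'a set) \<Rightarrow> (nat \<Rightarrow> ('a, 'h::chilbert_space) ell2) \<Rightarrow>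
   (('a, 'h) ell2 \<Rightarrow>\<^sub>L ('a, 'h) ell2) \<Rightarrow> bool" where
  "block_rank_one_projection X D \<xi> P \<longleftrightarrow> sparse_decomposition X D \<and>
     (\<forall>n. \<xi> n \<in> ell2_on (D n) \<and> norm (\<xi> n) = 1) \<and> P \<in> op_on (ell2_on X) \<and>
     (\<forall>\<eta> n. \<forall>x\<in>D n. ell2_fun (blinfun_apply P \<eta>) x = cinner \<eta> (\<xi> n) *\<^sub>C ell2_fun (\<xi> n) x)"

definition block_rank_one_ghost_projection ::
  "'a::metric_space set \<Rightarrow> (('a, 'h::chilbert_space) ell2 \<Rightarrow>\<^sub>L ('a, 'h) ell2) \<Rightarrow> bool" where
  "block_rank_one_ghost_projection X P \<longleftrightarrow>
     (\<exists>D \<xi>. block_rank_one_projection X D \<xi> P \<and>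
        (\<lambda>n. SUP x\<in>D n. (norm (ell2_fun (\<xi> n) x))\<^sup>2) \<longlonglongrightarrow> 0)"

end

theory Submission
  imports Defs
begin

text \<open>An isomorphism of two of these algebras is implemented by a unitary \<open>U\<close> between the underlying
  Hilbert spaces, as they contain all rank-one operators.  If the vectors \<open>U(x \<otimes> e)\<close>, for a fixed unit
  vector \<open>e\<close>, were not uniformly non-zero at some point of \<open>Y\<close>, a subsequence of them would produce a
  block-rank-one ghost projection in the Roe algebra of a sparse subspace of \<open>Y\<close>.  Choosing such a
  point \<open>f(x)\<close> gives a map \<open>f\<close> from \<open>X\<close> to \<open>Y\<close>; as \<open>U\<close> conjugates operators of finite propagation to norm
  limits of such operators, \<open>f\<close> is a coarse embedding.  Hence \<open>X\<close> has no block-rank-one ghosts either, and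
  the same argument for the inverse of \<open>U\<close> shows that the image of \<open>f\<close> is coarsely dense.

  Conversely, a coarse equivalence collapses fibres of bounded size, and absorbing these in \<open>H\<^sub>0\<close>
  yields a unitary which conjugates the algebras.  The stabilisation of the uniform Roe
  algebra is the stable Roe algebra.\<close>

section \<open>Complex Hilbert spaces\<close>

text \<open>One argument has to serve three algebras whose entries obey different constraints. The
  delicate one is the stable Roe algebra: all entries must live on one finite-dimensional subspace,
  while nothing ties the values of \<open>U(x \<otimes> e)\<close> to such a subspace. The remedy is
  that the projection onto the functions with values in the multiples of \<open>e\<close> belongs to
  each algebra. Its conjugate under \<open>U\<close> fixes every \<open>U(x \<otimes> e)\<close> and
  is a norm limit of constrained operators; so, up to a small error, all these values lie in one
  subspace that the constraint tolerates.

  The control of \<open>f\<close> rests on partial translations. One that moves \<open>x n\<close>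
  to \<open>x' n\<close> over a bounded distance belongs to the algebra; if \<open>f (x n)\<close>
  and \<open>f (x' n)\<close> drifted apart, its conjugate would have entries bounded below
  arbitrarily far from the diagonal, impossible for a norm limit of operators of finite propagation.
  The obstacle is cancellation, as an entry of the conjugate is an infinite sum over all the
  translated points. By Bessel's inequality the cross terms tend to 0, and a thin enough subsequence
  makes their sum smaller than the main term.\<close>

instance chilbert_space \<subseteq> banach ..

lemma cinner_add_right: "cinner x (y + z) = cinner x y + cinner x z"
  by (metis cinner_add_left cinner_commute complex_cnj_add)

lemma cinner_zero_left [simp]: "cinner 0 y = 0"
  using cinner_add_left[of 0 0 y] by simp

lemma cinner_zero_right [simp]: "cinner x 0 = 0"
  using cinner_add_right[of x 0 0] by simp

lemma cinner_minus_left: "cinner (- x) y = - cinner x y"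
  using cinner_add_left[of x "- x" y] by (simp add: eq_neg_iff_add_eq_0 add.commute)

lemma cinner_minus_right: "cinner x (- y) = - cinner x y"
  using cinner_add_right[of x y "- y"] by (simp add: eq_neg_iff_add_eq_0 add.commute)

lemma cinner_diff_left: "cinner (x - y) z = cinner x z - cinner y z"
  using cinner_add_left[of x "- y" z] by (simp add: cinner_minus_left)

lemma cinner_diff_right: "cinner x (y - z) = cinner x y - cinner x z"
  using cinner_add_right[of x y "- z"] by (simp add: cinner_minus_right)

lemma cinner_sum_left: "cinner (sum f A) y = (\<Sum>i\<in>A. cinner (f i) y)"
  by (induction A rule: infinite_finite_induct) (simp_all add: cinner_add_left)

lemma cinner_sum_right: "cinner x (sum f A) = (\<Sum>i\<in>A. cinner x (f i))"
  by (induction A rule: infinite_finite_induct) (simp_all add: cinner_add_right)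

lemma cinner_scaleR_left: "cinner (r *\<^sub>R x) y = complex_of_real r * cinner x y"
  by (simp add: scaleR_scaleC cinner_scaleC_left)

lemma scaleC_zero_left [simp]: "0 *\<^sub>C x = 0"
  by (rule complex_vector.scale_zero_left)

lemma scaleC_zero_right [simp]: "c *\<^sub>C 0 = 0"
  by (rule complex_vector.scale_zero_right)

declare scaleC_one [simp]

lemma scaleC_sum_right: "c *\<^sub>C sum f A = (\<Sum>i\<in>A. c *\<^sub>C f i)"
  by (rule complex_vector.scale_sum_right)

lemma cinner_Cauchy_Schwarz: "cmod (cinner x y) \<le> norm x * norm y"
proof (cases "cinner x y = 0")
  case False
  \<comment> \<open>A unimodular scalar that rotates \<open>cinner x y\<close> onto its modulus, so
    that the real Cauchy-Schwarz inequality for \<open>inner\<close> gives the complex one.\<close>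
  define c where "c = cnj (cinner x y) / cmod (cinner x y)"
  have c: "cmod c = 1" using False by (simp add: c_def norm_divide)
  have "c * cinner x y = cmod (cinner x y)"
    using False
    by (simp add: c_def complex_norm_square[symmetric] mult.commute power2_eq_square)
  then have "cmod (cinner x y) = inner (c *\<^sub>C x) y"
    by (simp add: inner_eq_Re_cinner cinner_scaleC_left)
  also have "\<dots> \<le> norm (c *\<^sub>C x) * norm y" by (rule norm_cauchy_schwarz)
  finally show ?thesis by (simp add: norm_scaleC c)
qed simp

lemma cinner_eq_zero_iff [simp]: "cinner x x = 0 \<longleftrightarrow> x = 0"
  by (simp add: cinner_self)

lemma cinner_ext_left: "(\<And>w. cinner x w = cinner y w) \<Longrightarrow> x = y"
proof -
  assume "\<And>w. cinner x w = cinner y w"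
  then have "cinner (x - y) (x - y) = 0" by (simp add: cinner_diff_left)
  then show ?thesis by simp
qed

lemma cinner_ext_right: "(\<And>w. cinner w x = cinner w y) \<Longrightarrow> x = y"
  by (rule cinner_ext_left) (metis cinner_commute)

lemma bounded_linear_cinner_left: "bounded_linear (\<lambda>x. cinner x y)"
  by (rule bounded_linear_intro[where K = "norm y"])
    (simp_all add: cinner_add_left cinner_scaleR_left scaleR_conv_of_real cinner_Cauchy_Schwarz)

lemma bounded_linear_cinner_right: "bounded_linear (\<lambda>y. cinner x y)"
  by (rule bounded_linear_intro[where K = "norm x"])
    (simp_all add: cinner_add_right scaleR_scaleC cinner_scaleC_right
      cinner_Cauchy_Schwarz mult.commute[of "norm _" "norm x"] scaleC_complex_def)

lemma bounded_linear_scaleC_right: "bounded_linear (\<lambda>v. c *\<^sub>C v)"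
  by (rule bounded_linear_intro[where K = "cmod c"])
    (simp_all add: scaleC_add_right scaleR_scaleC scaleC_scaleC norm_scaleC mult.commute)

lemma bounded_linear_scaleC_left: "bounded_linear (\<lambda>c. c *\<^sub>C v)"
  by (rule bounded_linear_intro[where K = "norm v"])
    (simp_all add: scaleC_add_left scaleR_scaleC scaleC_scaleC norm_scaleC mult.commute
      scaleC_complex_def)

section \<open>Complex-linear operators, adjoint pairs and rank-one operators\<close>

definition clinear_op :: "('h::chilbert_space \<Rightarrow>\<^sub>L 'k::chilbert_space) \<Rightarrow> bool" where
  "clinear_op T \<longleftrightarrow> (\<forall>c v. T (c *\<^sub>C v) = c *\<^sub>C T v)"

lemma clinear_opI: "(\<And>c v. blinfun_apply T (c *\<^sub>C v) = c *\<^sub>C T v) \<Longrightarrow> clinear_op T"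
  by (simp add: clinear_op_def)

lemma clinear_op_scaleC: "clinear_op T \<Longrightarrow> blinfun_apply T (c *\<^sub>C v) = c *\<^sub>C T v"
  by (simp add: clinear_op_def)

lemma bounded_operators_iff: "T \<in> bounded_operators \<longleftrightarrow> clinear_op T"
  by (simp add: bounded_operators_def clinear_op_def)

lemma clinear_op_compose: "clinear_op S \<Longrightarrow> clinear_op T \<Longrightarrow> clinear_op (S o\<^sub>L T)"
  by (simp add: clinear_op_def)

lemma clinear_op_add: "clinear_op S \<Longrightarrow> clinear_op T \<Longrightarrow> clinear_op (S + T)"
  by (simp add: clinear_op_def plus_blinfun.rep_eq scaleC_add_right)

lemma clinear_op_0: "clinear_op 0"
  by (simp add: clinear_op_def)

lemma clinear_op_id: "clinear_op id_blinfun"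
  by (simp add: clinear_op_def)

lemma clinear_op_scaleR: "clinear_op T \<Longrightarrow> clinear_op (r *\<^sub>R T)"
  by (simp add: clinear_op_def scaleR_blinfun.rep_eq scaleR_scaleC scaleC_scaleC mult.commute)

lemma clinear_op_sum: "(\<And>i. i \<in> I \<Longrightarrow> clinear_op (f i)) \<Longrightarrow> clinear_op (sum f I)"
  by (induction I rule: infinite_finite_induct) (simp_all add: clinear_op_0 clinear_op_add)

lemma blinfun_sum_apply: "blinfun_apply (sum f I) v = (\<Sum>i\<in>I. f i v)"
  by (induction I rule: infinite_finite_induct) (simp_all add: plus_blinfun.rep_eq)

lemma closed_clinear_op: "closed {T. clinear_op T}"
proof -
  have "{T. clinear_op T} = (\<Inter>c. \<Inter>v. {T. blinfun_apply T (c *\<^sub>C v) = c *\<^sub>C T v})"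
    by (auto simp: clinear_op_def)
  also have "closed \<dots>"
    by (intro closed_INT ballI closed_Collect_eq
        linear_continuous_on bounded_linear_compose[OF bounded_linear_scaleC_right]
        bounded_linear_intros)
  finally show ?thesis .
qed

text \<open>\<open>is_adjoint\<close> with the arguments exchanged and with two spaces allowed, as
  unitaries between different Hilbert spaces require. Carrying the adjoint along as a second
  operator avoids building it by Riesz representation and makes complex linearity automatic.\<close>

definition adjoint_pair ::
  "('h::chilbert_space \<Rightarrow>\<^sub>L 'k::chilbert_space) \<Rightarrow> ('k \<Rightarrow>\<^sub>L 'h) \<Rightarrow> bool" where
  "adjoint_pair T S \<longleftrightarrow> (\<forall>v w. cinner (T v) w = cinner v (S w))"

lemma adjoint_pairD: "adjoint_pair T S \<Longrightarrow> cinner (T v) w = cinner v (S w)"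
  by (simp add: adjoint_pair_def)

lemma adjoint_pair_sym: "adjoint_pair T S \<Longrightarrow> adjoint_pair S T"
  by (metis adjoint_pair_def cinner_commute)

lemma adjoint_pair_clinear: "adjoint_pair T S \<Longrightarrow> clinear_op T"
  by (rule clinear_opI, rule cinner_ext_left) (simp add: adjoint_pairD cinner_scaleC_left)

lemma is_adjoint_iff: "is_adjoint S T \<longleftrightarrow> adjoint_pair T S"
  by (simp add: is_adjoint_def adjoint_pair_def)

lift_definition rank1 :: "'k::chilbert_space \<Rightarrow> 'h::chilbert_space \<Rightarrow> ('h \<Rightarrow>\<^sub>L 'k)"
  is "\<lambda>v w u. cinner u w *\<^sub>C v"
  by (rule bounded_linear_compose[OF bounded_linear_scaleC_left bounded_linear_cinner_left])

lemma rank1_apply: "rank1 v w u = cinner u w *\<^sub>C v"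
  by (simp add: rank1.rep_eq)

lemma rank1_adjoint: "adjoint_pair (rank1 v w) (rank1 w v)"
  unfolding adjoint_pair_def rank1_apply
  by (metis cinner_commute cinner_scaleC_left cinner_scaleC_right mult.commute)

lemma rank1_clinear: "clinear_op (rank1 v w)"
  by (rule adjoint_pair_clinear[OF rank1_adjoint])

lemma norm_rank1_le: "norm (rank1 v w) \<le> norm v * norm w"
proof (rule norm_blinfun_bound)
  fix u show "norm (blinfun_apply (rank1 v w) u) \<le> norm v * norm w * norm u"
    using mult_right_mono[OF cinner_Cauchy_Schwarz[of u w], of "norm v"]
    by (simp add: rank1_apply norm_scaleC mult_ac)
qed simp

lemma compose_rank1: "clinear_op T \<Longrightarrow> T o\<^sub>L rank1 v w = rank1 (T v) w"
  by (rule blinfun_eqI) (simp add: rank1_apply clinear_op_scaleC)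

lemma rank1_compose: "adjoint_pair T S \<Longrightarrow> rank1 v w o\<^sub>L T = rank1 v (S w)"
  by (rule blinfun_eqI) (simp add: rank1_apply adjoint_pairD)

lemma rank1_diff: "rank1 v w - rank1 v' w' = rank1 (v - v') w + rank1 v' (w - w')"
  by (rule blinfun_eqI)
    (simp add: minus_blinfun.rep_eq plus_blinfun.rep_eq rank1_apply cinner_diff_right
      complex_vector.scale_right_diff_distrib complex_vector.scale_left_diff_distrib)

lemma rank1_0 [simp]: "rank1 0 w = 0" "rank1 v 0 = 0"
  by (rule blinfun_eqI, simp add: rank1_apply)+

lemma rank1_add_left: "rank1 (v + v') w = rank1 v w + rank1 v' w"
  by (rule blinfun_eqI) (simp add: rank1_apply plus_blinfun.rep_eq scaleC_add_right)

lemma rank1_scaleC_left: "rank1 (c *\<^sub>C v) w = op_scaleC c (rank1 v w)"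
  by (rule blinfun_eqI) (simp add: rank1_apply op_scaleC.rep_eq scaleC_scaleC mult.commute)


section \<open>Orthonormal sequences\<close>

definition onseq :: "(nat \<Rightarrow> 'h::chilbert_space) \<Rightarrow> bool" where
  "onseq a \<longleftrightarrow> (\<forall>m n. cinner (a m) (a n) = (if m = n then 1 else 0))"

lemma onseqD: "onseq a \<Longrightarrow> cinner (a m) (a n) = (if m = n then 1 else 0)"
  by (simp add: onseq_def)

lemma onseq_subseq: "onseq a \<Longrightarrow> inj r \<Longrightarrow> onseq (\<lambda>n. a (r n))"
  by (simp add: onseq_def inj_eq)

lemma onseq_norm: "onseq a \<Longrightarrow> norm (a n) = 1"
  using cinner_self[of "a n"]
  by (metis abs_norm_cancel abs_square_eq_1 of_real_eq_1_iff onseqD)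

lemma norm_onseq_sum:
  assumes "onseq a" "finite F"
  shows "(norm (\<Sum>n\<in>F. c n *\<^sub>C a n))\<^sup>2 = (\<Sum>n\<in>F. (cmod (c n))\<^sup>2)"
proof -
  have "complex_of_real ((norm (\<Sum>n\<in>F. c n *\<^sub>C a n))\<^sup>2)
      = (\<Sum>m\<in>F. \<Sum>n\<in>F. c m * cnj (c n) * cinner (a m) (a n))"
    unfolding cinner_self[symmetric] cinner_sum_left
    by (simp add: cinner_sum_right cinner_scaleC_left cinner_scaleC_right
        sum_distrib_left mult_ac)
  also have "\<dots> = (\<Sum>m\<in>F. c m * cnj (c m))"
    using assms by (simp add: onseqD if_distrib cong: if_cong)
  also have "\<dots> = complex_of_real (\<Sum>n\<in>F. (cmod (c n))\<^sup>2)"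
    by (simp only: of_real_sum complex_norm_square)
  finally show ?thesis using of_real_eq_iff by blast
qed

text \<open>Stated for functionals because Riesz representation is only obtained later, from this
  very bound, and because functionals such as evaluation of an operator at a point come without a
  representing vector at hand.\<close>

lemma Bessel_functional:
  fixes a :: "nat \<Rightarrow> 'h::chilbert_space" and g :: "'h \<Rightarrow>\<^sub>L complex"
  assumes a: "onseq a" and F: "finite F" and g: "clinear_op g"
  shows "(\<Sum>n\<in>F. (cmod (g (a n)))\<^sup>2) \<le> (norm g)\<^sup>2"
proof -
  define s where "s = (\<Sum>n\<in>F. (cmod (g (a n)))\<^sup>2)"
  \<comment> \<open>Test vector that turns \<open>g u \<le> norm g * norm u\<close> into
    \<open>s \<le> norm g * sqrt s\<close>, since both \<open>g u\<close> and the square of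
    \<open>norm u\<close> equal \<open>s\<close>.\<close>
  define u where "u = (\<Sum>n\<in>F. cnj (g (a n)) *\<^sub>C a n)"
  have nu: "(norm u)\<^sup>2 = s"
    unfolding u_def s_def by (subst norm_onseq_sum[OF a F]) simp
  have "g u = (\<Sum>n\<in>F. complex_of_real ((cmod (g (a n)))\<^sup>2))"
    unfolding u_def blinfun.sum_right complex_norm_square
    by (simp add: clinear_op_scaleC[OF g] scaleC_complex_def mult.commute)
  then have "g u = complex_of_real s" by (simp add: s_def)
  moreover have "s \<ge> 0" unfolding s_def by (simp add: sum_nonneg)
  ultimately have "s \<le> norm g * norm u"
    using norm_blinfun[of g u] by simp
  then have "s\<^sup>2 \<le> (norm g * norm u)\<^sup>2"
    using \<open>s \<ge> 0\<close> by (rule power_mono)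
  then have "s * s \<le> (norm g)\<^sup>2 * s"
    using nu by (simp add: power_mult_distrib) (simp add: power2_eq_square)
  then show ?thesis
    using \<open>s \<ge> 0\<close> unfolding s_def[symmetric]
    by (cases "s = 0") (auto simp: mult_le_cancel_right)
qed

lift_definition cinner_functional :: "'h::chilbert_space \<Rightarrow> ('h \<Rightarrow>\<^sub>L complex)"
  is "\<lambda>w v. cinner v w" by (rule bounded_linear_cinner_left)

lemma cinner_functional_clinear: "clinear_op (cinner_functional w)"
  by (simp add: clinear_op_def cinner_functional.rep_eq cinner_scaleC_left scaleC_complex_def)

lemma norm_cinner_functional_le: "norm (cinner_functional w) \<le> norm w"
  by (rule norm_blinfun_bound)
    (simp_all add: cinner_functional.rep_eq cinner_Cauchy_Schwarz mult.commute[of "norm w"])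

lemma Bessel:
  assumes "onseq a" "finite F"
  shows "(\<Sum>n\<in>F. (cmod (cinner v (a n)))\<^sup>2) \<le> (norm v)\<^sup>2"
proof -
  have "(\<Sum>n\<in>F. (cmod (cinner v (a n)))\<^sup>2) = (\<Sum>n\<in>F. (cmod (cinner_functional v (a n)))\<^sup>2)"
    by (metis (no_types, lifting) cinner_commute cinner_functional.rep_eq complex_mod_cnj)
  also have "\<dots> \<le> (norm (cinner_functional v))\<^sup>2"
    by (rule Bessel_functional[OF assms cinner_functional_clinear])
  also have "\<dots> \<le> (norm v)\<^sup>2"
    by (rule power_mono[OF norm_cinner_functional_le]) simp
  finally show ?thesis .
qed

lemma summable_square_functional:
  fixes a :: "nat \<Rightarrow> 'h::chilbert_space" and g :: "'h \<Rightarrow>\<^sub>L complex"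
  assumes "onseq a" "clinear_op g"
  shows "summable (\<lambda>n. (cmod (g (a n)))\<^sup>2)"
  by (rule bounded_imp_summable[where B = "(norm g)\<^sup>2"])
    (simp_all add: Bessel_functional[OF assms(1) _ assms(2)])

lemma functional_onseq_tendsto_0:
  fixes a :: "nat \<Rightarrow> 'h::chilbert_space" and g :: "'h \<Rightarrow>\<^sub>L complex"
  assumes "onseq a" "clinear_op g"
  shows "(\<lambda>n. g (a n)) \<longlonglongrightarrow> 0"
proof -
  have "(\<lambda>n. sqrt ((cmod (g (a n)))\<^sup>2)) \<longlonglongrightarrow> sqrt 0"
    by (intro tendsto_real_sqrt summable_LIMSEQ_zero summable_square_functional assms)
  then show ?thesis by (simp add: tendsto_norm_zero_iff)
qed

lemma summable_square_cinner: "onseq a \<Longrightarrow> summable (\<lambda>n. (cmod (cinner v (a n)))\<^sup>2)"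
  by (rule bounded_imp_summable[where B = "(norm v)\<^sup>2"]) (simp_all add: Bessel)

lemma cinner_onseq_tendsto_0:
  assumes "onseq a"
  shows "(\<lambda>n. cinner (a n) v) \<longlonglongrightarrow> 0" "(\<lambda>n. cinner v (a n)) \<longlonglongrightarrow> 0"
proof -
  show *: "(\<lambda>n. cinner (a n) v) \<longlonglongrightarrow> 0"
    using functional_onseq_tendsto_0[OF assms cinner_functional_clinear, of v]
    by (simp add: cinner_functional.rep_eq)
  show "(\<lambda>n. cinner v (a n)) \<longlonglongrightarrow> 0"
    using tendsto_cnj[OF *] by (simp flip: cinner_commute)
qed

lemma summable_onseq:
  assumes a: "onseq a" and c: "summable (\<lambda>n. (cmod (c n))\<^sup>2)"
  shows "summable (\<lambda>n. c n *\<^sub>C a n)"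
  unfolding summable_Cauchy
proof (intro allI impI)
  fix e :: real assume "e > 0"
  then obtain N where N: "\<And>m n. m \<ge> N \<Longrightarrow> norm (\<Sum>i\<in>{m..<n}. (cmod (c i))\<^sup>2) < e\<^sup>2"
    using c unfolding summable_Cauchy by (meson zero_less_power)
  have "norm (\<Sum>i\<in>{m..<n}. c i *\<^sub>C a i) < e" if "m \<ge> N" for m n
  proof (rule power_less_imp_less_base[where n = 2])
    show "(norm (\<Sum>i\<in>{m..<n}. c i *\<^sub>C a i))\<^sup>2 < e\<^sup>2"
      using N[OF that, of n] by (simp add: norm_onseq_sum[OF a])
  qed (use \<open>e > 0\<close> in simp)
  then show "\<exists>N. \<forall>m\<ge>N. \<forall>n. norm (\<Sum>i = m..<n. c i *\<^sub>C a i) < e" by blast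
qed

text \<open>For orthonormal \<open>a\<close> and \<open>b\<close> this is the partial isometry
  taking \<open>a n\<close> to \<open>b n\<close> and killing the orthogonal complement of
  \<open>a\<close>. Partial translations, projections (\<open>a = b\<close>) and the unitaries built
  from bases are all instances.\<close>

definition pisom :: "(nat \<Rightarrow> 'h::chilbert_space) \<Rightarrow> (nat \<Rightarrow> 'k::chilbert_space) \<Rightarrow> ('h \<Rightarrow>\<^sub>L 'k)" where
  "pisom a b = Blinfun (\<lambda>v. \<Sum>n. cinner v (a n) *\<^sub>C b n)"

lemma
  assumes a: "onseq a" and b: "onseq b"
  shows pisom_sums: "(\<lambda>n. cinner v (a n) *\<^sub>C b n) sums (pisom a b v)"
    and norm_pisom_apply_le: "norm (pisom a b v) \<le> norm v"
proof -
  let ?f = "\<lambda>v. \<Sum>n. cinner v (a n) *\<^sub>C b n"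
  have sm: "summable (\<lambda>n. cinner v (a n) *\<^sub>C b n)" for v
    by (rule summable_onseq[OF b summable_square_cinner[OF a]])
  have nm: "norm (?f v) \<le> norm v" for v
  proof (rule LIMSEQ_le_const2)
    show "(\<lambda>N. norm (\<Sum>n<N. cinner v (a n) *\<^sub>C b n)) \<longlonglongrightarrow> norm (?f v)"
      by (intro tendsto_norm summable_LIMSEQ sm)
    have "norm (\<Sum>n<N. cinner v (a n) *\<^sub>C b n) \<le> norm v" for N
      by (rule power2_le_imp_le)
        (simp_all add: norm_onseq_sum[OF b] Bessel[OF a])
    then show "\<exists>N. \<forall>n\<ge>N. norm (\<Sum>n<n. cinner v (a n) *\<^sub>C b n) \<le> norm v" by blast
  qed
  have "bounded_linear ?f"
  proof (rule bounded_linear_intro[where K = 1])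
    show "?f (x + y) = ?f x + ?f y" for x y
      by (simp add: suminf_add[OF sm sm] cinner_add_left scaleC_add_left)
    show "?f (r *\<^sub>R x) = r *\<^sub>R ?f x" for r x
      by (simp add: bounded_linear.suminf[OF bounded_linear_scaleC_right sm] scaleR_scaleC
          cinner_scaleC_left scaleC_scaleC)
  qed (simp add: nm)
  then have eq: "blinfun_apply (pisom a b) = ?f"
    by (simp add: pisom_def bounded_linear_Blinfun_apply)
  show "(\<lambda>n. cinner v (a n) *\<^sub>C b n) sums (pisom a b v)"
    unfolding eq using sm by (rule summable_sums)
  show "norm (pisom a b v) \<le> norm v" unfolding eq by (rule nm)
qed

lemma pisom_adjoint:
  assumes a: "onseq a" and b: "onseq b"
  shows "adjoint_pair (pisom a b) (pisom b a)"
  unfolding adjoint_pair_def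
proof (intro allI)
  fix v w
  have 1: "(\<lambda>n. cinner v (a n) * cinner (b n) w) sums cinner (pisom a b v) w"
    using bounded_linear.sums[OF bounded_linear_cinner_left[of w] pisom_sums[OF a b, of v]]
    by (simp add: cinner_scaleC_left)
  have "(\<lambda>n. cinner (b n) w * cinner v (a n)) sums cinner v (pisom b a w)"
    using bounded_linear.sums[OF bounded_linear_cinner_right[of v] pisom_sums[OF b a, of w]]
    by (simp add: cinner_scaleC_right flip: cinner_commute)
  then show "cinner (pisom a b v) w = cinner v (pisom b a w)"
    using sums_unique2[OF 1] by (simp add: mult.commute)
qed

lemma pisom_clinear: "onseq a \<Longrightarrow> onseq b \<Longrightarrow> clinear_op (pisom a b)"
  by (rule adjoint_pair_clinear[OF pisom_adjoint])

lemma pisom_seq: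
  assumes a: "onseq a" and b: "onseq b"
  shows "pisom a b (a m) = b m"
proof -
  have "(\<lambda>n. cinner (a m) (a n) *\<^sub>C b n) = (\<lambda>n. if n = m then b m else 0)"
    using a by (auto simp: onseqD fun_eq_iff)
  then have "(\<lambda>n. cinner (a m) (a n) *\<^sub>C b n) sums b m"
    using sums_If_finite_set[of "{m}" "\<lambda>n. b m"] by simp
  then show ?thesis using pisom_sums[OF a b] sums_unique2 by blast
qed

text \<open>Each \<open>v\<close> differs from its projection \<open>pisom a a v\<close> by a vector
  orthogonal to all the \<open>a n\<close>, which both operators kill; on the projection they agree
  term by term of the series.\<close>

lemma pisom_eqI:
  assumes "onseq a" "onseq b" and T: "clinear_op T"
    and "\<And>n. T (a n) = b n" and T0: "\<And>v. (\<And>n. cinner v (a n) = 0) \<Longrightarrow> T v = 0"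
  shows "pisom a b = T"
proof (rule blinfun_eqI)
  fix v
  let ?u = "pisom a a v"
  have "cinner (v - ?u) (a n) = 0" for n
    using assms(1) by (simp add: cinner_diff_left adjoint_pairD[OF pisom_adjoint] pisom_seq)
  then have "T v = T ?u" using T0[of "v - ?u"] by (simp add: blinfun.diff_right)
  moreover have "(\<lambda>n. cinner v (a n) *\<^sub>C b n) sums T ?u"
    using bounded_linear.sums[OF blinfun.bounded_linear_right[of T] pisom_sums[OF assms(1,1)]]
    by (simp add: clinear_op_scaleC[OF T] assms)
  ultimately show "pisom a b v = T v"
    using pisom_sums[OF assms(1,2)] sums_unique2 by metis
qed

lemma pisom_orthogonal: "onseq a \<Longrightarrow> onseq b \<Longrightarrow> (\<And>n. cinner v (a n) = 0) \<Longrightarrow> pisom a b v = 0"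
  using pisom_sums[of a b v] sums_unique2[OF _ sums_zero] by simp

lemma pisom_compose:
  assumes "onseq a" "onseq b" "onseq c"
  shows "pisom b c o\<^sub>L pisom a b = pisom a c"
  by (rule sym, rule pisom_eqI)
    (simp_all add: assms clinear_op_compose pisom_clinear pisom_seq pisom_orthogonal)

lemma cinner_total_eqI:
  assumes "\<And>v. (\<And>n. cinner v (a n) = 0) \<Longrightarrow> v = 0" "\<And>n. cinner v (a n) = cinner w (a n)"
  shows "v = w"
  using assms(1)[of "v - w"] assms(2) by (simp add: cinner_diff_left)


section \<open>Total orthonormal sequences, Riesz representation and Gram-Schmidt\<close>

definition total_onseq :: "(nat \<Rightarrow> 'h::chilbert_space) \<Rightarrow> bool" where
  "total_onseq e \<longleftrightarrow> onseq e \<and> (\<forall>v. (\<forall>n. cinner v (e n) = 0) \<longrightarrow> v = 0)"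

lemma pisom_total: "total_onseq e \<Longrightarrow> pisom e e = id_blinfun"
  by (rule pisom_eqI) (auto simp: total_onseq_def clinear_op_id)

lemma total_onseq_sums:
  assumes "total_onseq e" shows "(\<lambda>n. cinner v (e n) *\<^sub>C e n) sums v"
  using pisom_sums[of e e v] assms pisom_total[OF assms] by (simp add: total_onseq_def)

text \<open>The candidate is the series with coefficients \<open>cnj (g (e n))\<close>, which
  converges by the Bessel bound for \<open>g\<close>.\<close>

lemma Riesz_representation:
  fixes g :: "'h::chilbert_space \<Rightarrow>\<^sub>L complex" and e :: "nat \<Rightarrow> 'h"
  assumes e: "total_onseq e" and g: "clinear_op g"
  obtains c where "\<And>v. g v = cinner v c"
proof -
  have oe: "onseq e" using e by (simp add: total_onseq_def)
  have "summable (\<lambda>n. cnj (g (e n)) *\<^sub>C e n)"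
    by (rule summable_onseq[OF oe]) (simp add: summable_square_functional[OF oe g])
  then obtain c where c: "(\<lambda>n. cnj (g (e n)) *\<^sub>C e n) sums c" by (auto simp: summable_def)
  have "g v = cinner v c" for v
  proof -
    have "(\<lambda>n. cinner v (e n) * g (e n)) sums g v"
      using bounded_linear.sums[OF blinfun.bounded_linear_right[of g] total_onseq_sums[OF e, of v]]
      by (simp add: clinear_op_scaleC[OF g] scaleC_complex_def)
    moreover have "(\<lambda>n. cinner v (e n) * g (e n)) sums cinner v c"
      using bounded_linear.sums[OF bounded_linear_cinner_right[of v] c]
      by (simp add: cinner_scaleC_right mult.commute)
    ultimately show ?thesis by (rule sums_unique2)
  qed
  then show ?thesis by (rule that)
qed

text \<open>Sets instead of sequences, for finite bases and for Zorn's lemma.\<close>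

definition onset :: "'h::chilbert_space set \<Rightarrow> bool" where
  "onset B \<longleftrightarrow> (\<forall>b\<in>B. \<forall>c\<in>B. cinner b c = (if b = c then 1 else 0))"

lemma onset_insert:
  assumes B: "onset B" and u: "\<And>b. b \<in> B \<Longrightarrow> cinner u b = 0" "u \<noteq> 0"
  shows "onset (insert (complex_of_real (1 / norm u) *\<^sub>C u) B)"
proof -
  have "cinner b u = 0" if "b \<in> B" for b
    using u(1)[OF that] by (metis cinner_commute complex_cnj_zero)
  moreover have "complex_of_real (1 / norm u) * (complex_of_real (1 / norm u) * cinner u u) = 1"
    using u(2) by (simp add: cinner_self power2_eq_square)
  moreover have "complex_of_real (1 / norm u) *\<^sub>C u \<notin> B"
  proof
    assume "complex_of_real (1 / norm u) *\<^sub>C u \<in> B"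
    then have "complex_of_real (1 / norm u) * cinner u u = 0"
      using u(1) by (metis cinner_scaleC_right complex_cnj_complex_of_real)
    then show False using u(2) by simp
  qed
  ultimately show ?thesis
    using B u(1) by (auto simp: onset_def cinner_scaleC_left cinner_scaleC_right)
qed

lemma onset_residual:
  assumes "onset B" "finite B" "c \<in> B"
  shows "cinner (v - (\<Sum>b\<in>B. cinner v b *\<^sub>C b)) c = 0"
proof -
  have "(\<Sum>b\<in>B. cinner v b * cinner b c) = (\<Sum>b\<in>B. if b = c then cinner v c else 0)"
    using assms by (intro sum.cong) (auto simp: onset_def)
  then show ?thesis
    using assms by (simp add: cinner_diff_left cinner_sum_left cinner_scaleC_left)
qed

lemma onset_orthogonal_cspan:
  assumes "onset B" "finite B" "w \<in> cspan B"
  shows "cinner (v - (\<Sum>b\<in>B. cinner v b *\<^sub>C b)) w = 0"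
proof -
  let ?u = "v - (\<Sum>b\<in>B. cinner v b *\<^sub>C b)"
  have "complex_vector.subspace {w. cinner ?u w = 0}"
    by (auto simp: complex_vector.subspace_def cinner_add_right cinner_scaleC_right)
  then have "cspan B \<subseteq> {w. cinner ?u w = 0}"
    by (intro complex_vector.span_minimal) (auto simp: onset_residual[OF assms(1,2)])
  then show ?thesis using assms(3) by blast
qed

lemma onset_expansion:
  assumes B: "onset B" "finite B" and v: "v \<in> cspan B"
  shows "v = (\<Sum>b\<in>B. cinner v b *\<^sub>C b)"
proof -
  let ?u = "v - (\<Sum>b\<in>B. cinner v b *\<^sub>C b)"
  have "?u \<in> cspan B"
    by (intro complex_vector.span_diff v complex_vector.span_sum complex_vector.span_scale
        complex_vector.span_base)
  then have "cinner ?u ?u = 0" by (rule onset_orthogonal_cspan[OF B])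
  then show ?thesis by simp
qed

lemma Gram_Schmidt:
  assumes "finite F"
  obtains B where "finite B" "onset B" "F \<subseteq> cspan B"
  using assms
proof (induction F arbitrary: thesis)
  case empty
  then show ?case by (metis empty_iff empty_subsetI finite.emptyI onset_def)
next
  case (insert v F)
  obtain B where B: "finite B" "onset B" "F \<subseteq> cspan B" by (rule insert.IH)
  define u where "u = v - (\<Sum>b\<in>B. cinner v b *\<^sub>C b)"
  have s: "(\<Sum>b\<in>B. cinner v b *\<^sub>C b) \<in> cspan B"
    by (intro complex_vector.span_sum complex_vector.span_scale complex_vector.span_base)
  show ?case
  proof (cases "u = 0")
    case True
    then have "v \<in> cspan B" using s by (simp add: u_def)
    then show ?thesis using insert.prems B by blast
  next
    case False
    let ?c = "complex_of_real (1 / norm u)"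
    let ?B = "insert (?c *\<^sub>C u) B"
    have "onset ?B"
      using onset_residual[OF B(2,1)] False by (intro onset_insert B) (auto simp: u_def)
    moreover have sub: "cspan B \<subseteq> cspan ?B" by (rule complex_vector.span_mono) auto
    moreover have "v \<in> cspan ?B"
    proof -
      have "complex_of_real (norm u) *\<^sub>C (?c *\<^sub>C u) \<in> cspan ?B"
        by (intro complex_vector.span_scale complex_vector.span_base) auto
      then have "u \<in> cspan ?B" using False by (simp add: scaleC_scaleC)
      then have "u + (\<Sum>b\<in>B. cinner v b *\<^sub>C b) \<in> cspan ?B"
        using s sub by (intro complex_vector.span_add) auto
      then show ?thesis by (simp add: u_def)
    qed
    ultimately show ?thesis using insert.prems[of ?B] B by auto
  qed
qed

text \<open>The distance is the square root of 2. The weaker bound 1 is what the countability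
  argument uses: points within 1/2 of two different elements of an orthonormal set are
  different.\<close>

lemma onset_dist:
  assumes "onset B" "b \<in> B" "c \<in> B" "b \<noteq> c"
  shows "dist b c > 1"
proof -
  have 1: "cinner b b = 1" "cinner c c = 1" "cinner b c = 0" "cinner c b = 0"
    using assms by (auto simp: onset_def)
  have "complex_of_real ((dist b c)\<^sup>2) = cinner (b - c) (b - c)"
    by (simp only: dist_norm cinner_self)
  also have "\<dots> = complex_of_real 2"
    by (simp add: cinner_diff_left cinner_diff_right 1)
  finally have "(dist b c)\<^sup>2 = 2" using of_real_eq_iff by blast
  then show ?thesis
    by (intro power2_less_imp_less[of 1]) simp_all
qed

text \<open>A maximal orthonormal set from Zorn's lemma is total. It is infinite, since otherwise it
  would span the space, and countable, since distinct elements need distinct approximants in a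
  countable dense set. The assumptions on the coefficient space enter only here.\<close>

lemma exists_total_onseq:
  assumes sep: "separable_space (euclidean :: 'h::chilbert_space topology)"
    and inf: "\<not> (\<exists>F :: 'h::chilbert_space set. finite F \<and> cspan F = UNIV)"
  obtains e :: "nat \<Rightarrow> 'h::chilbert_space" where "total_onseq e"
proof -
  have "\<exists>M\<in>{B :: 'h set. onset B}. \<forall>X\<in>{B. onset B}. M \<subseteq> X \<longrightarrow> X = M"
  proof (rule subset_Zorn')
    fix C assume C: "subset.chain {B :: 'h set. onset B} C"
    have "cinner b c = (if b = c then 1 else 0)" if bc: "b \<in> \<Union>C" "c \<in> \<Union>C" for b c
    proof -
      obtain D1 D2 where "D1 \<in> C" "D2 \<in> C" "b \<in> D1" "c \<in> D2" using bc by blast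
      moreover from this C have "D1 \<subseteq> D2 \<or> D2 \<subseteq> D1" unfolding subset_chain_def by blast
      ultimately obtain D where "D \<in> C" "b \<in> D" "c \<in> D" by blast
      moreover have "onset D" using C \<open>D \<in> C\<close> unfolding subset_chain_def by blast
      ultimately show ?thesis unfolding onset_def by blast
    qed
    then show "\<Union>C \<in> {B. onset B}" by (simp add: onset_def)
  qed
  then obtain B :: "'h set" where B: "onset B" and max: "\<And>X. onset X \<Longrightarrow> B \<subseteq> X \<Longrightarrow> X = B"
    by auto
  have orth: "u = 0" if "\<And>b. b \<in> B \<Longrightarrow> cinner u b = 0" for u
  proof (rule ccontr)
    assume u: "u \<noteq> 0"
    let ?c = "complex_of_real (1 / norm u)"
    have "?c *\<^sub>C u \<in> B"
      using max[OF onset_insert[OF B that u]] by blast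
    then have "cinner u (?c *\<^sub>C u) = 0" by (rule that)
    then show False using u by (simp add: cinner_scaleC_right)
  qed
  have "infinite B"
  proof
    assume fin: "finite B"
    have "v \<in> cspan B" for v
    proof -
      have "v - (\<Sum>b\<in>B. cinner v b *\<^sub>C b) = 0"
        by (rule orth) (rule onset_residual[OF B fin])
      then have "v = (\<Sum>b\<in>B. cinner v b *\<^sub>C b)" by simp
      also have "\<dots> \<in> cspan B"
        by (intro complex_vector.span_sum complex_vector.span_scale complex_vector.span_base)
      finally show ?thesis .
    qed
    then show False using inf fin by auto
  qed
  have "countable B"
  proof -
    obtain C :: "'h set" where C: "countable C" "closure C = UNIV"
      using sep by (auto simp: separable_space_def)
    have "\<exists>c\<in>C. dist c b < 1/2" for b
      using C(2) closure_approachable[THEN iffD1, of b C, rule_format, of "1/2"] by simp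
    then obtain f where f: "\<And>b. f b \<in> C" "\<And>b. dist (f b) b < 1/2" by metis
    have "inj_on f B"
    proof (rule inj_onI, rule ccontr)
      fix b c assume "b \<in> B" "c \<in> B" "f b = f c" "b \<noteq> c"
      then show False
        using onset_dist[OF B, of b c] f(2)[of b] f(2)[of c] dist_triangle3[of b c "f b"]
        by simp
    qed
    moreover have "countable (f ` B)" by (rule countable_subset[OF _ C(1)]) (use f(1) in blast)
    ultimately show ?thesis using countable_image_inj_on by blast
  qed
  then have bij: "bij_betw (from_nat_into B) UNIV B"
    using \<open>infinite B\<close> by (rule bij_betw_from_nat_into)
  have "onseq (from_nat_into B)"
    using B bij_betw_apply[OF bij] inj_eq[OF bij_betw_imp_inj_on[OF bij]]
    unfolding onseq_def onset_def by simp
  moreover have "v = 0" if "\<And>n. cinner v (from_nat_into B n) = 0" for v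
  proof (rule orth)
    fix b assume "b \<in> B"
    then obtain n where "b = from_nat_into B n" using bij unfolding bij_betw_def by blast
    then show "cinner v b = 0" using that by simp
  qed
  ultimately show ?thesis using that[of "from_nat_into B"] by (auto simp: total_onseq_def)
qed


section \<open>Compact operators\<close>

text \<open>Lying in some compact set passes through sums and compositions more easily than
  compactness of a closure.\<close>

lemma compact_operators_iff:
  "T \<in> compact_operators \<longleftrightarrow> clinear_op T \<and> (\<exists>C. compact C \<and> T ` cball 0 1 \<subseteq> C)"
proof -
  have "compact (closure (T ` cball 0 1))" if C: "compact C" "T ` cball 0 1 \<subseteq> C" for C
  proof -
    have "closure (T ` cball 0 1) \<subseteq> C" by (rule closure_minimal[OF C(2) compact_imp_closed[OF C(1)]])
    then have "closure (T ` cball 0 1) = C \<inter> closure (T ` cball 0 1)" by blast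
    then show ?thesis using compact_Int_closed[OF C(1) closed_closure] by metis
  qed
  then show ?thesis
    unfolding compact_operators_def bounded_operators_iff
    by (metis (lifting) closure_subset mem_Collect_eq)
qed

lemma compact_operators_clinear: "T \<in> compact_operators \<Longrightarrow> clinear_op T"
  by (simp add: compact_operators_iff)

lemma compact_operators_0: "0 \<in> compact_operators"
proof -
  have "(\<lambda>x. 0) ` cball 0 1 \<subseteq> {0}" by auto
  then show ?thesis by (auto simp: compact_operators_iff clinear_op_0 intro!: exI[of _ "{0}"])
qed

lemma compact_operators_add:
  assumes "S \<in> compact_operators" "T \<in> compact_operators" shows "S + T \<in> compact_operators"
proof -
  obtain C D where C: "compact C" "S ` cball 0 1 \<subseteq> C" and D: "compact D" "T ` cball 0 1 \<subseteq> D"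
    using assms by (auto simp: compact_operators_iff)
  let ?E = "(\<lambda>z. fst z + snd z) ` (C \<times> D)"
  have "compact ?E" by (intro compact_continuous_image continuous_intros compact_Times C D)
  moreover have "(S + T) v \<in> ?E" if "v \<in> cball 0 1" for v
  proof
    show "(S v, T v) \<in> C \<times> D" using that C(2) D(2) by blast
  qed (simp add: plus_blinfun.rep_eq)
  then have "(S + T) ` cball 0 1 \<subseteq> ?E" by blast
  ultimately show ?thesis using assms by (auto simp: compact_operators_iff clinear_op_add)
qed

lemma compact_operators_sum:
  "(\<And>i. i \<in> I \<Longrightarrow> f i \<in> compact_operators) \<Longrightarrow> sum f I \<in> compact_operators"
  by (induction I rule: infinite_finite_induct)
    (simp_all add: compact_operators_0 compact_operators_add)

lemma compact_operators_compose:
  fixes A :: "'h::chilbert_space \<Rightarrow>\<^sub>L 'k::chilbert_space" and B :: "'k \<Rightarrow>\<^sub>L 'h"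
  assumes K: "K \<in> compact_operators" and A: "clinear_op A" and B: "clinear_op B"
  shows "A o\<^sub>L K o\<^sub>L B \<in> compact_operators"
proof -
  obtain C where C: "compact C" "K ` cball 0 1 \<subseteq> C" using K by (auto simp: compact_operators_iff)
  \<comment> \<open>\<open>B\<close> maps the unit ball into the ball of radius
    \<open>norm B + 1\<close>; the added 1 keeps the factor positive also for \<open>B = 0\<close>,
    so that it can be divided out.\<close>
  let ?D = "(\<lambda>v. (norm B + 1) *\<^sub>R A v) ` C"
  have "compact ?D"
    by (intro compact_continuous_image continuous_intros C)
  moreover have "A (K (B v)) \<in> ?D" if "v \<in> cball 0 1" for v
  proof
    let ?w = "B v /\<^sub>R (norm B + 1)"
    have pos: "norm B + 1 > 0" by (simp add: add_nonneg_pos)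
    have "norm (B v) \<le> norm B * norm v" by (rule norm_blinfun)
    also have "\<dots> \<le> norm B + 1"
      using that mult_left_mono[of "norm v" 1 "norm B"] by simp
    finally have "norm (B v) \<le> norm B + 1" .
    then have "norm (B v) / (norm B + 1) \<le> 1" using pos by simp
    then have "?w \<in> cball 0 1" using pos by (simp add: divide_inverse mult.commute)
    then show "K ?w \<in> C" using C(2) by blast
    show "A (K (B v)) = (norm B + 1) *\<^sub>R A (K ?w)"
      using pos by (simp add: blinfun.scaleR_right)
  qed
  ultimately show ?thesis
    using K A B unfolding compact_operators_iff
    by (intro conjI exI[of _ ?D]) (auto simp: clinear_op_compose)
qed

text \<open>In an orthonormal basis of a finite-dimensional space containing the range, the operator
  splits into summands \<open>rank1 b b o\<^sub>L T\<close>, each mapping the unit ball into a disc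
  of multiples of \<open>b\<close>.\<close>

lemma compact_operators_finite_rank:
  assumes T: "clinear_op T" and F: "finite F" "range T \<subseteq> cspan F"
  shows "T \<in> compact_operators"
proof -
  obtain B where B: "finite B" "onset B" "F \<subseteq> cspan B" using Gram_Schmidt[OF F(1)] .
  have "cspan F \<subseteq> cspan B"
    using B(3) complex_vector.span_minimal complex_vector.subspace_span by blast
  then have "T v = (\<Sum>b\<in>B. cinner (T v) b *\<^sub>C b)" for v
    using F(2) by (intro onset_expansion[OF B(2,1)]) auto
  then have eq: "(\<Sum>b\<in>B. rank1 b b o\<^sub>L T) = T"
    by (intro blinfun_eqI) (simp add: blinfun_sum_apply rank1_apply)
  have "rank1 b b o\<^sub>L T \<in> compact_operators" for b
  proof -
    have "cmod (cinner (T v) b) \<le> norm T * norm b" if "norm v \<le> 1" for v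
    proof -
      have "norm (T v) \<le> norm T"
        using norm_blinfun[of T v] mult_left_mono[OF that, of "norm T"] by simp
      then show ?thesis
        using cinner_Cauchy_Schwarz[of "T v" b] mult_right_mono[of _ _ "norm b"]
        by (meson norm_ge_zero order_trans)
    qed
    moreover have "compact ((\<lambda>c. c *\<^sub>C b) ` cball 0 (norm T * norm b))"
      by (intro compact_continuous_image linear_continuous_on bounded_linear_scaleC_left) simp
    ultimately show ?thesis
      using T unfolding compact_operators_iff
      by (intro conjI exI[of _ "(\<lambda>c. c *\<^sub>C b) ` cball 0 (norm T * norm b)"])
        (auto simp: clinear_op_compose rank1_clinear rank1_apply)
  qed
  then have "(\<Sum>b\<in>B. rank1 b b o\<^sub>L T) \<in> compact_operators" by (intro compact_operators_sum)
  then show ?thesis unfolding eq .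
qed

lemma rank1_compact: "rank1 v w \<in> compact_operators"
proof (rule compact_operators_finite_rank[of _ "{v}"])
  show "range (rank1 v w) \<subseteq> cspan {v}"
    using complex_vector.span_scale[OF complex_vector.span_base[of v "{v}"]]
    by (auto simp: rank1_apply)
qed (simp_all add: rank1_clinear)


section \<open>Operators on spaces of square-summable functions\<close>

lemma norm_ell2_le:
  fixes f :: "('a, 'h::chilbert_space) ell2" and g :: "('a, 'k::chilbert_space) ell2"
  assumes "\<And>x. norm (ell2_fun f x) \<le> C * norm (ell2_fun g x)" "C \<ge> 0"
  shows "norm f \<le> C * norm g"
proof (rule power2_le_imp_le)
  have "(norm f)\<^sup>2 \<le> (\<Sum>\<^sub>\<infinity>x. C\<^sup>2 * (norm (ell2_fun g x))\<^sup>2)"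
    unfolding norm_ell2_sq
    using power_mono[OF assms(1), of _ 2]
    by (intro infsum_mono ell2_summable summable_on_cmult_right) (simp add: power_mult_distrib)
  also have "\<dots> = (C * norm g)\<^sup>2"
    by (simp add: power_mult_distrib norm_ell2_sq infsum_cmult_right')
  finally show "(norm f)\<^sup>2 \<le> (C * norm g)\<^sup>2" .
qed (use assms in simp)

lemma ell2_eqI: "(\<And>x. ell2_fun f x = ell2_fun g x) \<Longrightarrow> f = g"
  by (simp add: ell2_fun_inject[symmetric] fun_eq_iff)

lemma ell2_fun_sum: "ell2_fun (sum f I) x = (\<Sum>i\<in>I. ell2_fun (f i) x)"
  for f :: "'i \<Rightarrow> ('a, 'h::chilbert_space) ell2"
  by (induction I rule: infinite_finite_induct) (simp_all add: zero_ell2.rep_eq plus_ell2.rep_eq)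

lift_definition ell2_eval :: "'a \<Rightarrow> (('a, 'h::chilbert_space) ell2 \<Rightarrow>\<^sub>L 'h)"
  is "\<lambda>x f. ell2_fun f x"
  by (rule bounded_linear_intro[where K = 1])
    (simp_all add: plus_ell2.rep_eq scaleR_ell2.rep_eq norm_ell2_fun_le)

lemma ell2_eval_apply: "ell2_eval x f = ell2_fun f x"
  by (simp add: ell2_eval.rep_eq)

lemma bounded_linear_ell2_fun: "bounded_linear (\<lambda>f. ell2_fun f x :: 'h::chilbert_space)"
  using blinfun.bounded_linear_right[of "ell2_eval x"] by (simp add: ell2_eval_apply)

lemma ell2_eval_clinear: "clinear_op (ell2_eval x)"
  by (simp add: clinear_op_def ell2_eval_apply scaleC_ell2.rep_eq)

lift_definition ell2_pointwise ::
  "('h::chilbert_space \<Rightarrow>\<^sub>L 'k::chilbert_space) \<Rightarrow> ('a, 'h) ell2 \<Rightarrow> ('a, 'k) ell2"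
  is "\<lambda>K f x. K (f x)"
  subgoal premises prems for K f
  proof -
    obtain B where "\<And>x. norm (K x) \<le> norm x * B" using bounded_linear.bounded[OF prems(1)] by blast
    then show ?thesis
      by (intro summable_on_comparison_test[OF summable_on_cmult_left[OF prems(2), of "B\<^sup>2"]])
        (simp_all add: power_mono flip: power_mult_distrib)
  qed
  done

lemma norm_ell2_pointwise_le: "norm (ell2_pointwise K f) \<le> norm K * norm f"
  by (rule norm_ell2_le) (simp_all add: ell2_pointwise.rep_eq norm_blinfun)

lift_definition ell2_map ::
  "('h::chilbert_space \<Rightarrow>\<^sub>L 'k::chilbert_space) \<Rightarrow> (('a, 'h) ell2 \<Rightarrow>\<^sub>L ('a, 'k) ell2)"
  is ell2_pointwise
  subgoal for K
    by (rule bounded_linear_intro[where K = "norm K"])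
      (auto intro!: ell2_eqI simp: ell2_pointwise.rep_eq plus_ell2.rep_eq scaleR_ell2.rep_eq
        blinfun.add_right blinfun.scaleR_right norm_ell2_pointwise_le mult.commute[of _ "norm K"])
  done

lemma ell2_map_apply: "ell2_fun (ell2_map K f) x = K (ell2_fun f x)"
  by (simp add: ell2_map.rep_eq ell2_pointwise.rep_eq)

lemma norm_ell2_map_le: "norm (ell2_map K) \<le> norm K"
  by (rule norm_blinfun_bound) (simp_all add: ell2_map.rep_eq norm_ell2_pointwise_le)

lemma ell2_map_clinear: "clinear_op K \<Longrightarrow> clinear_op (ell2_map K)"
  by (auto simp: clinear_op_def ell2_map_apply scaleC_ell2.rep_eq intro!: ell2_eqI)

lift_definition ell2_restrict :: "'a set \<Rightarrow> ('a, 'h::chilbert_space) ell2 \<Rightarrow> ('a, 'h) ell2"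
  is "\<lambda>S f x. if x \<in> S then f x else 0"
  by (rule summable_on_comparison_test) auto

lift_definition chi :: "'a set \<Rightarrow> (('a, 'h::chilbert_space) ell2 \<Rightarrow>\<^sub>L ('a, 'h) ell2)"
  is ell2_restrict
proof (rule bounded_linear_intro[where K = 1])
  fix S and f :: "('a, 'h) ell2"
  show "norm (ell2_restrict S f) \<le> norm f * 1"
    using norm_ell2_le[of "ell2_restrict S f" 1 f] by (simp add: ell2_restrict.rep_eq)
qed (auto intro!: ell2_eqI simp: ell2_restrict.rep_eq plus_ell2.rep_eq scaleR_ell2.rep_eq)

lemma chi_apply: "ell2_fun (chi S f) x = (if x \<in> S then ell2_fun f x else 0)"
  by (simp add: chi.rep_eq ell2_restrict.rep_eq)

lemma norm_chi_le: "norm (chi S f) \<le> norm f"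
  using norm_ell2_le[of "chi S f" 1 f] by (simp add: chi_apply)

lemma chi_clinear: "clinear_op (chi S)"
  by (auto simp: clinear_op_def chi_apply scaleC_ell2.rep_eq intro!: ell2_eqI)

lemma chi_self_adjoint: "adjoint_pair (chi S) (chi S)"
  by (auto simp: adjoint_pair_def cinner_ell2_def chi_apply intro!: infsum_cong)

lemma chi_fixed_iff: "chi S v = v \<longleftrightarrow> v \<in> ell2_on S"
proof
  assume "chi S v = v"
  then have "ell2_fun v x = 0" if "x \<notin> S" for x using that by (metis chi_apply)
  then show "v \<in> ell2_on S" by (simp add: ell2_on_def)
qed (auto simp: ell2_on_def chi_apply intro!: ell2_eqI)

lemma chi_in: "chi S v \<in> ell2_on S"
  by (simp add: ell2_on_def chi_apply)

lemma single_apply: "ell2_fun (ell2_single y v) x = (if x = y then v else 0)"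
  by (simp add: ell2_single.rep_eq)

lemma chi_single: "chi S (ell2_single y v) = (if y \<in> S then ell2_single y v else 0)"
  by (rule ell2_eqI) (simp add: chi_apply single_apply zero_ell2.rep_eq)

lemma single_scaleC: "ell2_single y (c *\<^sub>C v) = c *\<^sub>C ell2_single y v"
  by (rule ell2_eqI) (simp add: single_apply scaleC_ell2.rep_eq)

lift_definition ell2_inj :: "'a \<Rightarrow> ('h::chilbert_space \<Rightarrow>\<^sub>L ('a, 'h) ell2)" is "ell2_single"
  by (rule bounded_linear_intro[where K = 1])
    (auto intro!: ell2_eqI simp: single_apply plus_ell2.rep_eq scaleR_ell2.rep_eq norm_ell2_single)

lemma ell2_inj_apply: "ell2_inj y v = ell2_single y v"
  by (simp add: ell2_inj.rep_eq)

lemma ell2_inj_clinear: "clinear_op (ell2_inj y)"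
  by (simp add: clinear_op_def ell2_inj_apply single_scaleC)

lemma cinner_single_left: "cinner (ell2_single y v) f = cinner v (ell2_fun f y)"
proof -
  have "cinner (ell2_single y v) f = (\<Sum>\<^sub>\<infinity>x\<in>{y}. cinner v (ell2_fun f x))"
    unfolding cinner_ell2_def by (rule infsum_cong_neutral) (auto simp: single_apply)
  then show ?thesis by simp
qed

lemma cinner_single_right: "cinner f (ell2_single y v) = cinner (ell2_fun f y) v"
  by (metis cinner_commute cinner_single_left)

lemma chi_finite_sum: "finite F \<Longrightarrow> chi F f = (\<Sum>x\<in>F. ell2_single x (ell2_fun f x))"
  by (rule ell2_eqI) (simp add: chi_apply ell2_fun_sum single_apply)

lemma cinner_chi_complement: "cinner (chi S f) (f - chi S f) = 0"
proof -
  have "cinner (chi S f) (f - chi S f) = cinner f (chi S f - chi S (chi S f))"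
    by (simp add: adjoint_pairD[OF chi_self_adjoint] blinfun.diff_right)
  also have "chi S (chi S f) = chi S f" by (simp add: chi_fixed_iff chi_in)
  finally show ?thesis by simp
qed

lemma norm_chi_Pythagoras: "(norm f)\<^sup>2 = (norm (chi S f))\<^sup>2 + (norm (f - chi S f))\<^sup>2"
proof -
  have "orthogonal (chi S f) (f - chi S f)"
    by (simp add: orthogonal_def inner_eq_Re_cinner cinner_chi_complement)
  from norm_add_Pythagorean[OF this] show ?thesis by simp
qed

lemma ell2_finite_approx:
  fixes f :: "('a, 'h::chilbert_space) ell2"
  assumes "e > 0"
  obtains F where "finite F" "\<And>G. F \<subseteq> G \<Longrightarrow> norm (f - chi G f) < e"
proof -
  let ?g = "\<lambda>x. (norm (ell2_fun f x))\<^sup>2"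
  have "(?g has_sum (norm f)\<^sup>2) UNIV"
    unfolding norm_ell2_sq by (rule has_sum_infsum[OF ell2_summable])
  then have "eventually (\<lambda>F. dist (sum ?g F) ((norm f)\<^sup>2) < e\<^sup>2) (finite_subsets_at_top UNIV)"
    using assms unfolding has_sum_def tendsto_iff by simp
  then obtain F where F: "finite F" "dist (sum ?g F) ((norm f)\<^sup>2) < e\<^sup>2"
    unfolding eventually_finite_subsets_at_top by auto
  have "norm (f - chi G f) < e" if "F \<subseteq> G" for G
  proof (rule power_less_imp_less_base[where n = 2])
    have "sum ?g F = (\<Sum>x\<in>F. (norm (ell2_fun (chi G f) x))\<^sup>2)"
      using that by (intro sum.cong) (auto simp: chi_apply)
    also have "\<dots> \<le> (norm (chi G f))\<^sup>2" by (rule sum_norm_sq_le_norm_ell2[OF F(1)])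
    finally show "(norm (f - chi G f))\<^sup>2 < e\<^sup>2"
      using F(2) norm_chi_Pythagoras[of f G] unfolding dist_real_def by linarith
  qed (use assms in simp)
  then show ?thesis using that F(1) by blast
qed

text \<open>Finitely supported functions are dense, and each of them is a finite sum of one-point
  functions.\<close>

lemma ell2_blinfun_eqI:
  fixes S T :: "('a, 'h::chilbert_space) ell2 \<Rightarrow>\<^sub>L 'k::real_normed_vector"
  assumes "\<And>y v. S (ell2_single y v) = T (ell2_single y v)"
  shows "S = T"
proof (rule blinfun_eqI)
  fix f
  let ?D = "S - T"
  have fin: "?D (chi F f) = 0" if "finite F" for F
    using assms by (simp add: chi_finite_sum[OF that] blinfun.sum_right minus_blinfun.rep_eq)
  have "norm (?D f) \<le> e" if e: "e > 0" for e
  proof -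
    have pos: "norm ?D + 1 > 0" by (simp add: add_nonneg_pos)
    then obtain F where F: "finite F" "norm (f - chi F f) < e / (norm ?D + 1)"
      using ell2_finite_approx[of "e / (norm ?D + 1)" f] e by (metis divide_pos_pos order_refl)
    have "?D f = ?D (f - chi F f)" using fin[OF F(1)] by (simp add: blinfun.diff_right)
    also have "norm \<dots> \<le> norm ?D * norm (f - chi F f)" by (rule norm_blinfun)
    also have "\<dots> \<le> norm ?D * (e / (norm ?D + 1))"
      using F(2) by (intro mult_left_mono) auto
    also have "\<dots> \<le> e" using pos e by (simp add: field_simps)
    finally show ?thesis .
  qed
  then have "norm (?D f) = 0" by (metis field_le_epsilon add_0 norm_le_zero_iff norm_eq_zero)
  then show "S f = T f" by (simp add: minus_blinfun.rep_eq)
qed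

section \<open>Matrix entries and operators supported on a subset\<close>

lemma matrix_entry_apply: "matrix_entry T x y v = ell2_fun (T (ell2_single y v)) x"
  by (simp add: matrix_entry.rep_eq)

lemma matrix_entry_conv: "matrix_entry T x y = ell2_eval x o\<^sub>L T o\<^sub>L ell2_inj y"
  by (rule blinfun_eqI) (simp add: matrix_entry_apply ell2_eval_apply ell2_inj_apply)

lemma matrix_entry_clinear: "clinear_op T \<Longrightarrow> clinear_op (matrix_entry T x y)"
  unfolding matrix_entry_conv
  by (intro clinear_op_compose ell2_eval_clinear ell2_inj_clinear)

lemma cinner_matrix_entry:
  "cinner (blinfun_apply T (ell2_single y v)) (ell2_single x w) = cinner (matrix_entry T x y v) w"
  by (simp add: cinner_single_right matrix_entry_apply)

lemma matrix_entry_eqI: "(\<And>x y. matrix_entry S x y = matrix_entry T x y) \<Longrightarrow> S = T"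
  by (rule ell2_blinfun_eqI, rule ell2_eqI) (metis matrix_entry_apply)

lemma matrix_entry_add: "matrix_entry (S + T) x y = matrix_entry S x y + matrix_entry T x y"
  by (rule blinfun_eqI) (simp add: matrix_entry_apply plus_blinfun.rep_eq plus_ell2.rep_eq)

lemma matrix_entry_scaleR: "matrix_entry (r *\<^sub>R T) x y = r *\<^sub>R matrix_entry T x y"
  by (rule blinfun_eqI) (simp add: matrix_entry_apply scaleR_blinfun.rep_eq scaleR_ell2.rep_eq)

lemma matrix_entry_0 [simp]: "matrix_entry 0 x y = 0"
  by (rule blinfun_eqI) (simp add: matrix_entry_apply zero_ell2.rep_eq)

lemma matrix_entry_sum: "matrix_entry (sum f I) x y = (\<Sum>i\<in>I. matrix_entry (f i) x y)"
  by (induction I rule: infinite_finite_induct) (simp_all add: matrix_entry_add)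

lemma matrix_entry_rank1:
  "matrix_entry (rank1 f g) x y = rank1 (ell2_fun f x) (ell2_fun g y)"
  by (rule blinfun_eqI)
    (simp add: matrix_entry_apply rank1_apply scaleC_ell2.rep_eq cinner_single_left)

lemma matrix_entry_chi:
  "matrix_entry (chi S o\<^sub>L T o\<^sub>L chi S') x y
    = (if x \<in> S \<and> y \<in> S' then matrix_entry T x y else 0)"
  by (rule blinfun_eqI) (simp add: matrix_entry_apply chi_apply chi_single zero_ell2.rep_eq)

lemma matrix_entry_ell2_map:
  "matrix_entry (ell2_map A o\<^sub>L T o\<^sub>L ell2_map B) x y = A o\<^sub>L matrix_entry T x y o\<^sub>L B"
proof (rule blinfun_eqI)
  fix v
  have "ell2_map B (ell2_single y v) = ell2_single y (B v)"
    by (rule ell2_eqI) (simp add: ell2_map_apply single_apply)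
  then show "matrix_entry (ell2_map A o\<^sub>L T o\<^sub>L ell2_map B) x y v
    = (A o\<^sub>L matrix_entry T x y o\<^sub>L B) v"
    by (simp add: matrix_entry_apply ell2_map_apply)
qed

text \<open>\<open>chi X\<close> is the orthogonal projection onto \<open>ell2_on X\<close>, so
  vanishing on the orthogonal complement amounts to absorbing \<open>chi X\<close> from the right.
  The equational form visibly passes to norm limits.\<close>

lemma op_on_ell2_on_iff:
  "T \<in> op_on (ell2_on X) \<longleftrightarrow> clinear_op T \<and> chi X o\<^sub>L T = T \<and> T o\<^sub>L chi X = T"
proof
  assume T: "T \<in> op_on (ell2_on X)"
  have "T v = T (chi X v)" for v
  proof -
    have "cinner (v - chi X v) w = 0" if "w \<in> ell2_on X" for w
    proof -
      have "cinner (v - chi X v) (chi X w) = 0"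
        using adjoint_pairD[OF chi_self_adjoint, of X "v - chi X v" w, symmetric]
        by (simp add: blinfun.diff_right chi_fixed_iff[THEN iffD2, OF chi_in])
      then show ?thesis using that chi_fixed_iff by metis
    qed
    then have "T (v - chi X v) = 0" using T by (simp add: op_on_def)
    then show ?thesis by (simp add: blinfun.diff_right)
  qed
  moreover have "chi X (T v) = T v" for v using T by (simp add: op_on_def chi_fixed_iff)
  ultimately show "clinear_op T \<and> chi X o\<^sub>L T = T \<and> T o\<^sub>L chi X = T"
    using T by (auto simp: op_on_def bounded_operators_iff intro!: blinfun_eqI)
next
  assume T: "clinear_op T \<and> chi X o\<^sub>L T = T \<and> T o\<^sub>L chi X = T"
  have "T v \<in> ell2_on X" for v
    using T chi_in by (metis blinfun_apply_blinfun_compose)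
  moreover have "T v = 0" if v: "\<And>w. w \<in> ell2_on X \<Longrightarrow> cinner v w = 0" for v
  proof -
    have "chi X v = 0"
    proof (rule cinner_ext_left)
      fix w show "cinner (chi X v) w = cinner 0 w"
        using v[OF chi_in] by (simp add: adjoint_pairD[OF chi_self_adjoint])
    qed
    then show ?thesis using T by (metis blinfun_apply_blinfun_compose blinfun.zero_right)
  qed
  ultimately show "T \<in> op_on (ell2_on X)"
    using T by (simp add: op_on_def bounded_operators_iff)
qed

lemma op_on_ell2_on_clinear: "T \<in> op_on (ell2_on X) \<Longrightarrow> clinear_op T"
  by (simp add: op_on_ell2_on_iff)

lemma op_on_ell2_on_apply:
  assumes "T \<in> op_on (ell2_on X)"
  shows "chi X (T v) = T v" "T (chi X v) = T v"
  using assms by (metis op_on_ell2_on_iff blinfun_apply_blinfun_compose)+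

lemma op_on_ell2_on_entryI:
  assumes "clinear_op T" "\<And>x y. \<not> (x \<in> X \<and> y \<in> X) \<Longrightarrow> matrix_entry T x y = 0"
  shows "T \<in> op_on (ell2_on X)"
proof -
  have *: "chi X o\<^sub>L T o\<^sub>L chi X = T"
    by (rule matrix_entry_eqI) (use assms(2) in \<open>auto simp: matrix_entry_chi\<close>)
  have Tv: "T v = chi X (T (chi X v))" for v
    using arg_cong[OF *, of "\<lambda>S. blinfun_apply S v"] by simp
  have cc: "chi X (chi X v) = chi X v" for v :: "('a, 'b) ell2"
    by (simp add: chi_fixed_iff chi_in)
  have "chi X (T v) = T v" for v using Tv[of v] cc by metis
  moreover have "T (chi X v) = T v" for v using Tv[of v] Tv[of "chi X v"] cc by metis
  ultimately show ?thesis using assms(1) by (auto simp: op_on_ell2_on_iff intro!: blinfun_eqI)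
qed

lemma op_on_ell2_on_entry_0:
  assumes "T \<in> op_on (ell2_on X)" "\<not> (x \<in> X \<and> y \<in> X)"
  shows "matrix_entry T x y = 0"
proof -
  have "chi X o\<^sub>L T o\<^sub>L chi X = T" using assms(1) by (simp add: op_on_ell2_on_iff)
  then show ?thesis using matrix_entry_chi[of X T X x y] assms(2) by simp
qed

lemma op_on_ell2_on_add:
  "S \<in> op_on (ell2_on X) \<Longrightarrow> T \<in> op_on (ell2_on X) \<Longrightarrow> S + T \<in> op_on (ell2_on X)"
  by (intro op_on_ell2_on_entryI)
    (auto simp: op_on_ell2_on_clinear clinear_op_add matrix_entry_add op_on_ell2_on_entry_0)

lemma op_on_ell2_on_scaleR: "T \<in> op_on (ell2_on X) \<Longrightarrow> r *\<^sub>R T \<in> op_on (ell2_on X)"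
  by (intro op_on_ell2_on_entryI)
    (auto simp: op_on_ell2_on_clinear clinear_op_scaleR matrix_entry_scaleR op_on_ell2_on_entry_0)

lemma closed_op_on_ell2_on: "closed (op_on (ell2_on X))"
proof -
  have "op_on (ell2_on X) = {T. clinear_op T} \<inter> {T. chi X o\<^sub>L T = T} \<inter> {T. T o\<^sub>L chi X = T}"
    by (auto simp: op_on_ell2_on_iff)
  also have "closed \<dots>"
    by (intro closed_Int closed_clinear_op closed_Collect_eq continuous_intros
        linear_continuous_on bounded_bilinear.bounded_linear_left[OF bounded_bilinear_blinfun_compose]
        bounded_bilinear.bounded_linear_right[OF bounded_bilinear_blinfun_compose])
  finally show ?thesis .
qed

lemma matrix_row:
  assumes T: "T \<in> op_on (ell2_on X)" and F: "finite F"
    and 0: "\<And>y. y \<notin> F \<Longrightarrow> matrix_entry T x y = 0"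
  shows "ell2_fun (T f) x = (\<Sum>y\<in>F. matrix_entry T x y (ell2_fun f y))"
proof -
  have "ell2_eval x o\<^sub>L T = (\<Sum>y\<in>F. matrix_entry T x y o\<^sub>L ell2_eval y)"
  proof (rule ell2_blinfun_eqI)
    fix y v
    have "matrix_entry T x y v = (\<Sum>z\<in>F. if z = y then matrix_entry T x y v else 0)"
      using F 0[of y] by auto
    also have "\<dots> = (\<Sum>z\<in>F. matrix_entry T x z (ell2_fun (ell2_single y v) z))"
      by (rule sum.cong) (auto simp: single_apply)
    finally show "(ell2_eval x o\<^sub>L T) (ell2_single y v)
      = (\<Sum>y\<in>F. matrix_entry T x y o\<^sub>L ell2_eval y) (ell2_single y v)"
      by (simp add: blinfun_sum_apply ell2_eval_apply matrix_entry_apply)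
  qed
  from arg_cong[OF this, of "\<lambda>g. blinfun_apply g f"] show ?thesis
    by (simp add: blinfun_sum_apply ell2_eval_apply)
qed


section \<open>Spatial implementation of isomorphisms\<close>

lemma star_isomorphic_trans:
  assumes "star_isomorphic A B" "star_isomorphic B C" shows "star_isomorphic A C"
proof -
  obtain \<phi> \<psi> where \<phi>: "star_isomorphism A B \<phi>" and \<psi>: "star_isomorphism B C \<psi>"
    using assms by (auto simp: star_isomorphic_def)
  have mem: "\<phi> T \<in> B" if "T \<in> A" for T
    using \<phi> that by (auto simp: star_isomorphism_def bij_betw_def)
  have "star_isomorphism A C (\<lambda>T. \<psi> (\<phi> T))"
    using \<phi> \<psi> mem bij_betw_trans[of \<phi> A B \<psi> C] unfolding star_isomorphism_def
    by (simp add: comp_def)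
  then show ?thesis by (auto simp: star_isomorphic_def)
qed

lemma op_scaleC_apply: "op_scaleC c T v = c *\<^sub>C T v"
  by (simp add: op_scaleC.rep_eq)

text \<open>For projections \<open>P\<close> and \<open>Q\<close>, \<open>U\<close> is a unitary
  from the range of \<open>P\<close> to that of \<open>Q\<close>, extended by zero. The extension is
  forced by realising the Hilbert space of \<open>X\<close> inside the functions on a whole
  type.\<close>

definition partial_unitary ::
  "('h::chilbert_space \<Rightarrow>\<^sub>L 'h) \<Rightarrow> ('k::chilbert_space \<Rightarrow>\<^sub>L 'k) \<Rightarrow> ('h \<Rightarrow>\<^sub>L 'k) \<Rightarrow> ('k \<Rightarrow>\<^sub>L 'h) \<Rightarrow> bool"
where
  "partial_unitary P Q U V \<longleftrightarrow> adjoint_pair U V \<and> V o\<^sub>L U = P \<and> U o\<^sub>L V = Q"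

lemma partial_unitary_sym: "partial_unitary P Q U V \<Longrightarrow> partial_unitary Q P V U"
  by (auto simp: partial_unitary_def adjoint_pair_sym)

lemma partial_unitary_apply:
  assumes "partial_unitary P Q U V" shows "V (U v) = P v" "U (V w) = Q w"
  using assms by (metis partial_unitary_def blinfun_apply_blinfun_compose)+

lemma partial_unitary_star_isomorphism:
  assumes U: "partial_unitary P Q U V"
    and A: "\<And>T. T \<in> A \<Longrightarrow> P o\<^sub>L T = T \<and> T o\<^sub>L P = T"
    and B: "\<And>T. T \<in> B \<Longrightarrow> Q o\<^sub>L T = T \<and> T o\<^sub>L Q = T"
    and AB: "\<And>T. T \<in> A \<Longrightarrow> U o\<^sub>L T o\<^sub>L V \<in> B"
    and BA: "\<And>T. T \<in> B \<Longrightarrow> V o\<^sub>L T o\<^sub>L U \<in> A"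
  shows "star_isomorphism A B (\<lambda>T. U o\<^sub>L T o\<^sub>L V)"
proof -
  have adj: "adjoint_pair U V" using U by (simp add: partial_unitary_def)
  have PA: "P (T v) = T v" "T (P v) = T v" if "T \<in> A" for T v
    using A[OF that] by (metis blinfun_apply_blinfun_compose)+
  have QB: "Q (T v) = T v" "T (Q v) = T v" if "T \<in> B" for T v
    using B[OF that] by (metis blinfun_apply_blinfun_compose)+
  note VU = partial_unitary_apply[OF U]
  have "bij_betw (\<lambda>T. U o\<^sub>L T o\<^sub>L V) A B"
    by (rule bij_betw_byWitness[where f' = "\<lambda>T. V o\<^sub>L T o\<^sub>L U"])
      (auto simp: AB BA VU PA QB intro!: blinfun_eqI)
  moreover have "adjoint_pair (U o\<^sub>L T o\<^sub>L V) (U o\<^sub>L S o\<^sub>L V)" if "adjoint_pair T S" for S T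
    by (simp add: adjoint_pair_def adjoint_pairD[OF adj] adjoint_pairD[OF that]
        adjoint_pairD[OF adjoint_pair_sym[OF adj]])
  ultimately show ?thesis
    unfolding star_isomorphism_def is_adjoint_iff
    using clinear_op_scaleC[OF adjoint_pair_clinear[OF adj]]
    by (auto intro!: blinfun_eqI simp: plus_blinfun.rep_eq blinfun.add_right op_scaleC_apply VU PA)
qed

text \<open>The minimal projection \<open>|e\<rangle>\<langle>e|\<close> goes to a minimal projection \<open>|f\<rangle>\<langle>f|\<close>, and the unitary sends
  \<open>v\<close> to the image of \<open>f\<close> under \<open>\<phi>(|v\<rangle>\<langle>e|)\<close>.\<close>

lemma star_isomorphism_spatial:
  fixes P :: "'h::chilbert_space \<Rightarrow>\<^sub>L 'h" and Q :: "'k::chilbert_space \<Rightarrow>\<^sub>L 'k"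
  assumes iso: "star_isomorphism A B \<phi>"
    and P: "adjoint_pair P P" and PP: "\<And>v. P (P v) = P v"
    and Q: "adjoint_pair Q Q" and QQ: "\<And>v. Q (Q v) = Q v"
    and A: "\<And>T. T \<in> A \<Longrightarrow> clinear_op T \<and> P o\<^sub>L T = T \<and> T o\<^sub>L P = T"
    and B: "\<And>T. T \<in> B \<Longrightarrow> clinear_op T \<and> Q o\<^sub>L T = T \<and> T o\<^sub>L Q = T"
    and rA: "\<And>v w. rank1 (P v) (P w) \<in> A" and rB: "\<And>v w. rank1 (Q v) (Q w) \<in> B"
    and e: "P e = e" "norm e = 1"
  obtains U V where "partial_unitary P Q U V" "\<And>T. T \<in> A \<Longrightarrow> \<phi> T = U o\<^sub>L T o\<^sub>L V"
proof -
  have ee: "cinner e e = 1" by (simp add: cinner_self e)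
  have bij: "bij_betw \<phi> A B"
    and add: "\<And>S T. S \<in> A \<Longrightarrow> T \<in> A \<Longrightarrow> \<phi> (S + T) = \<phi> S + \<phi> T"
    and scale: "\<And>c T. T \<in> A \<Longrightarrow> \<phi> (op_scaleC c T) = op_scaleC c (\<phi> T)"
    and mult: "\<And>S T. S \<in> A \<Longrightarrow> T \<in> A \<Longrightarrow> \<phi> (S o\<^sub>L T) = \<phi> S o\<^sub>L \<phi> T"
    and adj: "\<And>S T. S \<in> A \<Longrightarrow> T \<in> A \<Longrightarrow> adjoint_pair T S \<Longrightarrow> adjoint_pair (\<phi> T) (\<phi> S)"
    using iso by (auto simp: star_isomorphism_def is_adjoint_iff)
  have \<phi>B: "\<phi> T \<in> B" if "T \<in> A" for T using bij that by (rule bij_betw_apply)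
  have PA: "P (T v) = T v" "T (P v) = T v" if "T \<in> A" for T v
    using A[OF that] by (metis blinfun_apply_blinfun_compose)+
  have QB: "Q (T v) = T v" "T (Q v) = T v" if "T \<in> B" for T v
    using B[OF that] by (metis blinfun_apply_blinfun_compose)+
  have rA': "rank1 (P v) e \<in> A" "rank1 e (P v) \<in> A" for v
    using rA[of v e] rA[of e v] by (simp_all add: e)
  have rAe: "rank1 e e \<in> A" using rA[of e e] by (simp add: e)
  have 0: "0 \<in> A" using rA[of 0 0] by simp
  have op0: "op_scaleC 0 T = 0" for T :: "'x::chilbert_space \<Rightarrow>\<^sub>L 'x"
    by (rule blinfun_eqI) (simp add: op_scaleC_apply)
  have \<phi>0: "\<phi> 0 = 0" using scale[OF 0, of 0] by (simp add: op0)
  define q where "q = \<phi> (rank1 e e)"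
  have qB: "q \<in> B" unfolding q_def by (rule \<phi>B[OF rAe])
  have "rank1 e e o\<^sub>L rank1 e e = rank1 e e"
    by (simp add: compose_rank1 rank1_clinear rank1_apply ee)
  then have qq: "q (q w) = q w" for w
    using mult[OF rAe rAe] unfolding q_def by (metis blinfun_apply_blinfun_compose)
  have "rank1 e e e = e" by (simp add: rank1_apply ee)
  then have "rank1 e e \<noteq> 0" using e(2) by auto
  then have "q \<noteq> 0"
    using bij rAe 0 \<phi>0 unfolding q_def bij_betw_def inj_on_def by metis
  then obtain w0 where w0: "q w0 \<noteq> 0" by (metis blinfun_eqI zero_blinfun.rep_eq)
  define f where "f = (1 / norm (q w0)) *\<^sub>R q w0"
  have nf: "norm f = 1" using w0 by (simp add: f_def)
  have ff: "cinner f f = 1" by (simp add: cinner_self nf)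
  have qf: "q f = f" by (simp add: f_def blinfun.scaleR_right qq)
  have Qf: "Q f = f" using QB(1)[OF qB, of f] qf by simp
  \<comment> \<open>Minimality is pulled back along \<open>\<phi>\<close>:
    \<open>rank1 f f = \<phi> s\<close> is unchanged by compression with \<open>q\<close>, and
    compressing \<open>s\<close> with \<open>rank1 e e\<close> leaves a multiple of
    \<open>rank1 e e\<close>. So \<open>rank1 f f\<close> is a multiple of \<open>q\<close>, and
    evaluation at \<open>f\<close> shows that the factor is 1.\<close>
  have qrank: "q = rank1 f f"
  proof -
    have "rank1 f f \<in> \<phi> ` A"
      using rB[of f f] unfolding bij_betw_imp_surj_on[OF bij] by (simp add: Qf)
    then obtain s where s: "s \<in> A" "\<phi> s = rank1 f f" by (metis imageE)
    have "q o\<^sub>L rank1 f f = rank1 f f" using B[OF qB] by (simp add: compose_rank1 qf)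
    moreover have "rank1 f f o\<^sub>L q = rank1 f f"
    proof -
      have "adjoint_pair q q" unfolding q_def by (rule adj[OF rAe rAe rank1_adjoint])
      then show ?thesis by (simp add: rank1_compose qf)
    qed
    ultimately have "\<phi> (rank1 e e o\<^sub>L (s o\<^sub>L rank1 e e)) = \<phi> s"
    proof -
      have sA: "s o\<^sub>L rank1 e e \<in> A"
        using rA'(1)[of "s e"] A[OF s(1)] PA[OF s(1)] by (simp add: compose_rank1)
      show ?thesis
        using mult[OF rAe sA] mult[OF s(1) rAe] s(2)
          \<open>q o\<^sub>L rank1 f f = rank1 f f\<close> \<open>rank1 f f o\<^sub>L q = rank1 f f\<close>
        by (simp add: q_def)
    qed
    moreover have "rank1 e e o\<^sub>L (s o\<^sub>L rank1 e e) = op_scaleC (cinner (s e) e) (rank1 e e)"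
      using A[OF s(1)] by (simp add: compose_rank1 rank1_clinear rank1_apply rank1_scaleC_left)
    ultimately have "rank1 f f = op_scaleC (cinner (s e) e) q"
      using scale[OF rAe] s(2) by (simp add: q_def)
    from arg_cong[OF this, of "\<lambda>T. blinfun_apply T f"]
    have "f = cinner (s e) e *\<^sub>C f" by (simp add: rank1_apply op_scaleC_apply qf ff)
    then have "cinner (cinner (s e) e *\<^sub>C f) f = 1" using ff by metis
    then have "cinner (s e) e = 1" by (simp add: cinner_scaleC_left ff)
    with \<open>rank1 f f = op_scaleC (cinner (s e) e) q\<close> show ?thesis
      by (auto intro!: blinfun_eqI simp: op_scaleC_apply)
  qed
  define u where "u v = \<phi> (rank1 (P v) e) f" for v
  have cin: "cinner (u v) (u w) = cinner (P v) (P w)" for v w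
  proof -
    have "cinner (u v) (u w) = cinner (\<phi> (rank1 e (P w)) (\<phi> (rank1 (P v) e) f)) f"
      unfolding u_def
      using adjoint_pairD[OF adjoint_pair_sym[OF adj[OF rA'(2) rA'(1) rank1_adjoint]]] by metis
    also have "\<phi> (rank1 e (P w)) (\<phi> (rank1 (P v) e) f) = \<phi> (rank1 e (P w) o\<^sub>L rank1 (P v) e) f"
      by (simp add: mult rA')
    also have "rank1 e (P w) o\<^sub>L rank1 (P v) e = op_scaleC (cinner (P v) (P w)) (rank1 e e)"
      by (simp add: compose_rank1 rank1_clinear rank1_apply rank1_scaleC_left)
    also have "\<phi> \<dots> f = cinner (P v) (P w) *\<^sub>C f"
      by (simp add: scale[OF rAe] op_scaleC_apply qf flip: q_def)
    finally show ?thesis by (simp add: cinner_scaleC_left ff)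
  qed
  have clP: "clinear_op P" using P by (rule adjoint_pair_clinear)
  have uadd: "u (v + w) = u v + u w" for v w
    by (simp add: u_def blinfun.add_right rank1_add_left add rA' plus_blinfun.rep_eq)
  have uscale: "u (c *\<^sub>C v) = c *\<^sub>C u v" for c v
    by (simp add: u_def clinear_op_scaleC[OF clP] rank1_scaleC_left scale rA' op_scaleC_apply)
  have nP: "norm (P v) \<le> norm v" for v
  proof -
    have "complex_of_real ((norm (P v))\<^sup>2) = cinner v (P v)"
      unfolding cinner_self[symmetric] by (simp add: adjoint_pairD[OF P] PP)
    then have "(norm (P v))\<^sup>2 = cmod (cinner v (P v))"
      by (metis norm_of_real abs_of_nonneg zero_le_power2)
    also have "\<dots> \<le> norm v * norm (P v)" by (rule cinner_Cauchy_Schwarz)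
    finally show ?thesis
      by (cases "norm (P v) = 0") (simp_all add: power2_eq_square)
  qed
  have nu: "norm (u v) = norm (P v)" for v
    using cin[of v v] by (simp add: cinner_self power2_eq_iff_nonneg flip: of_real_power)
  have "bounded_linear u"
    by (rule bounded_linear_intro[where K = 1]) (simp_all add: uadd uscale scaleR_scaleC nu nP)
  then have U: "blinfun_apply (Blinfun u) = u" by (rule bounded_linear_Blinfun_apply)
  have Qu: "Q (u v) = u v" for v unfolding u_def by (rule QB(1)[OF \<phi>B[OF rA'(1)]])
  have uP: "u (P v) = u v" for v by (simp add: u_def PP)
  have surj: "\<exists>v. P v = v \<and> u v = Q w" for w
  proof -
    have "rank1 (Q w) f \<in> \<phi> ` A"
      using rB[of w f] unfolding bij_betw_imp_surj_on[OF bij] by (simp add: Qf)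
    then obtain s where s: "s \<in> A" "\<phi> s = rank1 (Q w) f" by (metis imageE)
    have "u (s e) = \<phi> (s o\<^sub>L rank1 e e) f"
      using A[OF s(1)] PA[OF s(1)] by (simp add: u_def compose_rank1)
    also have "\<dots> = Q w" by (simp add: mult s rAe rank1_apply ff qf flip: q_def)
    finally show ?thesis using PA[OF s(1)] by blast
  qed
  \<comment> \<open>As \<open>u\<close> is isometric on the range of \<open>P\<close>, the preimage
    of \<open>Q w\<close> there is unique, and it is the value at \<open>w\<close> of the adjoint of
    \<open>u\<close>. Linearity and boundedness of \<open>v'\<close> follow from the adjoint
    relation.\<close>
  then obtain v' where v': "\<And>w. P (v' w) = v' w" "\<And>w. u (v' w) = Q w" by metis
  have adjuv: "cinner (u v) w = cinner v (v' w)" for v w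
  proof -
    have "cinner (u v) w = cinner (u v) (Q w)"
      by (metis Qu adjoint_pairD[OF Q])
    also have "\<dots> = cinner (P v) (v' w)" using cin[of v "v' w"] by (simp add: v')
    also have "\<dots> = cinner v (v' w)" by (simp add: adjoint_pairD[OF P] v')
    finally show ?thesis .
  qed
  have nQ: "norm (v' w) \<le> norm w" for w
  proof -
    have "complex_of_real ((norm (v' w))\<^sup>2) = cinner (u (v' w)) w"
      unfolding cinner_self[symmetric] adjuv ..
    then have "(norm (v' w))\<^sup>2 = cmod (cinner (u (v' w)) w)"
      by (metis norm_of_real abs_of_nonneg zero_le_power2)
    also have "\<dots> \<le> norm (v' w) * norm w"
      using cinner_Cauchy_Schwarz[of "u (v' w)" w] by (simp add: nu v'(1))
    finally show ?thesis
      by (cases "norm (v' w) = 0") (simp_all add: power2_eq_square)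
  qed
  have "bounded_linear v'"
  proof (rule bounded_linear_intro[where K = 1])
    show "v' (x + y) = v' x + v' y" for x y
      by (rule cinner_ext_right) (simp add: cinner_add_right adjuv[symmetric])
    show "v' (r *\<^sub>R x) = r *\<^sub>R v' x" for r x
      by (rule cinner_ext_right) (simp add: scaleR_scaleC cinner_scaleC_right adjuv[symmetric])
  qed (simp add: nQ)
  then have V: "blinfun_apply (Blinfun v') = v'" by (rule bounded_linear_Blinfun_apply)
  have v'u: "v' (u v) = P v" for v
  proof (rule cinner_ext_right)
    fix w show "cinner w (v' (u v)) = cinner w (P v)"
      using cin[of w v] by (simp add: adjuv[symmetric] adjoint_pairD[OF P] PP)
  qed
  have "partial_unitary P Q (Blinfun u) (Blinfun v')"
    unfolding partial_unitary_def adjoint_pair_def U V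
    by (auto simp: adjuv U V v'u v' intro!: blinfun_eqI)
  moreover have "\<phi> T = Blinfun u o\<^sub>L T o\<^sub>L Blinfun v'" if T: "T \<in> A" for T
  proof (rule blinfun_eqI)
    fix w
    have "u (T (v' w)) = \<phi> (T o\<^sub>L rank1 (P (v' w)) e) f"
      using A[OF T] PA[OF T] by (simp add: u_def compose_rank1)
    also have "\<dots> = \<phi> T (u (v' w))" by (simp add: mult T rA' u_def)
    also have "\<dots> = \<phi> T w" using QB(2)[OF \<phi>B[OF T]] by (simp add: v')
    finally show "\<phi> T w = (Blinfun u o\<^sub>L T o\<^sub>L Blinfun v') w" by (simp add: U V)
  qed
  ultimately show ?thesis by (rule that)
qed


section \<open>Generalised Roe algebras\<close>

text \<open>The three algebras with coefficients in \<open>H\<^sub>0\<close> differ only in the uniform constraint on the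
  matrix entries.  A constraint is given by a family \<open>E\<close> of sets of operators: all the entries of
  an operator have to lie in one common member of \<open>E\<close>.\<close>

definition pre_alg ::
  "('h::chilbert_space \<Rightarrow>\<^sub>L 'h) set set \<Rightarrow> 'a::metric_space set \<Rightarrow> (('a, 'h) ell2 \<Rightarrow>\<^sub>L ('a, 'h) ell2) set"
where
  "pre_alg E X = {T \<in> op_on (ell2_on X). finite_propagation T \<and>
     (\<exists>M\<in>E. \<forall>x y. matrix_entry T x y \<in> M)}"

definition alg ::
  "('h::chilbert_space \<Rightarrow>\<^sub>L 'h) set set \<Rightarrow> 'a::metric_space set \<Rightarrow> (('a, 'h) ell2 \<Rightarrow>\<^sub>L ('a, 'h) ell2) set"
where
  "alg E X = closure (pre_alg E X)"

text \<open>A space of coefficient vectors that the constraint tolerates at once: rank-one entries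
  built from \<open>V\<close> stay in one member of \<open>E\<close>. In the instances
  \<open>V\<close> is the whole space for compact entries and for bounded rank, and a
  finite-dimensional span in the stable case.\<close>

definition admissible :: "('h::chilbert_space \<Rightarrow>\<^sub>L 'h) set set \<Rightarrow> 'h set \<Rightarrow> bool" where
  "admissible E V \<longleftrightarrow> complex_vector.subspace V \<and> (\<exists>L\<in>E. \<forall>v\<in>V. \<forall>w\<in>V. rank1 v w \<in> L)"

definition adjointable :: "('h::chilbert_space \<Rightarrow>\<^sub>L 'k::chilbert_space) \<Rightarrow> bool" where
  "adjointable T \<longleftrightarrow> (\<exists>S. adjoint_pair T S)"

text \<open>The quantifier over \<open>L\<close> reflects that rank bounds and finite-dimensional
  subspaces may grow under the operations, as long as they remain uniform over all entries. In
  \<open>compose\<close> only finitely many operators act, since infinitely many could spread a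
  finite-dimensional corner over infinitely many dimensions. \<open>enlarge\<close> supplies one
  subspace containing the ranges of all entries.\<close>

locale entry_class =
  fixes E :: "('h::chilbert_space \<Rightarrow>\<^sub>L 'h) set set"
  assumes nonempty: "E \<noteq> {}"
    and compact: "M \<in> E \<Longrightarrow> M \<subseteq> compact_operators"
    and zero: "M \<in> E \<Longrightarrow> 0 \<in> M"
    and add: "M \<in> E \<Longrightarrow> N \<in> E \<Longrightarrow> \<exists>L\<in>E. \<forall>S\<in>M. \<forall>T\<in>N. S + T \<in> L"
    and compose: "M \<in> E \<Longrightarrow> finite \<A> \<Longrightarrow> (\<And>A. A \<in> \<A> \<Longrightarrow> adjointable A) \<Longrightarrow>
      \<exists>L\<in>E. \<forall>A\<in>\<A>. \<forall>B\<in>\<A>. \<forall>T\<in>M. A o\<^sub>L T o\<^sub>L B \<in> L"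
    and enlarge: "M \<in> E \<Longrightarrow> finite F \<Longrightarrow>
      \<exists>V. admissible E V \<and> F \<subseteq> V \<and> (\<forall>T\<in>M. range (blinfun_apply T) \<subseteq> V)"

section \<open>The three constraints on the entries\<close>

abbreviation compact_class :: "('h::chilbert_space \<Rightarrow>\<^sub>L 'h) set set" where
  "compact_class \<equiv> {compact_operators}"

definition rank_class :: "('h::chilbert_space \<Rightarrow>\<^sub>L 'h) set set" where
  "rank_class = range (\<lambda>N. {T. clinear_op T \<and> rank_at_most T N})"

definition corner_class :: "('h::chilbert_space \<Rightarrow>\<^sub>L 'h) set set" where
  "corner_class = {op_on (cspan F) |F. finite F}"

lemma roe_algebra_alg: "roe_algebra H\<^sub>0 X = alg compact_class X"
  unfolding roe_algebra_def alg_def pre_alg_def by simp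

lemma uniform_algebra_alg:
  fixes H\<^sub>0 :: "'h::chilbert_space itself" and X :: "'a::metric_space set"
  shows "uniform_algebra H\<^sub>0 X = alg rank_class X"
proof -
  have "(\<exists>N. \<forall>x y. rank_at_most (matrix_entry T x y) N)
    \<longleftrightarrow> (\<exists>M\<in>rank_class. \<forall>x y. matrix_entry T x y \<in> M)"
    if "T \<in> op_on (ell2_on X)" for T :: "('a, 'h) ell2 \<Rightarrow>\<^sub>L ('a, 'h) ell2"
    using matrix_entry_clinear[OF op_on_ell2_on_clinear[OF that]] by (auto simp: rank_class_def)
  then show ?thesis
    unfolding uniform_algebra_def alg_def pre_alg_def
    by (intro arg_cong[of _ _ closure] Collect_cong) blast
qed

lemma stable_roe_algebra_alg: "stable_roe_algebra H\<^sub>0 X = alg corner_class X"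
  unfolding stable_roe_algebra_def alg_def pre_alg_def corner_class_def
  by (intro arg_cong[of _ _ closure] Collect_cong) auto

lemma subspace_preimage: "clinear_op A \<Longrightarrow> complex_vector.subspace V \<Longrightarrow>
    complex_vector.subspace {v. A v \<in> V}"
  by (simp add: complex_vector.subspace_def blinfun.add_right clinear_op_scaleC)

lemma cspan_image:
  assumes "clinear_op A" "v \<in> cspan F" shows "A v \<in> cspan (A ` F)"
proof -
  have "cspan F \<subseteq> {v. A v \<in> cspan (A ` F)}"
    by (intro complex_vector.span_minimal subspace_preimage[OF assms(1)]
        complex_vector.subspace_span) (auto intro: complex_vector.span_base)
  then show ?thesis using assms(2) by blast
qed

text \<open>By the exchange argument, a subspace of a span of \<open>N\<close> vectors has a basis
  of at most \<open>N\<close> elements. Enclosing the range in a span avoids exhibiting bases for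
  the ranges of sums and products.\<close>

lemma rank_at_most_iff:
  assumes T: "clinear_op T"
  shows "rank_at_most T N \<longleftrightarrow> (\<exists>F. finite F \<and> card F \<le> N \<and> range T \<subseteq> cspan F)"
proof
  assume "\<exists>F. finite F \<and> card F \<le> N \<and> range T \<subseteq> cspan F"
  then obtain F where F: "finite F" "card F \<le> N" "range T \<subseteq> cspan F" by blast
  have sub: "complex_vector.subspace (range T)"
    unfolding complex_vector.subspace_def
  proof (intro conjI ballI allI)
    show "0 \<in> range T" by (rule range_eqI[of _ _ 0]) simp
    fix x y c assume "x \<in> range T" "y \<in> range T"
    then obtain v w where vw: "x = T v" "y = T w" by blast
    show "x + y \<in> range T" by (rule range_eqI[of _ _ "v + w"]) (simp add: vw blinfun.add_right)
    show "c *\<^sub>C x \<in> range T"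
      by (rule range_eqI[of _ _ "c *\<^sub>C v"]) (simp add: vw clinear_op_scaleC[OF T])
  qed
  obtain B where B: "B \<subseteq> range T" "\<not> cdependent B" "range T \<subseteq> cspan B"
    using complex_vector.maximal_independent_subset[of "range T"] by blast
  then have "finite B" "card B \<le> card F"
    using complex_vector.independent_span_bound[OF F(1) B(2)] F(3) by auto
  moreover have "cspan B = range T"
    using B complex_vector.span_minimal[OF B(1) sub] by blast
  ultimately show "rank_at_most T N"
    unfolding rank_at_most_def using B(2) F(2) by auto
qed (auto simp: rank_at_most_def)

lemma entry_class_compact: "entry_class compact_class"
proof
  fix M N :: "('a \<Rightarrow>\<^sub>L 'a) set" and F :: "'a set" and \<A> :: "('a \<Rightarrow>\<^sub>L 'a) set"
  assume M: "M \<in> compact_class"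
  show "M \<subseteq> compact_operators" "0 \<in> M" using M by (auto simp: compact_operators_0)
  show "\<exists>L\<in>compact_class. \<forall>S\<in>M. \<forall>T\<in>N. S + T \<in> L" if "N \<in> compact_class"
    using M that by (auto simp: compact_operators_add)
  show "\<exists>L\<in>compact_class. \<forall>A\<in>\<A>. \<forall>B\<in>\<A>. \<forall>T\<in>M. A o\<^sub>L T o\<^sub>L B \<in> L"
    if "\<And>A. A \<in> \<A> \<Longrightarrow> adjointable A"
    using M that adjoint_pair_clinear
    by (auto simp: adjointable_def intro!: compact_operators_compose)
  show "\<exists>V. admissible compact_class V \<and> F \<subseteq> V \<and> (\<forall>T\<in>M. range (blinfun_apply T) \<subseteq> V)"
    by (rule exI[of _ UNIV]) (simp add: admissible_def rank1_compact complex_vector.subspace_UNIV)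
qed simp

lemma entry_class_rank: "entry_class rank_class"
proof
  fix M N :: "('a \<Rightarrow>\<^sub>L 'a) set" and F :: "'a set" and \<A> :: "('a \<Rightarrow>\<^sub>L 'a) set"
  assume "M \<in> rank_class"
  then obtain k where M: "M = {T. clinear_op T \<and> rank_at_most T k}" by (auto simp: rank_class_def)
  have rankI: "T \<in> {T. clinear_op T \<and> rank_at_most T m}"
    if "clinear_op T" "finite F" "card F \<le> m" "range T \<subseteq> cspan F" for T :: "'a \<Rightarrow>\<^sub>L 'a" and m F
    using that rank_at_most_iff by blast
  have rankE: "\<exists>F. finite F \<and> card F \<le> m \<and> range T \<subseteq> cspan F"
    if "clinear_op T" "rank_at_most T m" for T :: "'a \<Rightarrow>\<^sub>L 'a" and m
    using that rank_at_most_iff by blast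
  show "M \<subseteq> compact_operators"
    using M rankE compact_operators_finite_rank by blast
  show "0 \<in> M"
    unfolding M by (rule rankI[where F = "{}"]) (auto simp: clinear_op_0)
  show "\<exists>L\<in>rank_class. \<forall>S\<in>M. \<forall>T\<in>N. S + T \<in> L" if N: "N \<in> rank_class"
  proof -
    obtain l where N: "N = {T. clinear_op T \<and> rank_at_most T l}" using N by (auto simp: rank_class_def)
    have "S + T \<in> {T. clinear_op T \<and> rank_at_most T (k + l)}" if ST: "S \<in> M" "T \<in> N" for S T
    proof -
      obtain F where F: "finite F" "card F \<le> k" "range S \<subseteq> cspan F"
        using ST(1) rankE unfolding M by blast
      obtain G where G: "finite G" "card G \<le> l" "range T \<subseteq> cspan G"
        using ST(2) rankE unfolding N by blast
      have "cspan F \<subseteq> cspan (F \<union> G)" "cspan G \<subseteq> cspan (F \<union> G)"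
        by (auto intro: complex_vector.span_mono[THEN subsetD])
      then have "range (S + T) \<subseteq> cspan (F \<union> G)"
        using F(3) G(3) by (auto simp: plus_blinfun.rep_eq intro!: complex_vector.span_add)
      then show ?thesis
        using ST F G card_Un_le[of F G] M N
        by (intro rankI[where F = "F \<union> G"]) (auto intro: clinear_op_add)
    qed
    then show ?thesis unfolding rank_class_def by blast
  qed
  show "\<exists>L\<in>rank_class. \<forall>A\<in>\<A>. \<forall>B\<in>\<A>. \<forall>T\<in>M. A o\<^sub>L T o\<^sub>L B \<in> L"
    if "\<And>A. A \<in> \<A> \<Longrightarrow> adjointable A"
  proof -
    have "A o\<^sub>L T o\<^sub>L B \<in> M" if AB: "A \<in> \<A>" "B \<in> \<A>" "T \<in> M" for A B T
    proof -
      have cl: "clinear_op A" "clinear_op B"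
        using AB \<open>\<And>A. A \<in> \<A> \<Longrightarrow> adjointable A\<close> adjoint_pair_clinear unfolding adjointable_def by blast+
      obtain F where F: "finite F" "card F \<le> k" "range T \<subseteq> cspan F"
        using AB(3) rankE unfolding M by blast
      have "range (A o\<^sub>L T o\<^sub>L B) \<subseteq> cspan (A ` F)"
        using F(3) cspan_image[OF cl(1)] by auto
      then show ?thesis
        using AB(3) cl F card_image_le[OF F(1), of A] unfolding M
        by (intro rankI[where F = "A ` F"]) (auto intro: clinear_op_compose)
    qed
    then show ?thesis using \<open>M \<in> rank_class\<close> by blast
  qed
  have "rank1 v w \<in> {T. clinear_op T \<and> rank_at_most T 1}" for v w :: 'a
    using complex_vector.span_scale[OF complex_vector.span_base[of v "{v}"]]
    by (intro rankI[where F = "{v}"]) (auto simp: rank1_clinear rank1_apply)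
  then show "\<exists>V. admissible rank_class V \<and> F \<subseteq> V \<and> (\<forall>T\<in>M. range (blinfun_apply T) \<subseteq> V)"
    by (intro exI[of _ UNIV]) (auto simp: admissible_def complex_vector.subspace_UNIV rank_class_def)
qed (auto simp: rank_class_def)

lemma corner_classE:
  assumes "M \<in> corner_class" obtains F where "finite F" "M = op_on (cspan F)"
  using assms by (auto simp: corner_class_def)

lemma op_on_mono:
  assumes "V \<subseteq> W" shows "op_on V \<subseteq> op_on W"
proof
  fix T assume T: "T \<in> op_on V"
  have "T v = 0" if "\<And>w. w \<in> W \<Longrightarrow> cinner v w = 0" for v
    using T that assms unfolding op_on_def by blast
  then show "T \<in> op_on W" using T assms unfolding op_on_def by blast
qed

lemma rank1_op_on: "v \<in> V \<Longrightarrow> w \<in> V \<Longrightarrow> complex_vector.subspace V \<Longrightarrow> rank1 v w \<in> op_on V"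
  by (auto simp: op_on_def bounded_operators_iff rank1_clinear rank1_apply
      complex_vector.subspace_scale)

lemma entry_class_corner: "entry_class corner_class"
proof
  fix M N :: "('a \<Rightarrow>\<^sub>L 'a) set" and F :: "'a set" and \<A> :: "('a \<Rightarrow>\<^sub>L 'a) set"
  assume "M \<in> corner_class"
  then obtain G where G: "finite G" and M: "M = op_on (cspan G)" by (rule corner_classE)
  show "M \<subseteq> compact_operators"
    using G by (auto simp: M op_on_def bounded_operators_iff intro!: compact_operators_finite_rank)
  show "0 \<in> M"
    by (simp add: M op_on_def bounded_operators_iff clinear_op_0 complex_vector.span_zero)
  show "\<exists>L\<in>corner_class. \<forall>S\<in>M. \<forall>T\<in>N. S + T \<in> L" if "N \<in> corner_class"
  proof -
    obtain G' where G': "finite G'" and N: "N = op_on (cspan G')"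
      using \<open>N \<in> corner_class\<close> by (rule corner_classE)
    have "M \<subseteq> op_on (cspan (G \<union> G'))" "N \<subseteq> op_on (cspan (G \<union> G'))"
      unfolding M N by (intro op_on_mono complex_vector.span_mono; blast)+
    then have "S + T \<in> op_on (cspan (G \<union> G'))" if "S \<in> M" "T \<in> N" for S T
      using that by (auto simp: op_on_def bounded_operators_iff clinear_op_add plus_blinfun.rep_eq
          subset_iff intro!: complex_vector.span_add)
    then show ?thesis using G G' unfolding corner_class_def by blast
  qed
  show "\<exists>L\<in>corner_class. \<forall>A\<in>\<A>. \<forall>B\<in>\<A>. \<forall>T\<in>M. A o\<^sub>L T o\<^sub>L B \<in> L"
    if fin: "finite \<A>" and adj: "\<And>A. A \<in> \<A> \<Longrightarrow> adjointable A"
  proof -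
    have "\<forall>A\<in>\<A>. \<exists>S. adjoint_pair A S" using adj unfolding adjointable_def by blast
    then obtain S :: "('a \<Rightarrow>\<^sub>L 'a) \<Rightarrow> ('a \<Rightarrow>\<^sub>L 'a)"
      where S: "\<And>A. A \<in> \<A> \<Longrightarrow> adjoint_pair A (S A)" by metis
    \<comment> \<open>The images of \<open>G\<close> under the left factors span the ranges; the
      images under the adjoints of the right factors are there to make the products vanish on the
      orthogonal complement.\<close>
    let ?H = "(\<Union>A\<in>\<A>. blinfun_apply A ` G \<union> blinfun_apply (S A) ` G)"
    have "A o\<^sub>L T o\<^sub>L B \<in> op_on (cspan ?H)" if AB: "A \<in> \<A>" "B \<in> \<A>" "T \<in> M" for A B T
    proof -
      have cl: "clinear_op A" "clinear_op B" "clinear_op (S B)"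
        using adjoint_pair_clinear[OF S[OF AB(1)]] adjoint_pair_clinear[OF S[OF AB(2)]]
          adjoint_pair_clinear[OF adjoint_pair_sym[OF S[OF AB(2)]]] by auto
      have T: "clinear_op T" "\<And>v. T v \<in> cspan G"
          "\<And>v. (\<And>w. w \<in> cspan G \<Longrightarrow> cinner v w = 0) \<Longrightarrow> T v = 0"
        using AB(3) unfolding M op_on_def bounded_operators_iff by blast+
      have sub: "cspan (A ` G) \<subseteq> cspan ?H" "cspan (S B ` G) \<subseteq> cspan ?H"
        using AB by (intro complex_vector.span_mono; blast)+
      have "A (T (B v)) \<in> cspan ?H" for v
        by (rule subsetD[OF sub(1) cspan_image[OF cl(1) T(2)]])
      moreover have "T (B v) = 0" if v: "\<And>w. w \<in> cspan ?H \<Longrightarrow> cinner v w = 0" for v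
      proof (rule T(3))
        fix w assume "w \<in> cspan G"
        then show "cinner (B v) w = 0"
          unfolding adjoint_pairD[OF S[OF AB(2)]]
          by (intro v subsetD[OF sub(2) cspan_image[OF cl(3)]])
      qed
      ultimately show ?thesis
        using T(1) cl unfolding op_on_def bounded_operators_iff by (simp add: clinear_op_compose)
    qed
    moreover have "finite ?H" using fin G by blast
    ultimately show ?thesis unfolding corner_class_def by blast
  qed
  show "\<exists>V. admissible corner_class V \<and> F \<subseteq> V \<and> (\<forall>T\<in>M. range (blinfun_apply T) \<subseteq> V)"
    if F: "finite F"
  proof (intro exI conjI)
    show "admissible corner_class (cspan (F \<union> G))"
      unfolding admissible_def
    proof (intro conjI bexI[of _ "op_on (cspan (F \<union> G))"] ballI)
      show "op_on (cspan (F \<union> G)) \<in> corner_class" using F G unfolding corner_class_def by blast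
    qed (simp_all add: rank1_op_on complex_vector.subspace_span)
    show "F \<subseteq> cspan (F \<union> G)" by (auto intro: complex_vector.span_base)
    show "\<forall>T\<in>M. range (blinfun_apply T) \<subseteq> cspan (F \<union> G)"
      using complex_vector.span_mono[of G "F \<union> G"] by (auto simp: M op_on_def)
  qed
qed (auto simp: corner_class_def)

section \<open>Closure properties of the generalised Roe algebras\<close>

lemma subspace_closure:
  fixes S :: "'v::real_normed_vector set"
  assumes "subspace S" shows "subspace (closure S)"
proof (rule real_vector.subspaceI)
  show "0 \<in> closure S"
    using real_vector.subspace_0[OF assms] closure_subset by blast
next
  fix x y assume "x \<in> closure S" "y \<in> closure S"
  then obtain a b where "\<And>n. a n \<in> S" "a \<longlonglongrightarrow> x" "\<And>n. b n \<in> S" "b \<longlonglongrightarrow> y"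
    unfolding closure_sequential by blast
  then show "x + y \<in> closure S"
    unfolding closure_sequential
    by (intro exI[of _ "\<lambda>n. a n + b n"] conjI allI tendsto_add real_vector.subspace_add[OF assms])
next
  fix r x assume "x \<in> closure S"
  then obtain a where "\<And>n. a n \<in> S" "a \<longlonglongrightarrow> x"
    unfolding closure_sequential by blast
  then show "r *\<^sub>R x \<in> closure S"
    unfolding closure_sequential
    by (intro exI[of _ "\<lambda>n. r *\<^sub>R a n"] conjI allI tendsto_scaleR tendsto_const
        real_vector.subspace_scale[OF assms])
qed

lemma finite_propagation_iff:
  "finite_propagation T \<longleftrightarrow> (\<exists>R. \<forall>x y. matrix_entry T x y \<noteq> 0 \<longrightarrow> dist x y \<le> R)"
  unfolding finite_propagation_def bdd_above_def by auto

lemma alg_op_on: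
  assumes "T \<in> alg E X" shows "T \<in> op_on (ell2_on X)"
proof -
  have "alg E X \<subseteq> op_on (ell2_on X)"
    unfolding alg_def by (rule closure_minimal) (auto simp: pre_alg_def closed_op_on_ell2_on)
  then show ?thesis using assms by blast
qed

lemma pre_alg_alg: "T \<in> pre_alg E X \<Longrightarrow> T \<in> alg E X"
  unfolding alg_def using closure_subset by blast

lemma alg_approx:
  assumes "T \<in> alg E X" "e > 0"
  obtains S where "S \<in> pre_alg E X" "norm (T - S) < e"
  using assms unfolding alg_def closure_approachable by (metis dist_norm norm_minus_commute)

lemma bounded_linear_compose_right: "bounded_linear (\<lambda>T. S o\<^sub>L T)"
  by (rule bounded_bilinear.bounded_linear_right[OF bounded_bilinear_blinfun_compose])

lemma bounded_linear_compose_left: "bounded_linear (\<lambda>T. T o\<^sub>L S)"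
  by (rule bounded_bilinear.bounded_linear_left[OF bounded_bilinear_blinfun_compose])

lemma bounded_linear_conj: "bounded_linear (\<lambda>T. U o\<^sub>L T o\<^sub>L V)"
  by (rule bounded_linear_compose[OF bounded_linear_compose_left bounded_linear_compose_right])

lemma conjugate_alg:
  fixes U :: "('a::metric_space, 'h::chilbert_space) ell2 \<Rightarrow>\<^sub>L ('b::metric_space, 'h) ell2"
  assumes pre: "\<And>T. T \<in> pre_alg E X \<Longrightarrow> U o\<^sub>L T o\<^sub>L V \<in> pre_alg E Y"
    and T: "T \<in> alg E X"
  shows "U o\<^sub>L T o\<^sub>L V \<in> alg E Y"
proof -
  have "(\<lambda>T. U o\<^sub>L T o\<^sub>L V) ` closure (pre_alg E X) \<subseteq> closure (pre_alg E Y)"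
    using pre by (intro image_closure_subset linear_continuous_on bounded_linear_conj)
      (auto intro: closure_subset[THEN subsetD])
  then show ?thesis using T unfolding alg_def by blast
qed

lemma adjointable_scaleR_id: "adjointable (r *\<^sub>R id_blinfun)"
  unfolding adjointable_def adjoint_pair_def
  by (intro exI[of _ "r *\<^sub>R id_blinfun"])
    (simp add: scaleR_blinfun.rep_eq scaleR_scaleC cinner_scaleC_left cinner_scaleC_right)

context entry_class
begin

lemma pre_alg_add:
  assumes "S \<in> pre_alg E X" "T \<in> pre_alg E X" shows "S + T \<in> pre_alg E X"
proof -
  obtain M R where S: "S \<in> op_on (ell2_on X)" "M \<in> E" "\<And>x y. matrix_entry S x y \<in> M"
    "\<And>x y. matrix_entry S x y \<noteq> 0 \<Longrightarrow> dist x y \<le> R"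
    using assms(1) by (auto simp: pre_alg_def finite_propagation_iff)
  obtain N Q where T: "T \<in> op_on (ell2_on X)" "N \<in> E" "\<And>x y. matrix_entry T x y \<in> N"
    "\<And>x y. matrix_entry T x y \<noteq> 0 \<Longrightarrow> dist x y \<le> Q"
    using assms(2) by (auto simp: pre_alg_def finite_propagation_iff)
  obtain L where "L \<in> E" "\<forall>S\<in>M. \<forall>T\<in>N. S + T \<in> L" using add[OF S(2) T(2)] by blast
  then have "\<exists>L\<in>E. \<forall>x y. matrix_entry (S + T) x y \<in> L"
    using S(3) T(3) unfolding matrix_entry_add by blast
  moreover have "dist x y \<le> max R Q" if "matrix_entry (S + T) x y \<noteq> 0" for x y
  proof -
    have "matrix_entry S x y \<noteq> 0 \<or> matrix_entry T x y \<noteq> 0"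
      using that by (auto simp: matrix_entry_add)
    then show ?thesis using S(4)[of x y] T(4)[of x y] by auto
  qed
  ultimately show ?thesis
    using op_on_ell2_on_add[OF S(1) T(1)] unfolding pre_alg_def finite_propagation_iff by blast
qed

lemma pre_alg_scaleR:
  assumes "T \<in> pre_alg E X" shows "r *\<^sub>R T \<in> pre_alg E X"
proof -
  obtain M where T: "T \<in> op_on (ell2_on X)" "M \<in> E" "\<And>x y. matrix_entry T x y \<in> M"
    using assms by (auto simp: pre_alg_def)
  \<comment> \<open>Scaling is an instance of \<open>compose\<close>: \<open>r\<close> times the
    identity acts on the left and the identity on the right.\<close>
  let ?\<A> = "{r *\<^sub>R id_blinfun, 1 *\<^sub>R id_blinfun :: 'h \<Rightarrow>\<^sub>L 'h}"
  obtain L where L: "L \<in> E" "\<forall>A\<in>?\<A>. \<forall>B\<in>?\<A>. \<forall>T\<in>M. A o\<^sub>L T o\<^sub>L B \<in> L"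
    using compose[OF T(2), of ?\<A>] adjointable_scaleR_id by blast
  have "r *\<^sub>R K \<in> L" if "K \<in> M" for K
  proof -
    have "(r *\<^sub>R id_blinfun) o\<^sub>L K o\<^sub>L (1 *\<^sub>R id_blinfun) = r *\<^sub>R K"
      by (rule blinfun_eqI) (simp add: scaleR_blinfun.rep_eq)
    then show ?thesis using L(2) that by (metis insertCI)
  qed
  moreover have "finite_propagation (r *\<^sub>R T)"
    using assms unfolding pre_alg_def finite_propagation_iff by (simp add: matrix_entry_scaleR) blast
  ultimately show ?thesis
    using op_on_ell2_on_scaleR[OF T(1)] L(1) T(3)
    unfolding pre_alg_def mem_Collect_eq matrix_entry_scaleR by blast
qed

lemma pre_alg_0: "0 \<in> pre_alg E X"
proof -
  obtain M where "M \<in> E" using nonempty by blast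
  then show ?thesis
    using zero by (auto simp: pre_alg_def finite_propagation_iff op_on_ell2_on_iff clinear_op_0)
qed

lemma subspace_alg: "subspace (alg E X)"
  unfolding alg_def
  by (rule subspace_closure)
    (simp add: real_vector.subspace_def pre_alg_add pre_alg_scaleR pre_alg_0)

lemma obtain_admissible:
  assumes "finite F" obtains V where "admissible E V" "F \<subseteq> V"
  using nonempty enlarge[OF _ assms] by blast

text \<open>Both vectors are cut down to finite sets. Then only finitely many entries are nonzero,
  and the finitely many values that occur fit into one admissible subspace. Spatial implementation
  of isomorphisms depends on this supply of rank-one operators.\<close>

lemma rank1_alg:
  assumes f: "f \<in> ell2_on X" and g: "g \<in> ell2_on X"
  shows "rank1 f g \<in> alg E X"
  unfolding alg_def closure_approachable
proof (intro allI impI)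
  fix e :: real assume e: "e > 0"
  define d where "d = e / (norm f + norm g + 1)"
  have pos: "norm f + norm g + 1 > 0" by (simp add: add_nonneg_pos)
  have d: "d > 0" using e pos by (simp add: d_def)
  obtain F where F: "finite F" "norm (f - chi F f) < d"
    using ell2_finite_approx[OF d, of f] by (metis order_refl)
  obtain G where G: "finite G" "norm (g - chi G g) < d"
    using ell2_finite_approx[OF d, of g] by (metis order_refl)
  let ?T = "rank1 (chi F f) (chi G g)"
  let ?V = "insert 0 (ell2_fun f ` F \<union> ell2_fun g ` G)"
  obtain V where V: "admissible E V" "?V \<subseteq> V"
    using obtain_admissible[of ?V] F G by auto
  then obtain L where L: "L \<in> E" "\<And>v w. v \<in> V \<Longrightarrow> w \<in> V \<Longrightarrow> rank1 v w \<in> L"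
    unfolding admissible_def by blast
  have ent: "matrix_entry ?T x y = (if x \<in> F \<and> y \<in> G then rank1 (ell2_fun f x) (ell2_fun g y) else 0)"
    for x y by (simp add: matrix_entry_rank1 chi_apply)
  have "matrix_entry ?T x y \<in> L" for x y
    unfolding ent using V(2) zero[OF L(1)] by (auto intro!: L(2))
  moreover have "?T \<in> op_on (ell2_on X)"
    using f g by (intro op_on_ell2_on_entryI) (auto simp: rank1_clinear ent ell2_on_def)
  moreover have "finite_propagation ?T"
  proof -
    have "{dist x y |x y. matrix_entry ?T x y \<noteq> 0} \<subseteq> (\<lambda>(x, y). dist x y) ` (F \<times> G)"
      by (auto simp: ent split: if_splits)
    then show ?thesis
      unfolding finite_propagation_def
      by (rule bdd_above_mono[rotated]) (use F G in \<open>auto intro: bdd_above_finite\<close>)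
  qed
  ultimately have "?T \<in> pre_alg E X" using L(1) by (auto simp: pre_alg_def)
  moreover have "dist ?T (rank1 f g) < e"
  proof -
    have "norm (rank1 f g - ?T) \<le> norm (rank1 (f - chi F f) g) + norm (rank1 (chi F f) (g - chi G g))"
      unfolding rank1_diff by (rule norm_triangle_ineq)
    also have "\<dots> \<le> norm (f - chi F f) * norm g + norm (chi F f) * norm (g - chi G g)"
      by (intro add_mono norm_rank1_le)
    also have "\<dots> \<le> d * norm g + norm f * d"
      using F(2) G(2) norm_chi_le[of F f] d by (intro add_mono mult_mono) auto
    also have "\<dots> < d * (norm f + norm g + 1)" using d by (simp add: algebra_simps)
    also have "\<dots> = e" using pos by (simp add: d_def)
    finally show ?thesis by (simp add: dist_norm norm_minus_commute)
  qed
  ultimately show "\<exists>T\<in>pre_alg E X. dist T (rank1 f g) < e" by blast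
qed

lemma chi_compress_alg:
  assumes T: "T \<in> alg E X" and Z: "Z \<subseteq> X" shows "chi Z o\<^sub>L T o\<^sub>L chi Z \<in> alg E Z"
proof (rule conjugate_alg[OF _ T])
  fix S assume "S \<in> pre_alg E X"
  then obtain M where S: "S \<in> op_on (ell2_on X)" "M \<in> E" "\<And>x y. matrix_entry S x y \<in> M"
    "finite_propagation S"
    by (auto simp: pre_alg_def)
  let ?S = "chi Z o\<^sub>L S o\<^sub>L chi Z"
  have "?S \<in> op_on (ell2_on Z)"
    by (rule op_on_ell2_on_entryI)
      (auto simp: clinear_op_compose chi_clinear op_on_ell2_on_clinear[OF S(1)] matrix_entry_chi)
  moreover have "finite_propagation ?S"
    using S(4) by (auto simp: finite_propagation_iff matrix_entry_chi split: if_splits)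
  moreover have "matrix_entry ?S x y \<in> M" for x y
    using S(3) zero[OF S(2)] by (simp add: matrix_entry_chi)
  ultimately show "?S \<in> pre_alg E Z" using S(2) by (auto simp: pre_alg_def)
qed

text \<open>The hypothesis on ghosts concerns the Roe algebra only; this inclusion makes it apply to
  a ghost found in any of the three algebras.\<close>

lemma alg_subset_compact: "alg E X \<subseteq> alg compact_class X"
proof -
  have "pre_alg E X \<subseteq> pre_alg compact_class X"
    using compact unfolding pre_alg_def by blast
  then show ?thesis unfolding alg_def by (rule closure_mono)
qed

text \<open>For a unit vector \<open>e\<close> this is the projection onto the functions on
  \<open>X\<close> with values in the multiples of \<open>e\<close>. Its conjugate under the unitary
  later confines the vectors \<open>U(x \<otimes> e)\<close>.\<close>

lemma diagonal_projection_alg: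
  "chi X o\<^sub>L ell2_map (rank1 e e) \<in> alg E X" (is "?p \<in> _")
proof (rule pre_alg_alg)
  obtain V where V: "admissible E V" "{e} \<subseteq> V" using obtain_admissible[of "{e}"] by auto
  then obtain L where L: "L \<in> E" "rank1 e e \<in> L" unfolding admissible_def by blast
  have ent: "matrix_entry ?p x y = (if x = y \<and> x \<in> X then rank1 e e else 0)" for x y
    by (rule blinfun_eqI) (simp add: matrix_entry_apply chi_apply ell2_map_apply single_apply)
  have "?p \<in> op_on (ell2_on X)"
    by (rule op_on_ell2_on_entryI)
      (auto simp: clinear_op_compose chi_clinear ell2_map_clinear rank1_clinear ent)
  moreover have "finite_propagation ?p"
    by (auto simp: finite_propagation_iff ent intro!: exI[of _ 0])
  moreover have "matrix_entry ?p x y \<in> L" for x y using L zero by (simp add: ent)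
  ultimately show "?p \<in> pre_alg E X" using L(1) unfolding pre_alg_def by blast
qed

end

section \<open>Partial translations\<close>

lemma onseq_single:
  assumes "inj x" "\<And>n. norm (v n) = 1" shows "onseq (\<lambda>n. ell2_single (x n) (v n))"
  using assms by (auto simp: onseq_def cinner_single_left single_apply inj_eq cinner_self)

lemma pisom_one_term:
  assumes "onseq a" "onseq b" "\<And>m. m \<noteq> n \<Longrightarrow> cinner v (a m) = 0"
  shows "pisom a b v = cinner v (a n) *\<^sub>C b n"
proof -
  have "(\<lambda>m. cinner v (a m) *\<^sub>C b m) = (\<lambda>m. if m = n then cinner v (a n) *\<^sub>C b n else 0)"
    using assms(3) by auto
  then have "(\<lambda>m. cinner v (a m) *\<^sub>C b m) sums (cinner v (a n) *\<^sub>C b n)"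
    using sums_If_finite_set[of "{n}" "\<lambda>_. cinner v (a n) *\<^sub>C b n"] by simp
  then show ?thesis using pisom_sums[OF assms(1,2), of v] sums_unique2 by blast
qed

text \<open>Injectivity of both sequences leaves at most one nonzero entry in each row and column,
  at the pairs \<open>(x' n, x n)\<close>. The varying coefficient vectors are harmless because they
  come from one admissible subspace.\<close>

lemma (in entry_class) partial_translation_alg:
  assumes x: "inj x" "range x \<subseteq> X" and x': "inj x'" "range x' \<subseteq> X"
    and R: "\<And>n. dist (x n) (x' n) \<le> R"
    and V: "admissible E V" and v: "\<And>n. v n \<in> V" "\<And>n. norm (v n) = 1"
    and v': "\<And>n. v' n \<in> V" "\<And>n. norm (v' n) = 1"
  shows "pisom (\<lambda>n. ell2_single (x n) (v n)) (\<lambda>n. ell2_single (x' n) (v' n)) \<in> alg E X"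
    (is "?T \<in> _")
proof (rule pre_alg_alg)
  note on = onseq_single[OF x(1) v(2)] onseq_single[OF x'(1) v'(2)]
  obtain L where L: "L \<in> E" "\<And>v w. v \<in> V \<Longrightarrow> w \<in> V \<Longrightarrow> rank1 v w \<in> L"
    using V unfolding admissible_def by blast
  have ent: "matrix_entry ?T p (x n) = (if p = x' n then rank1 (v' n) (v n) else 0)" for p n
  proof (rule blinfun_eqI)
    fix w
    have "?T (ell2_single (x n) w) = cinner w (v n) *\<^sub>C ell2_single (x' n) (v' n)"
      by (subst pisom_one_term[OF on, where n = n])
        (use x(1) in \<open>auto simp: cinner_single_left single_apply inj_eq\<close>)
    then show "matrix_entry ?T p (x n) w = (if p = x' n then rank1 (v' n) (v n) else 0) w"
      by (simp add: matrix_entry_apply scaleC_ell2.rep_eq single_apply rank1_apply)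
  qed
  have ent0: "matrix_entry ?T p q = 0" if "q \<notin> range x" for p q
  proof (rule blinfun_eqI)
    fix w
    have "?T (ell2_single q w) = 0"
      by (rule pisom_orthogonal[OF on]) (use that in \<open>auto simp: cinner_single_left single_apply\<close>)
    then show "matrix_entry ?T p q w = blinfun_apply 0 w" by (simp add: matrix_entry_apply zero_ell2.rep_eq)
  qed
  have cases: "(\<exists>n. p = x' n \<and> q = x n \<and> matrix_entry ?T p q = rank1 (v' n) (v n))
    \<or> matrix_entry ?T p q = 0" for p q
    using ent[of p] ent0[of q p] by (cases "q \<in> range x") (auto split: if_splits)
  have "matrix_entry ?T p q \<in> L" for p q
    using cases[of p q] zero[OF L(1)] L(2)[OF v'(1) v(1)] by auto
  moreover have "?T \<in> op_on (ell2_on X)"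
  proof (rule op_on_ell2_on_entryI[OF pisom_clinear[OF on]])
    fix p q assume "\<not> (p \<in> X \<and> q \<in> X)"
    then show "matrix_entry ?T p q = 0" using cases[of p q] x(2) x'(2) by auto
  qed
  moreover have "finite_propagation ?T"
    unfolding finite_propagation_iff
  proof (intro exI allI impI)
    fix p q assume "matrix_entry ?T p q \<noteq> 0"
    then show "dist p q \<le> R" using cases[of p q] R by (auto simp: dist_commute)
  qed
  ultimately show "?T \<in> pre_alg E X" using L(1) unfolding pre_alg_def by blast
qed

lemma norm_op_diff_le:
  assumes "norm (T - S) \<le> e" shows "norm (blinfun_apply T v - blinfun_apply S v) \<le> e * norm v"
  using norm_blinfun[of "T - S" v] mult_right_mono[OF assms, of "norm v"]
  by (simp add: minus_blinfun.rep_eq)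

text \<open>An approximant of finite propagation has no entries there, so these coefficients are
  bounded by the approximation error, uniformly in the unit vectors \<open>w\<close> and
  \<open>w'\<close>.\<close>

lemma alg_off_diagonal:
  assumes T: "T \<in> alg E X" and e: "e > 0"
  obtains S where "\<And>y y' w w'. dist y' y > S \<Longrightarrow> norm w = 1 \<Longrightarrow> norm w' = 1 \<Longrightarrow>
    cmod (cinner (T (ell2_single y w)) (ell2_single y' w')) < e"
proof -
  obtain T' where T': "T' \<in> pre_alg E X" "norm (T - T') < e" using alg_approx[OF T e] .
  obtain S where S: "\<And>x y. matrix_entry T' x y \<noteq> 0 \<Longrightarrow> dist x y \<le> S"
    using T'(1) by (auto simp: pre_alg_def finite_propagation_iff)
  have "cmod (cinner (T (ell2_single y w)) (ell2_single y' w')) < e"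
    if d: "dist y' y > S" and w: "norm w = 1" "norm w' = 1" for y y' w w'
  proof -
    have "matrix_entry T' y' y = 0" using S d by force
    then have "cinner (T' (ell2_single y w)) (ell2_single y' w') = 0"
      by (simp add: cinner_matrix_entry)
    then have "cinner (T (ell2_single y w)) (ell2_single y' w')
      = cinner (T (ell2_single y w) - T' (ell2_single y w)) (ell2_single y' w')"
      by (simp add: cinner_diff_left)
    also have "cmod \<dots> \<le> norm (T (ell2_single y w) - T' (ell2_single y w)) * norm (ell2_single y' w')"
      by (rule cinner_Cauchy_Schwarz)
    also have "\<dots> \<le> norm (T - T')"
      using norm_op_diff_le[of T T' _ "ell2_single y w", OF order_refl] w by (simp add: norm_ell2_single)
    finally show ?thesis using T'(2) by simp
  qed
  then show ?thesis by (rule that)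
qed

lemma alg_spatial:
  fixes X :: "'a::metric_space set" and Y :: "'b::metric_space set"
    and E :: "('h::chilbert_space \<Rightarrow>\<^sub>L 'h) set set"
  assumes "entry_class E" and iso: "star_isomorphic (alg E X) (alg E Y)"
    and X: "X \<noteq> {}" and e: "norm (e::'h) = 1"
  obtains U V where "partial_unitary (chi X) (chi Y) U V"
    "\<And>T. T \<in> alg E X \<Longrightarrow> U o\<^sub>L T o\<^sub>L V \<in> alg E Y"
    "\<And>T. T \<in> alg E Y \<Longrightarrow> V o\<^sub>L T o\<^sub>L U \<in> alg E X"
proof -
  interpret entry_class E by fact
  obtain \<phi> where \<phi>: "star_isomorphism (alg E X) (alg E Y) \<phi>"
    using iso by (auto simp: star_isomorphic_def)
  have cc: "chi S (chi S v) = chi S v" for S :: "'x set" and v :: "('x, 'h) ell2"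
    by (simp add: chi_fixed_iff chi_in)
  obtain x0 where x0: "x0 \<in> X" using X by blast
  obtain U V where UV: "partial_unitary (chi X) (chi Y) U V"
    and imp: "\<And>T. T \<in> alg E X \<Longrightarrow> \<phi> T = U o\<^sub>L T o\<^sub>L V"
  proof (rule star_isomorphism_spatial[OF \<phi> chi_self_adjoint cc chi_self_adjoint cc])
    show "clinear_op T \<and> chi X o\<^sub>L T = T \<and> T o\<^sub>L chi X = T" if "T \<in> alg E X" for T
      using alg_op_on[OF that] by (simp add: op_on_ell2_on_iff)
    show "clinear_op T \<and> chi Y o\<^sub>L T = T \<and> T o\<^sub>L chi Y = T" if "T \<in> alg E Y" for T
      using alg_op_on[OF that] by (simp add: op_on_ell2_on_iff)
    show "chi X (ell2_single x0 e) = ell2_single x0 e" using x0 by (simp add: chi_single)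
  qed (auto simp: rank1_alg chi_in norm_ell2_single e)
  have bij: "bij_betw \<phi> (alg E X) (alg E Y)" using \<phi> by (simp add: star_isomorphism_def)
  show ?thesis
  proof (rule that[OF UV])
    show "U o\<^sub>L T o\<^sub>L V \<in> alg E Y" if "T \<in> alg E X" for T
      using bij_betw_apply[OF bij that] imp[OF that] by simp
    show "V o\<^sub>L T o\<^sub>L U \<in> alg E X" if "T \<in> alg E Y" for T
    proof -
      have "T \<in> \<phi> ` alg E X" using that bij_betw_imp_surj_on[OF bij] by simp
      then obtain S where S: "S \<in> alg E X" "T = \<phi> S" by (metis imageE)
      have "V o\<^sub>L T o\<^sub>L U = S"
        using op_on_ell2_on_apply[OF alg_op_on[OF S(1)]]
        by (intro blinfun_eqI) (simp add: S(2) imp[OF S(1)] partial_unitary_apply[OF UV])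
      then show ?thesis using S(1) by simp
    qed
  qed
qed


text \<open>This is \<open>add\<close> iterated. Collapsing fibres with at most \<open>k\<close>
  points turns an entry into a sum of up to \<open>k * k\<close> transformed old ones, and one
  member of \<open>E\<close> has to hold all these sums.\<close>

lemma (in entry_class) bounded_sums:
  assumes "M \<in> E"
  shows "\<exists>L\<in>E. \<forall>I f. finite I \<longrightarrow> card I \<le> n \<longrightarrow> f ` I \<subseteq> M \<longrightarrow> sum f (I::'i set) \<in> L"
proof (induction n)
  case 0
  show ?case using assms zero by auto
next
  case (Suc n)
  then obtain L where L: "L \<in> E"
    "\<And>I f. finite I \<Longrightarrow> card I \<le> n \<Longrightarrow> f ` I \<subseteq> M \<Longrightarrow> sum f (I::'i set) \<in> L" by blast
  obtain L' where L': "L' \<in> E" "\<And>S T. S \<in> M \<Longrightarrow> T \<in> L \<Longrightarrow> S + T \<in> L'"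
    using add[OF assms L(1)] by blast
  have "sum f I \<in> L'" if I: "finite I" "card I \<le> Suc n" "f ` I \<subseteq> M" for I :: "'i set" and f
  proof (cases "I = {}")
    case True
    then show ?thesis using zero[OF L'(1)] by simp
  next
    case False
    then obtain i where i: "i \<in> I" by blast
    have "sum f (I - {i}) \<in> L" by (rule L(2)) (use I i in auto)
    then show ?thesis using L'(2)[of "f i"] I i by (simp add: sum.remove[OF I(1) i] image_subset_iff)
  qed
  then show ?case using L'(1) by blast
qed

section \<open>Enumerated bases and bounded geometry\<close>

lemma total_onseq_blinfun_eqI:
  assumes e: "total_onseq e" and "clinear_op S" "clinear_op T" "\<And>n. S (e n) = T (e n)"
  shows "S = T"
proof (rule blinfun_eqI)
  fix v
  have "(\<lambda>n. cinner v (e n) *\<^sub>C T (e n)) sums S v"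
    using bounded_linear.sums[OF blinfun.bounded_linear_right[of S] total_onseq_sums[OF e, of v]]
    by (simp add: clinear_op_scaleC assms)
  moreover have "(\<lambda>n. cinner v (e n) *\<^sub>C T (e n)) sums T v"
    using bounded_linear.sums[OF blinfun.bounded_linear_right[of T] total_onseq_sums[OF e, of v]]
    by (simp add: clinear_op_scaleC assms)
  ultimately show "S v = T v" by (rule sums_unique2)
qed

lemma total_onseq_orthogonal: "total_onseq e \<Longrightarrow> (\<And>n. cinner v (e n) = 0) \<Longrightarrow> v = 0"
  by (simp add: total_onseq_def)

lemma total_onseq_onseq: "total_onseq e \<Longrightarrow> onseq e"
  by (simp add: total_onseq_def)

lemma enumerate_product:
  assumes "countable Y" "Y \<noteq> {}"
  shows "\<exists>\<kappa> :: nat \<Rightarrow> 'a \<times> nat. inj \<kappa> \<and> range \<kappa> = Y \<times> UNIV"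
proof -
  have "countable (Y \<times> (UNIV :: nat set))" using assms(1) by (intro countable_SIGMA countableI_type)
  moreover have "infinite (Y \<times> (UNIV :: nat set))"
    using assms(2) by (simp add: finite_cartesian_product_iff)
  ultimately have "bij_betw (from_nat_into (Y \<times> (UNIV :: nat set))) UNIV (Y \<times> UNIV)"
    by (rule bij_betw_from_nat_into)
  then show ?thesis unfolding bij_betw_def by blast
qed

lemma basis_enumeration:
  fixes \<kappa> :: "nat \<Rightarrow> 'a \<times> nat" and e :: "nat \<Rightarrow> 'h::chilbert_space"
  assumes e: "total_onseq e" and \<kappa>: "inj \<kappa>" "range \<kappa> = Y \<times> UNIV"
  defines "a \<equiv> \<lambda>n. ell2_single (fst (\<kappa> n)) (e (snd (\<kappa> n)))"
  shows "onseq a" "pisom a a = chi Y"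
proof -
  show oa: "onseq a"
    unfolding onseq_def
  proof (intro allI)
    fix m n
    have "m = n" if "fst (\<kappa> m) = fst (\<kappa> n)" "snd (\<kappa> m) = snd (\<kappa> n)"
      using that \<kappa>(1) by (metis prod_eqI injD)
    then show "cinner (a m) (a n) = (if m = n then 1 else 0)"
      by (auto simp: a_def cinner_single_left single_apply onseqD[OF total_onseq_onseq[OF e]])
  qed
  show "pisom a a = chi Y"
  proof (rule pisom_eqI[OF oa oa chi_clinear])
    have "fst (\<kappa> n) \<in> Y" for n using \<kappa>(2) by (metis mem_Times_iff rangeI)
    then show "chi Y (a n) = a n" for n by (simp add: a_def chi_single)
    fix v :: "('a, 'h) ell2" assume v: "\<And>n. cinner v (a n) = 0"
    have "ell2_fun v y = 0" if "y \<in> Y" for y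
    proof (rule total_onseq_orthogonal[OF e])
      fix m
      have "(y, m) \<in> range \<kappa>" using that \<kappa>(2) by simp
      then obtain n where "\<kappa> n = (y, m)" by (metis rangeE)
      then show "cinner (ell2_fun v y) (e m) = 0"
        using v[of n] by (simp add: a_def cinner_single_right)
    qed
    then show "chi Y v = 0" by (intro ell2_eqI) (simp add: chi_apply zero_ell2.rep_eq)
  qed
qed

lemma bounded_geometryD:
  assumes "bounded_geometry X"
  obtains N where "\<And>x. x \<in> X \<Longrightarrow> finite (X \<inter> cball x R)" "\<And>x. x \<in> X \<Longrightarrow> card (X \<inter> cball x R) \<le> N"
proof -
  obtain N where N: "\<forall>x\<in>X. finite (X \<inter> cball x (max R 1)) \<and> card (X \<inter> cball x (max R 1)) \<le> N"
    using assms unfolding bounded_geometry_def by (meson less_max_iff_disj zero_less_one)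
  have sub: "X \<inter> cball x R \<subseteq> X \<inter> cball x (max R 1)" for x by auto
  show ?thesis
    by (rule that[of N]) (use N finite_subset[OF sub] card_mono[OF _ sub] in \<open>blast intro: order_trans\<close>)+
qed

lemma bounded_geometry_subset: "bounded_geometry X \<Longrightarrow> Z \<subseteq> X \<Longrightarrow> bounded_geometry Z"
  unfolding bounded_geometry_def
  by (meson Int_mono card_mono finite_subset order_refl order_trans subsetD)

lemma bounded_geometry_countable:
  assumes "bounded_geometry X" shows "countable X"
proof (cases "X = {}")
  case False
  then obtain x0 where x0: "x0 \<in> X" by blast
  have "X = (\<Union>n::nat. X \<inter> cball x0 (real n))"
    using real_arch_simple by (auto simp: dist_commute)
  moreover have "finite (X \<inter> cball x0 R)" for R
  proof -
    obtain N where "\<And>x. x \<in> X \<Longrightarrow> finite (X \<inter> cball x R)" "\<And>x. x \<in> X \<Longrightarrow> card (X \<inter> cball x R) \<le> N"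
      using bounded_geometryD[OF assms, where R = R] by metis
    then show ?thesis using x0 by blast
  qed
  then have "countable (\<Union>n::nat. X \<inter> cball x0 (real n))"
    by (intro countable_UN countableI_type countable_finite)
  ultimately show ?thesis by simp
qed simp


section \<open>Coarse surjections\<close>

text \<open>A coarse equivalence that is exactly onto. The last condition is injectivity up to
  bounded distance.\<close>

definition coarse_surjection :: "'a::metric_space set \<Rightarrow> 'b::metric_space set \<Rightarrow> ('a \<Rightarrow> 'b) \<Rightarrow> bool" where
  "coarse_surjection Y Z r \<longleftrightarrow> r ` Y = Z \<and>
     (\<forall>R. \<exists>S. \<forall>y\<in>Y. \<forall>y'\<in>Y. dist y y' \<le> R \<longrightarrow> dist (r y) (r y') \<le> S) \<and>
     (\<forall>R. \<exists>S. \<forall>y\<in>Y. \<forall>y'\<in>Y. dist (r y) (r y') \<le> R \<longrightarrow> dist y y' \<le> S)"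

definition fiber :: "'a set \<Rightarrow> ('a \<Rightarrow> 'b) \<Rightarrow> 'b \<Rightarrow> 'a set" where
  "fiber Y r z = {y \<in> Y. r y = z}"

text \<open>The second control condition at \<open>R = 0\<close> bounds the diameters of the fibres,
  and bounded geometry turns this into a bound on their sizes.\<close>

lemma coarse_surjection_fibers:
  assumes "bounded_geometry Y" "coarse_surjection Y Z r"
  obtains k where "\<And>z. finite (fiber Y r z)" "\<And>z. card (fiber Y r z) \<le> k"
proof -
  obtain S where S: "\<And>y y'. y \<in> Y \<Longrightarrow> y' \<in> Y \<Longrightarrow> dist (r y) (r y') \<le> 0 \<Longrightarrow> dist y y' \<le> S"
    using assms(2) unfolding coarse_surjection_def by metis
  obtain N where N: "\<And>x. x \<in> Y \<Longrightarrow> finite (Y \<inter> cball x S)" "\<And>x. x \<in> Y \<Longrightarrow> card (Y \<inter> cball x S) \<le> N"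
    using bounded_geometryD[OF assms(1)] by metis
  have sub: "fiber Y r z \<subseteq> Y \<inter> cball x S" if "x \<in> fiber Y r z" for x z
    using that S by (auto simp: fiber_def)
  have "finite (fiber Y r z) \<and> card (fiber Y r z) \<le> N" for z
  proof (cases "fiber Y r z = {}")
    case False
    then obtain x where x: "x \<in> fiber Y r z" by blast
    then have "x \<in> Y" by (simp add: fiber_def)
    then show ?thesis using N sub[OF x] by (meson card_mono finite_subset order_trans)
  qed simp
  then show ?thesis using that by blast
qed

text \<open>For a total \<open>e\<close> and \<open>i < b\<close> these are isometries with mutually
  orthogonal ranges that together fill the space, as in a Cuntz family.\<close>

definition shift_op :: "(nat \<Rightarrow> 'h::chilbert_space) \<Rightarrow> nat \<Rightarrow> nat \<Rightarrow> ('h \<Rightarrow>\<^sub>L 'h)" where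
  "shift_op e b i = pisom e (\<lambda>n. e (n * b + i))"

definition shift_adj :: "(nat \<Rightarrow> 'h::chilbert_space) \<Rightarrow> nat \<Rightarrow> nat \<Rightarrow> ('h \<Rightarrow>\<^sub>L 'h)" where
  "shift_adj e b i = pisom (\<lambda>n. e (n * b + i)) e"

lemma onseq_shift: "onseq e \<Longrightarrow> b > 0 \<Longrightarrow> onseq (\<lambda>n. e (n * b + i))"
  by (rule onseq_subseq) (auto simp: inj_def)

lemma shift_adjoint: "onseq e \<Longrightarrow> b > 0 \<Longrightarrow> adjoint_pair (shift_op e b i) (shift_adj e b i)"
  unfolding shift_op_def shift_adj_def by (intro pisom_adjoint onseq_shift)

lemma norm_shift_op: "onseq e \<Longrightarrow> b > 0 \<Longrightarrow> norm (shift_op e b i v) \<le> norm v"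
  unfolding shift_op_def by (intro norm_pisom_apply_le onseq_shift)

text \<open>A fibre with \<open>b\<close> points is collapsed by \<open>H\<^sub>0 \<oplus> \<dots> \<oplus> H\<^sub>0 \<cong> H\<^sub>0\<close>, sending the \<open>n\<close>-th basis vector of
  the \<open>i\<close>-th summand to the basis vector with number \<open>n b + i\<close>.  Only finitely many operators of
  this form occur, so the constraint on the entries is respected.\<close>

lemma coarse_surjection_unitary:
  fixes e :: "nat \<Rightarrow> 'h::chilbert_space" and Y :: "'a::metric_space set"
    and Z :: "'b::metric_space set" and E :: "('h \<Rightarrow>\<^sub>L 'h) set set"
  assumes E: "entry_class E" and e: "total_onseq e" and bg: "bounded_geometry Y"
    and Y: "Y \<noteq> {}" and r: "coarse_surjection Y Z r"
  obtains W :: "('a, 'h) ell2 \<Rightarrow>\<^sub>L ('b, 'h) ell2" and W' and S :: "'a \<Rightarrow> ('h \<Rightarrow>\<^sub>L 'h)"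
  where "partial_unitary (chi Y) (chi Z) W W'"
    "\<And>T. T \<in> alg E Y \<Longrightarrow> W o\<^sub>L T o\<^sub>L W' \<in> alg E Z"
    "\<And>T. T \<in> alg E Z \<Longrightarrow> W' o\<^sub>L T o\<^sub>L W \<in> alg E Y"
    "\<And>\<eta> z. ell2_fun (W \<eta>) z = (\<Sum>y\<in>fiber Y r z. S y (ell2_fun \<eta> y))"
    "\<And>y. y \<in> Y \<Longrightarrow> clinear_op (S y)"
    "\<And>y v. y \<in> Y \<Longrightarrow> norm (S y v) \<le> norm v"
proof -
  interpret entry_class E by fact
  note oe = total_onseq_onseq[OF e]
  have rY: "r ` Y = Z" using r by (simp add: coarse_surjection_def)
  obtain k where fin: "\<And>z. finite (fiber Y r z)" and k: "\<And>z. card (fiber Y r z) \<le> k"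
    using coarse_surjection_fibers[OF bg r] by metis
  define b where "b z = card (fiber Y r z)" for z
  have "\<exists>h. bij_betw h (fiber Y r z) {..<b z}" for z
    using ex_bij_betw_finite_nat[OF fin[of z]] by (simp add: b_def atLeast0LessThan)
  then obtain h where h: "\<And>z. bij_betw (h z) (fiber Y r z) {..<b z}" by metis
  define i where "i y = h (r y) y" for y
  have ib: "i y < b (r y)" if "y \<in> Y" for y
    using bij_betw_apply[OF h[of "r y"], of y] that by (simp add: i_def fiber_def)
  have iinj: "y = y'" if "y \<in> Y" "y' \<in> Y" "r y = r y'" "i y = i y'" for y y'
    using bij_betw_imp_inj_on[OF h[of "r y"]] that by (auto simp: i_def fiber_def inj_on_def)
  have isurj: "\<exists>y\<in>Y. r y = z \<and> i y = m" if "m < b z" for z m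
  proof -
    have "m \<in> h z ` fiber Y r z" using bij_betw_imp_surj_on[OF h[of z]] that by simp
    then show ?thesis by (auto simp: i_def fiber_def)
  qed
  obtain \<kappa> :: "nat \<Rightarrow> 'a \<times> nat" where \<kappa>: "inj \<kappa>" "range \<kappa> = Y \<times> UNIV"
    using enumerate_product[OF bounded_geometry_countable[OF bg] Y] by blast
  note \<kappa>inj = \<kappa>(1)
  have \<kappa>P: "fst (\<kappa> n) \<in> Y" for n using \<kappa>(2) by (metis mem_Times_iff rangeI)
  have \<kappa>surj: "\<exists>n. \<kappa> n = (y, m)" if "y \<in> Y" for y m
  proof -
    have "(y, m) \<in> range \<kappa>" using that \<kappa>(2) by simp
    then show ?thesis by (metis rangeE)
  qed
  define a where "a n = ell2_single (fst (\<kappa> n)) (e (snd (\<kappa> n)))" for n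
  define c where "c n = ell2_single (r (fst (\<kappa> n))) (e (snd (\<kappa> n) * b (r (fst (\<kappa> n))) + i (fst (\<kappa> n))))" for n
  have oa: "onseq a" and aa: "pisom a a = chi Y"
    using basis_enumeration[OF e \<kappa>] by (simp_all add: a_def[abs_def])
  have oc: "onseq c"
    unfolding onseq_def
  proof (intro allI)
    fix m n
    have "m = n" if eq: "r (fst (\<kappa> m)) = r (fst (\<kappa> n))"
      "snd (\<kappa> m) * b (r (fst (\<kappa> m))) + i (fst (\<kappa> m)) = snd (\<kappa> n) * b (r (fst (\<kappa> n))) + i (fst (\<kappa> n))"
    proof -
      \<comment> \<open>Division by the size of the fibre separates the number of the basis vector
        from the position in the fibre.\<close>
      let ?b = "b (r (fst (\<kappa> m)))"
      have lt: "i (fst (\<kappa> m)) < ?b" "i (fst (\<kappa> n)) < ?b"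
        using ib[OF \<kappa>P[of m]] ib[OF \<kappa>P[of n]] eq(1) by auto
      have "(snd (\<kappa> m) * ?b + i (fst (\<kappa> m))) div ?b = (snd (\<kappa> n) * ?b + i (fst (\<kappa> n))) div ?b"
        "(snd (\<kappa> m) * ?b + i (fst (\<kappa> m))) mod ?b = (snd (\<kappa> n) * ?b + i (fst (\<kappa> n))) mod ?b"
        using eq by simp_all
      then have "snd (\<kappa> m) = snd (\<kappa> n)" "i (fst (\<kappa> m)) = i (fst (\<kappa> n))" using lt by simp_all
      moreover from this(2) have "fst (\<kappa> m) = fst (\<kappa> n)" using iinj[OF \<kappa>P \<kappa>P eq(1)] by simp
      ultimately show ?thesis using \<kappa>inj by (metis prod_eqI injD)
    qed
    then show "cinner (c m) (c n) = (if m = n then 1 else 0)"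
      by (auto simp: c_def cinner_single_left single_apply onseqD[OF oe])
  qed
  have cc: "pisom c c = chi Z"
  proof (rule pisom_eqI[OF oc oc chi_clinear])
    show "chi Z (c n) = c n" for n using \<kappa>P rY by (auto simp: c_def chi_single)
    fix v :: "('b, 'h) ell2" assume v: "\<And>n. cinner v (c n) = 0"
    have "ell2_fun v z = 0" if "z \<in> Z" for z
    proof (rule total_onseq_orthogonal[OF e])
      fix m
      have "b z > 0" using that rY ib by force
      \<comment> \<open>Conversely, the remainder of \<open>m\<close> selects the point of the fibre
        and the quotient the basis vector there that is sent to \<open>e m\<close>.\<close>
      then have "m mod b z < b z" by simp
      then obtain y where y: "y \<in> Y" "r y = z" "i y = m mod b z" using isurj by blast
      obtain n where n: "\<kappa> n = (y, m div b z)" using \<kappa>surj[OF y(1)] by blast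
      have "c n = ell2_single z (e m)" by (simp add: c_def n y)
      then show "cinner (ell2_fun v z) (e m) = 0"
        using v[of n] by (simp add: cinner_single_right)
    qed
    then show "chi Z v = 0" by (intro ell2_eqI) (simp add: chi_apply zero_ell2.rep_eq)
  qed
  define W where "W = pisom a c"
  define W' where "W' = pisom c a"
  have adj: "adjoint_pair W W'" unfolding W_def W'_def by (rule pisom_adjoint[OF oa oc])
  have UV: "partial_unitary (chi Y) (chi Z) W W'"
    unfolding partial_unitary_def W_def W'_def
    by (simp add: pisom_adjoint pisom_compose oa oc aa cc)
  define S where "S y = shift_op e (b (r y)) (i y)" for y
  define S' where "S' y = shift_adj e (b (r y)) (i y)" for y
  have bpos: "b (r y) > 0" if "y \<in> Y" for y using ib[OF that] by simp
  have SS': "adjoint_pair (S y) (S' y)" if "y \<in> Y" for y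
    unfolding S_def S'_def by (rule shift_adjoint[OF oe bpos[OF that]])
  have clS: "clinear_op (S y)" if "y \<in> Y" for y by (rule adjoint_pair_clinear[OF SS'[OF that]])
  have clS': "clinear_op (S' y)" if "y \<in> Y" for y
    by (rule adjoint_pair_clinear[OF adjoint_pair_sym[OF SS'[OF that]]])
  have clW: "clinear_op W" "clinear_op W'"
    using adj adjoint_pair_clinear adjoint_pair_sym by blast+
  have Wsingle: "W (ell2_single y v) = ell2_single (r y) (S y v)" if y: "y \<in> Y" for y v
  proof -
    have "W o\<^sub>L ell2_inj y = ell2_inj (r y) o\<^sub>L S y"
    proof (rule total_onseq_blinfun_eqI[OF e])
      fix m obtain n where n: "\<kappa> n = (y, m)" using \<kappa>surj[OF y] by blast
      have "ell2_single y (e m) = a n" by (simp add: a_def n)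
      moreover have "S y (e m) = e (m * b (r y) + i y)"
        unfolding S_def shift_op_def by (rule pisom_seq[OF oe onseq_shift[OF oe bpos[OF y]]])
      ultimately show "(W o\<^sub>L ell2_inj y) (e m) = (ell2_inj (r y) o\<^sub>L S y) (e m)"
        by (simp add: ell2_inj_apply W_def pisom_seq[OF oa oc] c_def n)
    qed (simp_all add: clinear_op_compose clW ell2_inj_clinear clS y)
    from arg_cong[OF this, of "\<lambda>T. blinfun_apply T v"] show ?thesis by (simp add: ell2_inj_apply)
  qed
  have W'chi: "chi Y (W' \<zeta>) = W' \<zeta>" for \<zeta>
    unfolding aa[symmetric] W'_def using pisom_compose[OF oc oa oa]
    by (metis blinfun_apply_blinfun_compose)
  have Wchi: "W (chi Y \<eta>) = W \<eta>" for \<eta>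
    unfolding aa[symmetric] W_def using pisom_compose[OF oa oa oc]
    by (metis blinfun_apply_blinfun_compose)
  have W'apply: "ell2_fun (W' \<zeta>) y = (if y \<in> Y then S' y (ell2_fun \<zeta> (r y)) else 0)" for \<zeta> y
  proof (cases "y \<in> Y")
    case True
    have "cinner (ell2_fun (W' \<zeta>) y) u = cinner (S' y (ell2_fun \<zeta> (r y))) u" for u
    proof -
      have "cinner (ell2_fun (W' \<zeta>) y) u = cinner \<zeta> (W (ell2_single y u))"
        by (simp add: cinner_single_right[symmetric] adjoint_pairD[OF adjoint_pair_sym[OF adj]])
      also have "\<dots> = cinner (S' y (ell2_fun \<zeta> (r y))) u"
        by (simp add: Wsingle[OF True] cinner_single_right
            adjoint_pairD[OF adjoint_pair_sym[OF SS'[OF True]]])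
      finally show ?thesis .
    qed
    then show ?thesis using True cinner_ext_left by auto
  next
    case False
    then show ?thesis using W'chi[of \<zeta>] by (metis chi_apply)
  qed
  have W'single: "W' (ell2_single z v) = (\<Sum>y\<in>fiber Y r z. ell2_single y (S' y v))" for z v
  proof (rule ell2_eqI)
    fix y
    have "(\<Sum>x\<in>fiber Y r z. if y = x then S' x v else 0) = (if y \<in> fiber Y r z then S' y v else 0)"
      using fin by simp
    then show "ell2_fun (W' (ell2_single z v)) y
      = ell2_fun (\<Sum>y\<in>fiber Y r z. ell2_single y (S' y v)) y"
      by (auto simp: W'apply ell2_fun_sum single_apply fiber_def)
  qed
  have Wapply: "ell2_fun (W \<eta>) z = (\<Sum>y\<in>fiber Y r z. S y (ell2_fun \<eta> y))" for \<eta> z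
  proof (rule cinner_ext_left)
    fix u
    have "cinner (ell2_fun (W \<eta>) z) u = cinner \<eta> (W' (ell2_single z u))"
      by (simp add: cinner_single_right[symmetric] adjoint_pairD[OF adj])
    also have "\<dots> = (\<Sum>y\<in>fiber Y r z. cinner (ell2_fun \<eta> y) (S' y u))"
      by (simp add: W'single cinner_sum_right cinner_single_right)
    also have "\<dots> = (\<Sum>y\<in>fiber Y r z. cinner (S y (ell2_fun \<eta> y)) u)"
      by (intro sum.cong refl) (auto simp: fiber_def adjoint_pairD[OF SS'])
    finally show "cinner (ell2_fun (W \<eta>) z) u
      = cinner (\<Sum>y\<in>fiber Y r z. S y (ell2_fun \<eta> y)) u"
      by (simp add: cinner_sum_left)
  qed
  define \<A> where "\<A> = (\<lambda>(b, i). shift_op e b i) ` {(b, i). b \<le> k \<and> i < b}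
    \<union> (\<lambda>(b, i). shift_adj e b i) ` {(b, i). b \<le> k \<and> i < b}"
  have "{(b, i). b \<le> k \<and> i < b} \<subseteq> {..k} \<times> {..k}" by auto
  then have "finite {(b, i). b \<le> k \<and> i < b}" by (rule finite_subset) simp
  then have fin\<A>: "finite \<A>" by (simp add: \<A>_def)
  have adj\<A>: "adjointable A" if "A \<in> \<A>" for A
  proof -
    obtain p where "p \<in> {(b, i). b \<le> k \<and> i < b}"
      "A = (case p of (b, i) \<Rightarrow> shift_op e b i) \<or> A = (case p of (b, i) \<Rightarrow> shift_adj e b i)"
      using \<open>A \<in> \<A>\<close> unfolding \<A>_def by blast
    moreover obtain b i where "p = (b, i)" by (cases p)
    ultimately have "b > 0" "A = shift_op e b i \<or> A = shift_adj e b i" by auto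
    then show ?thesis
      using shift_adjoint[OF oe, of b i] adjoint_pair_sym unfolding adjointable_def by blast
  qed
  have S\<A>: "S y \<in> \<A>" "S' y \<in> \<A>" if "y \<in> Y" for y
    using ib[OF that] k[of "r y"] unfolding \<A>_def S_def S'_def b_def[symmetric] by auto
  have entW: "matrix_entry (W o\<^sub>L T o\<^sub>L W') z z'
    = (\<Sum>(y, y')\<in>fiber Y r z \<times> fiber Y r z'. S y o\<^sub>L matrix_entry T y y' o\<^sub>L S' y')" for T z z'
  proof (rule blinfun_eqI)
    fix v
    have "matrix_entry (W o\<^sub>L T o\<^sub>L W') z z' v
      = (\<Sum>y\<in>fiber Y r z. \<Sum>y'\<in>fiber Y r z'. S y (matrix_entry T y y' (S' y' v)))"
      by (subst sum.swap)
        (simp add: matrix_entry_apply Wapply W'single blinfun.sum_right ell2_fun_sum)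
    then show "matrix_entry (W o\<^sub>L T o\<^sub>L W') z z' v
      = (\<Sum>(y, y')\<in>fiber Y r z \<times> fiber Y r z'. S y o\<^sub>L matrix_entry T y y' o\<^sub>L S' y') v"
      by (simp add: blinfun_sum_apply sum.cartesian_product case_prod_beta)
  qed
  have entW': "matrix_entry (W' o\<^sub>L T o\<^sub>L W) y y'
    = (if y \<in> Y \<and> y' \<in> Y then S' y o\<^sub>L matrix_entry T (r y) (r y') o\<^sub>L S y' else 0)" for T y y'
  proof (rule blinfun_eqI)
    fix v
    have "W (ell2_single y' v) = 0" if "y' \<notin> Y"
      using Wchi[of "ell2_single y' v"] that by (simp add: chi_single)
    then show "matrix_entry (W' o\<^sub>L T o\<^sub>L W) y y' v
      = blinfun_apply (if y \<in> Y \<and> y' \<in> Y then S' y o\<^sub>L matrix_entry T (r y) (r y') o\<^sub>L S y' else 0) v"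
      by (auto simp: matrix_entry_apply W'apply Wsingle zero_ell2.rep_eq)
  qed
  have pre: "W o\<^sub>L T o\<^sub>L W' \<in> pre_alg E Z" if T: "T \<in> pre_alg E Y" for T
  proof -
    obtain M R where T: "T \<in> op_on (ell2_on Y)" "M \<in> E" "\<And>x y. matrix_entry T x y \<in> M"
      "\<And>x y. matrix_entry T x y \<noteq> 0 \<Longrightarrow> dist x y \<le> R"
      using T by (auto simp: pre_alg_def finite_propagation_iff)
    obtain L where L: "L \<in> E" "\<And>A B K. A \<in> \<A> \<Longrightarrow> B \<in> \<A> \<Longrightarrow> K \<in> M \<Longrightarrow> A o\<^sub>L K o\<^sub>L B \<in> L"
      using compose[OF T(2) fin\<A> adj\<A>] by blast
    obtain L' where L': "L' \<in> E" "\<And>I (f :: 'a \<times> 'a \<Rightarrow> _). finite I \<Longrightarrow> card I \<le> k * k \<Longrightarrow> f ` I \<subseteq> L \<Longrightarrow> sum f I \<in> L'"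
      using bounded_sums[OF L(1), of "k * k"] by blast
    have "matrix_entry (W o\<^sub>L T o\<^sub>L W') z z' \<in> L'" for z z'
      unfolding entW
    proof (rule L'(2))
      show "card (fiber Y r z \<times> fiber Y r z') \<le> k * k"
        by (simp add: card_cartesian_product mult_le_mono k)
      show "(\<lambda>(y, y'). S y o\<^sub>L matrix_entry T y y' o\<^sub>L S' y') ` (fiber Y r z \<times> fiber Y r z') \<subseteq> L"
        using L(2) S\<A> T(3) by (auto simp: fiber_def)
    qed (simp add: fin)
    moreover have "finite_propagation (W o\<^sub>L T o\<^sub>L W')"
    proof -
      obtain Q where Q: "\<And>y y'. y \<in> Y \<Longrightarrow> y' \<in> Y \<Longrightarrow> dist y y' \<le> R \<Longrightarrow> dist (r y) (r y') \<le> Q"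
        using r unfolding coarse_surjection_def by metis
      have "dist z z' \<le> Q" if ne: "matrix_entry (W o\<^sub>L T o\<^sub>L W') z z' \<noteq> 0" for z z'
      proof -
        have "\<exists>p\<in>fiber Y r z \<times> fiber Y r z'. (case p of (y, y') \<Rightarrow> S y o\<^sub>L matrix_entry T y y' o\<^sub>L S' y') \<noteq> 0"
          using ne unfolding entW by (metis (mono_tags, lifting) sum.neutral)
        then obtain y y' where y: "y \<in> Y" "r y = z" "y' \<in> Y" "r y' = z'"
          "S y o\<^sub>L matrix_entry T y y' o\<^sub>L S' y' \<noteq> 0" by (auto simp: fiber_def)
        have "matrix_entry T y y' \<noteq> 0"
          using y(5) by (auto simp: blinfun_compose_zero)
        then show ?thesis using T(4) Q y by blast
      qed
      then show ?thesis unfolding finite_propagation_iff by blast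
    qed
    moreover have "W o\<^sub>L T o\<^sub>L W' \<in> op_on (ell2_on Z)"
    proof (rule op_on_ell2_on_entryI)
      show "clinear_op (W o\<^sub>L T o\<^sub>L W')"
        by (intro clinear_op_compose clW op_on_ell2_on_clinear[OF T(1)])
      fix z z' assume "\<not> (z \<in> Z \<and> z' \<in> Z)"
      then have "fiber Y r z = {} \<or> fiber Y r z' = {}" using rY by (auto simp: fiber_def)
      then show "matrix_entry (W o\<^sub>L T o\<^sub>L W') z z' = 0" unfolding entW by auto
    qed
    ultimately show ?thesis using L'(1) unfolding pre_alg_def by blast
  qed
  have pre': "W' o\<^sub>L T o\<^sub>L W \<in> pre_alg E Y" if T: "T \<in> pre_alg E Z" for T
  proof -
    obtain M R where T: "T \<in> op_on (ell2_on Z)" "M \<in> E" "\<And>x y. matrix_entry T x y \<in> M"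
      "\<And>x y. matrix_entry T x y \<noteq> 0 \<Longrightarrow> dist x y \<le> R"
      using T by (auto simp: pre_alg_def finite_propagation_iff)
    obtain L where L: "L \<in> E" "\<And>A B K. A \<in> \<A> \<Longrightarrow> B \<in> \<A> \<Longrightarrow> K \<in> M \<Longrightarrow> A o\<^sub>L K o\<^sub>L B \<in> L"
      using compose[OF T(2) fin\<A> adj\<A>] by blast
    have "matrix_entry (W' o\<^sub>L T o\<^sub>L W) y y' \<in> L" for y y'
      unfolding entW' using L(2) S\<A> T(3) zero[OF L(1)] by simp
    moreover have "finite_propagation (W' o\<^sub>L T o\<^sub>L W)"
    proof -
      obtain Q where Q: "\<And>y y'. y \<in> Y \<Longrightarrow> y' \<in> Y \<Longrightarrow> dist (r y) (r y') \<le> R \<Longrightarrow> dist y y' \<le> Q"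
        using r unfolding coarse_surjection_def by metis
      have "dist y y' \<le> Q" if ne: "matrix_entry (W' o\<^sub>L T o\<^sub>L W) y y' \<noteq> 0" for y y'
      proof -
        have "y \<in> Y" "y' \<in> Y" "matrix_entry T (r y) (r y') \<noteq> 0"
          using ne unfolding entW' by (auto simp: blinfun_compose_zero split: if_splits)
        then show ?thesis using T(4) Q by blast
      qed
      then show ?thesis unfolding finite_propagation_iff by blast
    qed
    moreover have "W' o\<^sub>L T o\<^sub>L W \<in> op_on (ell2_on Y)"
      by (rule op_on_ell2_on_entryI)
        (auto simp: clinear_op_compose clW op_on_ell2_on_clinear[OF T(1)] entW')
    ultimately show ?thesis using L(1) unfolding pre_alg_def by blast
  qed
  show ?thesis
  proof (rule that[OF UV _ _ Wapply clS])
    show "norm (S y v) \<le> norm v" if "y \<in> Y" for y v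
      unfolding S_def by (rule norm_shift_op[OF oe bpos[OF that]])
  qed (auto intro: conjugate_alg pre pre')
qed

lemma unitary_star_isomorphic:
  assumes UV: "partial_unitary (chi X) (chi Y) U V"
    and AB: "\<And>T. T \<in> A \<Longrightarrow> U o\<^sub>L T o\<^sub>L V \<in> B" and BA: "\<And>T. T \<in> B \<Longrightarrow> V o\<^sub>L T o\<^sub>L U \<in> A"
    and A: "A \<subseteq> op_on (ell2_on X)" and B: "B \<subseteq> op_on (ell2_on Y)"
  shows "star_isomorphic A B" "star_isomorphic B A"
proof -
  have A': "chi X o\<^sub>L T = T \<and> T o\<^sub>L chi X = T" if "T \<in> A" for T
    using A that op_on_ell2_on_iff by blast
  have B': "chi Y o\<^sub>L T = T \<and> T o\<^sub>L chi Y = T" if "T \<in> B" for T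
    using B that op_on_ell2_on_iff by blast
  show "star_isomorphic A B"
    unfolding star_isomorphic_def
    using partial_unitary_star_isomorphism[OF UV A' B' AB BA] by blast
  show "star_isomorphic B A"
    unfolding star_isomorphic_def
    using partial_unitary_star_isomorphism[OF partial_unitary_sym[OF UV] B' A' BA AB] by blast
qed

lemma coarse_surjection_star_isomorphic:
  fixes e :: "nat \<Rightarrow> 'h::chilbert_space" and E :: "('h \<Rightarrow>\<^sub>L 'h) set set"
    and Y :: "'b::metric_space set" and Z :: "'a::metric_space set"
  assumes "entry_class E" "total_onseq e" "bounded_geometry Y" "Y \<noteq> {}" "coarse_surjection Y Z r"
  shows "star_isomorphic (alg E Y) (alg E Z)" "star_isomorphic (alg E Z) (alg E Y)"
proof -
  obtain W :: "('b, 'h) ell2 \<Rightarrow>\<^sub>L ('a, 'h) ell2" and W' and S :: "'b \<Rightarrow> ('h \<Rightarrow>\<^sub>L 'h)"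
    where W: "partial_unitary (chi Y) (chi Z) W W'"
    "\<And>T. T \<in> alg E Y \<Longrightarrow> W o\<^sub>L T o\<^sub>L W' \<in> alg E Z"
    "\<And>T. T \<in> alg E Z \<Longrightarrow> W' o\<^sub>L T o\<^sub>L W \<in> alg E Y"
    "\<And>\<eta> z. ell2_fun (W \<eta>) z = (\<Sum>y\<in>fiber Y r z. S y (ell2_fun \<eta> y))"
    "\<And>y. y \<in> Y \<Longrightarrow> clinear_op (S y)" "\<And>y v. y \<in> Y \<Longrightarrow> norm (S y v) \<le> norm v"
    by (rule coarse_surjection_unitary[OF assms]) (rule that; blast)
  have sub: "alg E Y \<subseteq> op_on (ell2_on Y)" "alg E Z \<subseteq> op_on (ell2_on Z)"
    by (auto intro: alg_op_on)
  show "star_isomorphic (alg E Y) (alg E Z)" "star_isomorphic (alg E Z) (alg E Y)"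
    by (rule unitary_star_isomorphic[OF W(1-3) sub]; assumption)+
qed

section \<open>Coarse embeddings through two boundedness conditions\<close>

lemma control_function_inverse:
  assumes \<rho>: "control_function \<rho>"
  obtains S where "\<And>t. t \<ge> 0 \<Longrightarrow> \<rho> t \<le> R \<Longrightarrow> t \<le> S"
proof -
  obtain s where s: "s \<ge> 0" "\<rho> s > R"
    using \<rho> unfolding control_function_def bdd_above_def by (metis atLeast_iff imageE not_le)
  have "t \<le> s" if "t \<ge> 0" "\<rho> t \<le> R" for t
  proof (rule ccontr)
    assume "\<not> t \<le> s"
    moreover have "mono_on {0..} \<rho>" using \<rho> by (simp add: control_function_def)
    ultimately have "\<rho> s \<le> \<rho> t" using mono_onD[of "{0..}" \<rho> s t] s(1) that(1) by simp
    then show False using s(2) that(2) by simp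
  qed
  then show ?thesis by (rule that)
qed

text \<open>These conditions restrict to subspaces without any handling of control functions;
  \<open>coarse_embeddingI\<close> is the way back.\<close>

lemma coarse_embedding_control:
  assumes f: "coarse_embedding X Y f"
  shows "f ` X \<subseteq> Y"
    and "\<exists>S. \<forall>x\<in>X. \<forall>x'\<in>X. dist x x' \<le> R \<longrightarrow> dist (f x) (f x') \<le> S"
    and "\<exists>S. \<forall>x\<in>X. \<forall>x'\<in>X. dist (f x) (f x') \<le> R \<longrightarrow> dist x x' \<le> S"
proof -
  obtain \<rho>1 \<rho>2 where \<rho>: "control_function \<rho>1" "control_function \<rho>2"
    and lo: "\<And>x x'. x \<in> X \<Longrightarrow> x' \<in> X \<Longrightarrow> \<rho>1 (dist x x') \<le> dist (f x) (f x')"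
    and up: "\<And>x x'. x \<in> X \<Longrightarrow> x' \<in> X \<Longrightarrow> dist (f x) (f x') \<le> \<rho>2 (dist x x')"
    using f unfolding coarse_embedding_def by blast
  show "f ` X \<subseteq> Y" using f unfolding coarse_embedding_def by blast
  \<comment> \<open>\<open>\<rho>2\<close> is monotone on nonnegative arguments only, and
    \<open>R\<close> may be negative.\<close>
  have "dist (f x) (f x') \<le> \<rho>2 (max R 0)" if "x \<in> X" "x' \<in> X" "dist x x' \<le> R" for x x'
  proof -
    have "mono_on {0..} \<rho>2" using \<rho>(2) by (simp add: control_function_def)
    from mono_onD[OF this, of "dist x x'" "max R 0"] have "\<rho>2 (dist x x') \<le> \<rho>2 (max R 0)"
      using that(3) by simp
    then show ?thesis using up[OF that(1,2)] by simp
  qed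
  then show "\<exists>S. \<forall>x\<in>X. \<forall>x'\<in>X. dist x x' \<le> R \<longrightarrow> dist (f x) (f x') \<le> S" by blast
  obtain S where S: "\<And>t. t \<ge> 0 \<Longrightarrow> \<rho>1 t \<le> R \<Longrightarrow> t \<le> S"
    using control_function_inverse[OF \<rho>(1)] by blast
  have "dist x x' \<le> S" if "x \<in> X" "x' \<in> X" "dist (f x) (f x') \<le> R" for x x'
    using S[of "dist x x'"] lo[OF that(1,2)] that(3) by simp
  then show "\<exists>S. \<forall>x\<in>X. \<forall>x'\<in>X. dist (f x) (f x') \<le> R \<longrightarrow> dist x x' \<le> S" by blast
qed

lemma coarse_embedding_surjection:
  assumes "coarse_embedding X Y f" "Z \<subseteq> X" shows "coarse_surjection Z (f ` Z) f"
  unfolding coarse_surjection_def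
proof (intro conjI allI)
  fix R
  show "\<exists>S. \<forall>x\<in>Z. \<forall>x'\<in>Z. dist x x' \<le> R \<longrightarrow> dist (f x) (f x') \<le> S"
    using coarse_embedding_control(2)[OF assms(1), of R] assms(2) by (meson subsetD)
  show "\<exists>S. \<forall>x\<in>Z. \<forall>x'\<in>Z. dist (f x) (f x') \<le> R \<longrightarrow> dist x x' \<le> S"
    using coarse_embedding_control(3)[OF assms(1), of R] assms(2) by (meson subsetD)
qed simp

text \<open>Both \<open>X\<close> and \<open>Y\<close> are collapsed onto the image of the coarse equivalence.\<close>

proposition coarsely_equivalent_star_isomorphic:
  fixes X :: "'a::metric_space set" and Y :: "'b::metric_space set"
    and e :: "nat \<Rightarrow> 'h::chilbert_space" and E :: "('h \<Rightarrow>\<^sub>L 'h) set set"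
  assumes E: "entry_class E" "total_onseq e" and bg: "bounded_geometry X" "bounded_geometry Y"
    and X: "X \<noteq> {}" and ce: "coarsely_equivalent X Y"
  shows "star_isomorphic (alg E X) (alg E Y)"
proof -
  obtain f C where f: "coarse_embedding X Y f" and C: "\<And>y. y \<in> Y \<Longrightarrow> \<exists>x\<in>X. dist y (f x) \<le> C"
    and C0: "C > 0"
    using ce unfolding coarsely_equivalent_def by blast
  have sub: "f ` X \<subseteq> Y" by (rule coarse_embedding_control(1)[OF f])
  \<comment> \<open>The map of bounded displacement onto the image is made to fix the image
    pointwise; otherwise it might miss some of its points.\<close>
  have "\<exists>z\<in>f ` X. dist y z \<le> C \<and> (y \<in> f ` X \<longrightarrow> z = y)" if "y \<in> Y" for y
  proof (cases "y \<in> f ` X")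
    case True
    then show ?thesis using C0 by (intro bexI[of _ y]) auto
  next
    case False
    then show ?thesis using C[OF that] by blast
  qed
  then obtain r where r: "\<And>y. y \<in> Y \<Longrightarrow> r y \<in> f ` X \<and> dist y (r y) \<le> C \<and> (y \<in> f ` X \<longrightarrow> r y = y)"
    by metis
  have "coarse_surjection Y (f ` X) r"
    unfolding coarse_surjection_def
  proof (intro conjI allI)
    show "r ` Y = f ` X" using r sub by (auto simp: image_iff) (metis imageI subsetD)
    fix R
    have tri: "dist (r y) (r y') \<le> dist y y' + 2 * C" "dist y y' \<le> dist (r y) (r y') + 2 * C"
      if "y \<in> Y" "y' \<in> Y" for y y'
      using r[OF that(1)] r[OF that(2)] dist_triangle[of "r y" "r y'" y] dist_triangle[of y "r y'" y']
        dist_triangle[of y y' "r y"] dist_triangle[of "r y" y' "r y'"]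
      by (simp_all add: dist_commute)
    show "\<exists>S. \<forall>y\<in>Y. \<forall>y'\<in>Y. dist y y' \<le> R \<longrightarrow> dist (r y) (r y') \<le> S"
      using tri by (intro exI[of _ "R + 2 * C"]) fastforce
    show "\<exists>S. \<forall>y\<in>Y. \<forall>y'\<in>Y. dist (r y) (r y') \<le> R \<longrightarrow> dist y y' \<le> S"
      using tri by (intro exI[of _ "R + 2 * C"]) fastforce
  qed
  moreover have "Y \<noteq> {}" using X sub by blast
  ultimately have "star_isomorphic (alg E (f ` X)) (alg E Y)"
    using coarse_surjection_star_isomorphic(2)[OF E bg(2)] by blast
  with coarse_surjection_star_isomorphic(1)[OF E bg(1) X coarse_embedding_surjection[OF f order_refl]]
  show ?thesis by (rule star_isomorphic_trans)
qed


section \<open>Subsequences\<close>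

lemma fast_subsequence:
  assumes "\<And>n m. \<exists>k>m. Q n m k"
  obtains r :: "nat \<Rightarrow> nat" where "strict_mono r" "\<And>n. Q n (r n) (r (Suc n))"
proof -
  obtain r where "\<And>n. r n < r (Suc n) \<and> Q n (r n) (r (Suc n))"
    using dependent_nat_choice[of "\<lambda>_ _. True" "\<lambda>n m k. m < k \<and> Q n m k"] assms by auto
  then show ?thesis using that[of r] by (simp add: strict_mono_Suc_iff)
qed

lemma injective_subsequence:
  assumes "\<And>c. finite {n. z n = c}"
  shows "\<exists>r :: nat \<Rightarrow> nat. strict_mono r \<and> inj (\<lambda>n. z (r n))"
proof -
  have "\<exists>k>m. z k \<notin> z ` {..m}" for m
  proof -
    have "finite (\<Union>c\<in>z ` {..m}. {n. z n = c})" using assms by blast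
    then have "finite ({..m} \<union> (\<Union>c\<in>z ` {..m}. {n. z n = c}))" by simp
    then obtain k where "k \<notin> {..m} \<union> (\<Union>c\<in>z ` {..m}. {n. z n = c})"
      using ex_new_if_finite[OF infinite_UNIV_nat] by blast
    then show ?thesis by (intro exI[of _ k]) auto
  qed
  then obtain r where r: "strict_mono r" "\<And>n. z (r (Suc n)) \<notin> z ` {..r n}"
    using fast_subsequence[of "\<lambda>n m k. z k \<notin> z ` {..m}"] by blast
  have "z (r i) \<noteq> z (r j)" if ij: "i < j" for i j
  proof -
    obtain j' where j': "j = Suc j'" using ij by (cases j) auto
    then have "r i \<le> r j'" using r(1) ij by (simp add: strict_mono_less_eq)
    then show ?thesis using r(2)[of j'] j' by (metis atMost_iff imageI)
  qed
  then have "inj (\<lambda>n. z (r n))" by (intro injI) (metis nat_neq_iff)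
  then show ?thesis using r(1) by blast
qed

text \<open>Each new index is taken so late that its row and its column are small against all
  earlier indices; the two limits serve the two sides of the diagonal. The bound decays with the
  column \<open>j\<close>, so that every row has off-diagonal sum at most
  \<open>2 * c\<close>.\<close>

lemma almost_diagonal_subsequence:
  fixes \<alpha> :: "nat \<Rightarrow> nat \<Rightarrow> real"
  assumes "\<And>n. (\<lambda>m. \<alpha> n m) \<longlonglongrightarrow> 0" "\<And>m. (\<lambda>n. \<alpha> n m) \<longlonglongrightarrow> 0" and c: "c > 0"
  obtains r :: "nat \<Rightarrow> nat" where "strict_mono r"
    "\<And>i j. i \<noteq> j \<Longrightarrow> \<alpha> (r i) (r j) \<le> c * (1/2) ^ j"
proof -
  have "\<exists>k>m. \<forall>i\<le>m. \<alpha> i k \<le> c * (1/2) ^ Suc n \<and> \<alpha> k i \<le> c * (1/2) ^ Suc n" for n m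
  proof -
    have pos: "c * (1/2) ^ Suc n > 0" using c by simp
    have "eventually (\<lambda>k. \<alpha> i k \<le> c * (1/2) ^ Suc n) sequentially" for i
      by (rule eventually_mono[OF order_tendstoD(2)[OF assms(1) pos] less_imp_le])
    moreover have "eventually (\<lambda>k. \<alpha> k i \<le> c * (1/2) ^ Suc n) sequentially" for i
      by (rule eventually_mono[OF order_tendstoD(2)[OF assms(2) pos] less_imp_le])
    ultimately have "eventually (\<lambda>k. k > m \<and> (\<forall>i\<in>{..m}. \<alpha> i k \<le> c * (1/2) ^ Suc n \<and> \<alpha> k i \<le> c * (1/2) ^ Suc n)) sequentially"
      by (intro eventually_conj eventually_gt_at_top eventually_ball_finite) (auto intro: eventually_conj)
    then obtain k where "k > m \<and> (\<forall>i\<in>{..m}. \<alpha> i k \<le> c * (1/2) ^ Suc n \<and> \<alpha> k i \<le> c * (1/2) ^ Suc n)"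
      unfolding eventually_sequentially by blast
    then show ?thesis by (intro exI[of _ k]) auto
  qed
  then obtain r where r: "strict_mono r"
    "\<And>n. \<forall>i\<le>r n. \<alpha> i (r (Suc n)) \<le> c * (1/2) ^ Suc n \<and> \<alpha> (r (Suc n)) i \<le> c * (1/2) ^ Suc n"
    using fast_subsequence[of "\<lambda>n m k. \<forall>i\<le>m. \<alpha> i k \<le> c * (1/2) ^ Suc n \<and> \<alpha> k i \<le> c * (1/2) ^ Suc n"]
    by blast
  have lt: "\<alpha> (r i) (r j) \<le> c * (1/2) ^ j \<and> \<alpha> (r j) (r i) \<le> c * (1/2) ^ j" if ij: "i < j" for i j
  proof -
    obtain j' where j': "j = Suc j'" using ij by (cases j) auto
    then have "r i \<le> r j'" using r(1) ij by (simp add: strict_mono_less_eq)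
    then show ?thesis using r(2)[of j'] unfolding j' by blast
  qed
  have "\<alpha> (r i) (r j) \<le> c * (1/2) ^ j" if "i \<noteq> j" for i j
  proof (cases "i < j")
    case False
    then have "j < i" using that by simp
    then have "\<alpha> (r i) (r j) \<le> c * (1/2) ^ i" using lt by blast
    also have "\<dots> \<le> c * (1/2) ^ j" using \<open>j < i\<close> c by (intro mult_left_mono power_decreasing) auto
    finally show ?thesis .
  qed (use lt in blast)
  then show ?thesis using that r(1) by blast
qed


section \<open>Rigidity\<close>

locale alg_unitary = entry_class E for E :: "('h::chilbert_space \<Rightarrow>\<^sub>L 'h) set set" +
  fixes X :: "'a::metric_space set" and Y :: "'b::metric_space set"
    and U :: "('a, 'h) ell2 \<Rightarrow>\<^sub>L ('b, 'h) ell2" and V :: "('b, 'h) ell2 \<Rightarrow>\<^sub>L ('a, 'h) ell2" and e :: 'h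
  assumes UV: "partial_unitary (chi X) (chi Y) U V"
    and U_alg: "\<And>T. T \<in> alg E X \<Longrightarrow> U o\<^sub>L T o\<^sub>L V \<in> alg E Y"
    and V_alg: "\<And>T. T \<in> alg E Y \<Longrightarrow> V o\<^sub>L T o\<^sub>L U \<in> alg E X"
    and bgX: "bounded_geometry X" and bgY: "bounded_geometry Y"
    and e: "norm e = 1"
begin

text \<open>The assumptions are symmetric in \<open>U\<close> and \<open>V\<close>, so everything
  proved for \<open>U\<close> becomes available for \<open>V\<close>.\<close>

lemma swap: "alg_unitary E Y X V U e"
  by unfold_locales (rule partial_unitary_sym[OF UV] V_alg U_alg bgX bgY e; assumption?)+

lemma VU: "V (U v) = chi X v" and UV': "U (V w) = chi Y w"
  using partial_unitary_apply[OF UV] by auto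

lemma adj: "adjoint_pair U V"
  using UV by (simp add: partial_unitary_def)

lemma clU: "clinear_op U" and clV: "clinear_op V"
  using adj adjoint_pair_clinear adjoint_pair_sym by blast+

lemma onseq_U:
  assumes "onseq a" "\<And>n. chi X (a n) = a n" shows "onseq (\<lambda>n. U (a n))"
  using assms by (simp add: onseq_def adjoint_pairD[OF adj] VU)

lemma chi_U: "chi Y (U v) = U (chi X v)"
  by (metis UV' VU)

lemma U_in:
  assumes "x \<in> X" "y \<notin> Y" shows "ell2_fun (U (ell2_single x v)) y = 0"
proof -
  have "chi Y (U (ell2_single x v)) = U (ell2_single x v)"
    using assms(1) by (simp add: chi_U chi_single)
  then show ?thesis using assms(2) by (metis chi_apply)
qed

lemma norm_U_single: "x \<in> X \<Longrightarrow> norm (U (ell2_single x v)) = norm v"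
proof -
  assume x: "x \<in> X"
  have "cinner (U (ell2_single x v)) (U (ell2_single x v)) = cinner v v"
    using x by (simp add: adjoint_pairD[OF adj] VU chi_single cinner_single_left single_apply)
  then show ?thesis
    by (simp add: cinner_self power2_eq_iff_nonneg flip: of_real_power)
qed

text \<open>On a subsequence the vectors \<open>y n \<otimes> w n\<close> are almost orthogonal to all the \<open>U(x m \<otimes> v m)\<close> with
  \<open>m \<noteq> n\<close>.  The image of the partial translation \<open>x n \<otimes> v n \<mapsto> x' n \<otimes> v' n\<close> then has entries at
  \<open>(y' n, y n)\<close> which are bounded below, so that these pairs have bounded distance.\<close>

lemma separation:
  assumes x: "inj x" "range x \<subseteq> X" and x': "inj x'" "range x' \<subseteq> X"
    and R: "\<And>n. dist (x n) (x' n) \<le> R"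
    and V0: "admissible E V0" and v: "\<And>n. v n \<in> V0" "\<And>n. norm (v n) = 1"
    and v': "\<And>n. v' n \<in> V0" "\<And>n. norm (v' n) = 1"
    and y: "inj y" and w: "\<And>n. norm (w n) = 1" and w': "\<And>n. norm (w' n) = 1" and d: "\<delta> > 0"
    and xy: "\<And>n. \<delta> \<le> cmod (cinner (U (ell2_single (x n) (v n))) (ell2_single (y n) (w n)))"
    and xy': "\<And>n. \<delta> \<le> cmod (cinner (U (ell2_single (x' n) (v' n))) (ell2_single (y' n) (w' n)))"
    and lim: "filterlim (\<lambda>n. dist (y' n) (y n)) at_top sequentially"
  shows False
proof -
  define a where "a n = ell2_single (x n) (v n)" for n
  define b where "b n = ell2_single (x' n) (v' n)" for n
  define c where "c n = ell2_single (y n) (w n)" for n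
  define d where "d n = ell2_single (y' n) (w' n)" for n
  have oa: "onseq a" and ob: "onseq b" and oc: "onseq c"
    unfolding a_def b_def c_def by (rule onseq_single; fact)+
  have Xa: "chi X (a n) = a n" and Xb: "chi X (b n) = b n" for n
    using x(2) x'(2) by (auto simp: a_def b_def chi_single)
  have oUa: "onseq (\<lambda>n. U (a n))" by (rule onseq_U[OF oa Xa])
  \<comment> \<open>Rows tend to 0 because the \<open>U (a m)\<close> are orthonormal, columns
    because the \<open>c n\<close> are.\<close>
  define \<alpha> where "\<alpha> n m = cmod (cinner (c n) (U (a m)))" for n m
  have "(\<lambda>m. \<alpha> n m) \<longlonglongrightarrow> 0" for n
    unfolding \<alpha>_def using tendsto_norm_zero[OF cinner_onseq_tendsto_0(2)[OF oUa]] .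
  moreover have "(\<lambda>n. \<alpha> n m) \<longlonglongrightarrow> 0" for m
    unfolding \<alpha>_def using tendsto_norm_zero[OF cinner_onseq_tendsto_0(1)[OF oc]] .
  \<comment> \<open>With this constant the cross terms add up to at most
    \<open>\<delta>\<^sup>2 / 2\<close> and the whole coefficient is below
    \<open>\<delta>\<^sup>2 / 4\<close> far from the diagonal, whereas the main term is at least
    \<open>\<delta>\<^sup>2\<close>.\<close>
  moreover have "\<delta>\<^sup>2 / 4 > 0" using \<open>\<delta> > 0\<close> by simp
  ultimately obtain r where r: "strict_mono r"
    and small: "\<And>i j. i \<noteq> j \<Longrightarrow> \<alpha> (r i) (r j) \<le> \<delta>\<^sup>2 / 4 * (1/2) ^ j"
    using almost_diagonal_subsequence[of \<alpha> "\<delta>\<^sup>2 / 4"] by blast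
  have ir: "inj r" using r by (rule strict_mono_imp_inj_on)
  define T where "T = pisom (\<lambda>n. a (r n)) (\<lambda>n. b (r n))"
  have oar: "onseq (\<lambda>n. a (r n))" and obr: "onseq (\<lambda>n. b (r n))"
    using onseq_subseq[OF oa ir] onseq_subseq[OF ob ir] .
  have "T \<in> alg E X"
    unfolding T_def a_def b_def
    using x x' ir by (intro partial_translation_alg[OF _ _ _ _ _ V0, where R = R])
      (auto simp: inj_def R v v')
  then have "U o\<^sub>L T o\<^sub>L V \<in> alg E Y" by (rule U_alg)
  then obtain S where S: "\<And>y y' w w'. dist y' y > S \<Longrightarrow> norm w = 1 \<Longrightarrow> norm w' = 1 \<Longrightarrow>
      cmod (cinner ((U o\<^sub>L T o\<^sub>L V) (ell2_single y w)) (ell2_single y' w')) < \<delta>\<^sup>2 / 4"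
    using alg_off_diagonal[of "U o\<^sub>L T o\<^sub>L V" E Y "\<delta>\<^sup>2 / 4"] \<open>\<delta>\<^sup>2 / 4 > 0\<close> by blast
  have "eventually (\<lambda>n. dist (y' n) (y n) > S) sequentially"
    using lim by (simp add: filterlim_at_top_dense)
  then obtain N where N: "\<And>n. n \<ge> N \<Longrightarrow> dist (y' n) (y n) > S"
    by (auto simp: eventually_sequentially)
  define n where "n = r N"
  have "n \<ge> N" unfolding n_def by (rule strict_mono_imp_increasing[OF r])
  \<comment> \<open>The coefficient of the conjugated translation between \<open>c n\<close> and
    \<open>d n\<close> is the series of the \<open>s m\<close>, one term for each translated point;
    \<open>s N\<close> is the main term because \<open>n = r N\<close>.\<close>
  define s where "s m = cinner (c n) (U (a (r m))) * cinner (U (b (r m))) (d n)" for m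
  define t where "t = cinner (U (T (V (c n)))) (d n)"
  have "(\<lambda>m. cinner (U (cinner (V (c n)) (a (r m)) *\<^sub>C b (r m))) (d n)) sums t"
    unfolding t_def T_def
    by (intro bounded_linear.sums[OF bounded_linear_compose[OF bounded_linear_cinner_left
            blinfun.bounded_linear_right[of U]]] pisom_sums[OF oar obr])
  then have s: "s sums t"
    unfolding s_def
    by (simp add: clinear_op_scaleC[OF clU] cinner_scaleC_left adjoint_pairD[OF adjoint_pair_sym[OF adj]])
  have nd: "norm (d n) = 1" by (simp add: d_def norm_ell2_single w')
  have nUb: "norm (U (b m)) = 1" for m
    using norm_U_single[of "x' m" "v' m"] x'(2) v'(2) by (auto simp: b_def)
  have sm: "cmod (s m) \<le> \<delta>\<^sup>2 / 4 * (1/2) ^ m" if "m \<noteq> N" for m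
  proof -
    have "cmod (cinner (U (b (r m))) (d n)) \<le> 1"
      using cinner_Cauchy_Schwarz[of "U (b (r m))" "d n"] by (simp add: nd nUb)
    then have "cmod (s m) \<le> \<alpha> n (r m) * 1"
      unfolding s_def \<alpha>_def norm_mult by (intro mult_left_mono) auto
    also have "\<dots> \<le> \<delta>\<^sup>2 / 4 * (1/2) ^ m" using small[of N m] that by (simp add: n_def)
    finally show ?thesis .
  qed
  define s' where "s' m = (if m = N then 0 else s m)" for m
  have "(\<lambda>m. s m - (if m = N then s m else 0)) sums (t - s N)"
    using sums_diff[OF s sums_If_finite_set[of "{N}" s]] by simp
  also have "(\<lambda>m. s m - (if m = N then s m else 0)) = s'" by (auto simp: s'_def)
  finally have s': "s' sums (t - s N)" .
  have geo: "(\<lambda>m. \<delta>\<^sup>2 / 4 * (1/2) ^ m) sums (\<delta>\<^sup>2 / 4 * 2)"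
    using sums_mult[OF geometric_sums[of "1/2 :: real"], of "\<delta>\<^sup>2 / 4"] by simp
  have "cmod (t - s N) \<le> \<delta>\<^sup>2 / 4 * 2"
    unfolding sums_unique[OF s'] sums_unique[OF geo]
    by (rule norm_suminf_le) (use sm sums_summable[OF geo] in \<open>auto simp: s'_def\<close>)
  moreover have "cmod (s N) \<ge> \<delta>\<^sup>2"
  proof -
    have "cmod (cinner (c n) (U (a n))) \<ge> \<delta>"
      using xy[of n] cinner_commute[of "c n" "U (a n)"] by (simp add: a_def c_def)
    moreover have "cmod (cinner (U (b n)) (d n)) \<ge> \<delta>" using xy'[of n] by (simp add: b_def d_def)
    ultimately show ?thesis
      using mult_mono[of \<delta> "cmod (cinner (c n) (U (a n)))" \<delta>] \<open>\<delta> > 0\<close>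
      by (simp add: s_def norm_mult power2_eq_square n_def)
  qed
  moreover have "cmod t < \<delta>\<^sup>2 / 4"
    using S[OF N[OF \<open>n \<ge> N\<close>] w w'] by (simp add: t_def c_def d_def)
  moreover have "cmod (s N) \<le> cmod t + cmod (t - s N)"
    using norm_triangle_ineq4[of t "t - s N"] by simp
  ultimately show False using \<open>\<delta>\<^sup>2 / 4 > 0\<close> by simp
qed

section \<open>Localising the vectors \<open>U(x \<otimes> e)\<close>\<close>

abbreviation proj :: "('a, 'h) ell2 \<Rightarrow>\<^sub>L ('a, 'h) ell2" where
  "proj \<equiv> chi X o\<^sub>L ell2_map (rank1 e e)"

lemma proj_single: "x \<in> X \<Longrightarrow> proj (ell2_single x e) = ell2_single x e"
proof -
  have ee: "cinner e e = 1" by (simp add: cinner_self e)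
  show "x \<in> X \<Longrightarrow> ?thesis"
    by (rule ell2_eqI) (simp add: chi_apply ell2_map_apply single_apply rank1_apply ee)
qed

text \<open>All the vectors \<open>U(x \<otimes> e)\<close> are fixed by the conjugate of
  \<open>proj\<close>, an element of the algebra of \<open>Y\<close>. Approximating this single
  operator replaces them, uniformly in \<open>x\<close>, by vectors whose values come from the
  entries of \<open>S\<close>.\<close>

lemma proj_approx:
  assumes "\<delta> > 0"
  obtains S where "S \<in> pre_alg E Y"
    "\<And>x. x \<in> X \<Longrightarrow> norm (U (ell2_single x e) - S (U (ell2_single x e))) < \<delta>"
proof -
  have "U o\<^sub>L proj o\<^sub>L V \<in> alg E Y" by (intro U_alg diagonal_projection_alg)
  then obtain S where S: "S \<in> pre_alg E Y" "norm ((U o\<^sub>L proj o\<^sub>L V) - S) < \<delta>"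
    using alg_approx[OF _ assms] by metis
  have "norm (U (ell2_single x e) - S (U (ell2_single x e))) < \<delta>" if x: "x \<in> X" for x
  proof -
    let ?u = "U (ell2_single x e)"
    have "(U o\<^sub>L proj o\<^sub>L V) ?u = ?u"
      using x proj_single[OF x] by (simp add: VU chi_single)
    then have "norm (?u - S ?u) \<le> norm ((U o\<^sub>L proj o\<^sub>L V) - S) * norm ?u"
      using norm_op_diff_le[OF order_refl, where T = "U o\<^sub>L proj o\<^sub>L V" and S = S and v = ?u] by simp
    then show ?thesis using S(2) by (simp add: norm_U_single[OF x] e)
  qed
  with S(1) show ?thesis by (rule that)
qed

text \<open>Finite propagation and bounded geometry leave only finitely many nonzero entries in a
  row.\<close>

lemma pre_alg_row:
  assumes S: "S \<in> pre_alg E Y" and y: "y \<in> Y"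
  obtains F where "finite F" "\<And>f. ell2_fun (S f) y = (\<Sum>z\<in>F. matrix_entry S y z (ell2_fun f z))"
proof -
  obtain R where R: "\<And>x y. matrix_entry S x y \<noteq> 0 \<Longrightarrow> dist x y \<le> R" and S': "S \<in> op_on (ell2_on Y)"
    using S by (auto simp: pre_alg_def finite_propagation_iff)
  obtain N where "\<And>x. x \<in> Y \<Longrightarrow> finite (Y \<inter> cball x R)" "\<And>x. x \<in> Y \<Longrightarrow> card (Y \<inter> cball x R) \<le> N"
    using bounded_geometryD[OF bgY, where R = R] by metis
  then have fin: "finite (Y \<inter> cball y R)" using y by blast
  have "matrix_entry S y z = 0" if "z \<notin> Y \<inter> cball y R" for z
    using that R[of y z] op_on_ell2_on_entry_0[OF S', of y z] by auto
  then show ?thesis using matrix_row[OF S' fin, of y] that[OF fin] by blast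
qed

text \<open>The large value of \<open>U(x \<otimes> e)\<close> may point anywhere in the coefficient
  space as \<open>x\<close> varies. The corresponding value of \<open>S(U(x \<otimes> e))\<close> is
  close to it and is a sum of vectors in the ranges of entries of \<open>S\<close>, hence lies in
  one admissible subspace; its direction is the vector sought.\<close>

lemma localise:
  assumes d: "\<delta> > 0" and near: "\<And>x. x \<in> X \<Longrightarrow> \<exists>y\<in>Y. \<delta> \<le> norm (ell2_fun (U (ell2_single x e)) y)"
  obtains V0 where "admissible E V0" "e \<in> V0"
    "\<And>x. x \<in> X \<Longrightarrow> \<exists>y\<in>Y. \<exists>v\<in>V0. norm v = 1 \<and>
      \<delta> / 2 \<le> cmod (cinner (U (ell2_single x e)) (ell2_single y v))"
proof -
  \<comment> \<open>The error \<open>\<delta> / 4\<close> is paid twice, in the length of the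
    replaced value and in its coefficient against the original one; \<open>\<delta> / 2\<close>
    remains.\<close>
  have "\<delta> / 4 > 0" using d by simp
  then obtain S where S: "S \<in> pre_alg E Y"
    "\<And>x. x \<in> X \<Longrightarrow> norm (U (ell2_single x e) - S (U (ell2_single x e))) < \<delta> / 4"
    using proj_approx by metis
  obtain M where M: "M \<in> E" "\<And>x y. matrix_entry S x y \<in> M" using S(1) by (auto simp: pre_alg_def)
  obtain V0 where V0: "admissible E V0" "{e} \<subseteq> V0" "\<forall>T\<in>M. range (blinfun_apply T) \<subseteq> V0"
    using enlarge[OF M(1), of "{e}"] by auto
  have sub: "complex_vector.subspace V0" using V0(1) by (simp add: admissible_def)
  have "\<exists>y\<in>Y. \<exists>v\<in>V0. norm v = 1 \<and> \<delta> / 2 \<le> cmod (cinner (U (ell2_single x e)) (ell2_single y v))"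
    if x: "x \<in> X" for x
  proof -
    let ?u = "U (ell2_single x e)"
    obtain y where y: "y \<in> Y" "\<delta> \<le> norm (ell2_fun ?u y)" using near[OF x] by blast
    let ?v = "ell2_fun (S ?u) y"
    obtain F where F: "finite F" "\<And>f. ell2_fun (S f) y = (\<Sum>z\<in>F. matrix_entry S y z (ell2_fun f z))"
      using pre_alg_row[OF S(1) y(1)] by metis
    have v: "?v \<in> V0"
      unfolding F(2) using M(2) V0(3) by (intro complex_vector.subspace_sum[OF sub]) blast
    have close: "norm (ell2_fun ?u y - ?v) \<le> \<delta> / 4"
      using norm_ell2_fun_le[of "?u - S ?u" y] S(2)[OF x] by (simp add: minus_ell2.rep_eq)
    have nv: "norm ?v \<ge> 3 * \<delta> / 4"
      using norm_triangle_ineq2[of "ell2_fun ?u y" ?v] close y(2) by simp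
    then have "norm ?v > 0" using d by linarith
    let ?w = "complex_of_real (1 / norm ?v) *\<^sub>C ?v"
    have nw: "norm ?w = 1" using \<open>norm ?v > 0\<close> by (simp add: norm_scaleC norm_divide)
    have "cinner ?v ?w = complex_of_real (norm ?v)"
      using \<open>norm ?v > 0\<close> by (simp add: cinner_scaleC_right cinner_self power2_eq_square)
    then have "complex_of_real (norm ?v) = cinner (ell2_fun ?u y) ?w - cinner (ell2_fun ?u y - ?v) ?w"
      by (simp add: cinner_diff_left)
    then have "norm ?v \<le> cmod (cinner (ell2_fun ?u y) ?w) + cmod (cinner (ell2_fun ?u y - ?v) ?w)"
      using norm_triangle_ineq4[of "cinner (ell2_fun ?u y) ?w" "cinner (ell2_fun ?u y - ?v) ?w"]
        norm_of_real[of "norm ?v", where 'a = complex] by simp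
    moreover have "cmod (cinner (ell2_fun ?u y - ?v) ?w) \<le> \<delta> / 4"
      using cinner_Cauchy_Schwarz[of "ell2_fun ?u y - ?v" ?w] close nw by simp
    ultimately have "\<delta> / 2 \<le> cmod (cinner ?u (ell2_single y ?w))"
      using nv by (simp add: cinner_single_right)
    moreover have "?w \<in> V0" using v sub by (rule complex_vector.subspace_scale[rotated])
    ultimately show ?thesis using y(1) nw by blast
  qed
  with V0 show ?thesis using that by blast
qed

end

text \<open>Addition is continuous, so it takes a product of compact sets to a compact set. This
  serves for the finite rows of compact entries.\<close>

lemma compact_finite_sums:
  fixes C :: "'i \<Rightarrow> 'v::real_normed_vector set"
  assumes "finite F" "\<And>i. i \<in> F \<Longrightarrow> compact (C i)"
  shows "\<exists>D. compact D \<and> (\<forall>f. (\<forall>i\<in>F. f i \<in> C i) \<longrightarrow> sum f F \<in> D)"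
  using assms
proof (induction F rule: finite_induct)
  case empty
  show ?case by (intro exI[of _ "{0}"]) simp
next
  case (insert i F)
  then obtain D where D: "compact D" "\<And>f. (\<forall>i\<in>F. f i \<in> C i) \<Longrightarrow> sum f F \<in> D" by auto
  let ?D = "(\<lambda>z. fst z + snd z) ` (C i \<times> D)"
  have "compact ?D"
    using insert.prems D by (intro compact_continuous_image continuous_intros compact_Times) auto
  moreover have "sum f (insert i F) \<in> ?D" if "\<forall>j\<in>insert i F. f j \<in> C j" for f
    using that D(2)[of f] insert.hyps by (intro image_eqI[of _ _ "(f i, sum f F)"]) auto
  ultimately show ?case by blast
qed

context alg_unitary
begin

text \<open>Infinitely many such points would give orthonormal vectors with values at
  \<open>y\<close> bounded away from 0. After application of \<open>S\<close> these values stay in a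
  compact set, as a row of \<open>S\<close> is a finite family of compact operators, and a
  subsequence converges to some nonzero \<open>l\<close>. But pairing with \<open>l\<close> is a
  bounded functional of the orthonormal vectors, hence tends to 0.\<close>

lemma finite_preimages:
  assumes d: "\<delta> > 0"
  shows "finite {x \<in> X. \<delta> \<le> norm (ell2_fun (U (ell2_single x e)) y)}"
proof (rule ccontr)
  assume "infinite {x \<in> X. \<delta> \<le> norm (ell2_fun (U (ell2_single x e)) y)}"
  then obtain x :: "nat \<Rightarrow> 'a" where x: "inj x"
    "range x \<subseteq> {x \<in> X. \<delta> \<le> norm (ell2_fun (U (ell2_single x e)) y)}"
    using infinite_countable_subset by blast
  then have xX: "x n \<in> X" and xd: "\<delta> \<le> norm (ell2_fun (U (ell2_single (x n) e)) y)" for n by auto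
  have yY: "y \<in> Y" using U_in[OF xX[of 0], of y e] xd[of 0] d by force
  define u where "u n = U (ell2_single (x n) e)" for n
  have ou: "onseq u"
    unfolding u_def using xX by (intro onseq_U onseq_single x e) (simp add: chi_single)
  have nu: "norm (u n) = 1" for n unfolding u_def using norm_U_single[OF xX] e by simp
  have "\<delta> / 2 > 0" using d by simp
  then obtain S where S: "S \<in> pre_alg E Y"
    "\<And>x. x \<in> X \<Longrightarrow> norm (U (ell2_single x e) - S (U (ell2_single x e))) < \<delta> / 2"
    using proj_approx by metis
  obtain M where M: "M \<in> E" "\<And>x y. matrix_entry S x y \<in> M" using S(1) by (auto simp: pre_alg_def)
  have clS: "clinear_op S" using S(1) by (auto simp: pre_alg_def intro: op_on_ell2_on_clinear)
  obtain F where F: "finite F" "\<And>f. ell2_fun (S f) y = (\<Sum>z\<in>F. matrix_entry S y z (ell2_fun f z))"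
    using pre_alg_row[OF S(1) yY] by metis
  have "\<exists>C. compact C \<and> matrix_entry S y z ` cball 0 1 \<subseteq> C" for z
    using M compact compact_operators_iff by blast
  then obtain C where C: "\<And>z. compact (C z)" "\<And>z. matrix_entry S y z ` cball 0 1 \<subseteq> C z" by metis
  obtain D where D: "compact D" "\<And>f. (\<forall>z\<in>F. f z \<in> C z) \<Longrightarrow> sum f F \<in> D"
    using compact_finite_sums[OF F(1), of C] C(1) by blast
  have uD: "ell2_fun (S (u n)) y \<in> D" for n
    unfolding F(2)
  proof (intro D(2) ballI)
    fix z show "matrix_entry S y z (ell2_fun (u n) z) \<in> C z"
      using C(2)[of z] norm_ell2_fun_le[of "u n" z] nu[of n] by auto
  qed
  define g where "g n = ell2_fun (S (u n)) y" for n
  have "\<forall>n. g n \<in> D" using uD by (simp add: g_def)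
  then obtain l r where "strict_mono r" "(g \<circ> r) \<longlonglongrightarrow> l"
    using D(1)[THEN compact_imp_seq_compact] unfolding seq_compact_def by blast
  then have l: "strict_mono r" "(\<lambda>n. ell2_fun (S (u (r n))) y) \<longlonglongrightarrow> l"
    by (simp_all add: g_def comp_def)
  have lim: "(\<lambda>n. cinner (ell2_fun (S (u (r n))) y) l) \<longlonglongrightarrow> cinner l l"
    by (rule bounded_linear.tendsto[OF bounded_linear_cinner_left l(2)])
  have "(\<lambda>n. (cinner_functional l o\<^sub>L ell2_eval y o\<^sub>L S) (u (r n))) \<longlonglongrightarrow> 0"
    using strict_mono_imp_inj_on[OF l(1)]
    by (intro functional_onseq_tendsto_0 onseq_subseq[OF ou] clinear_op_compose
        cinner_functional_clinear ell2_eval_clinear clS)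
  then have "(\<lambda>n. cinner (ell2_fun (S (u (r n))) y) l) \<longlonglongrightarrow> 0"
    by (simp add: cinner_functional.rep_eq ell2_eval_apply)
  with lim have "cinner l l = 0" by (rule LIMSEQ_unique)
  moreover have "\<delta> / 2 \<le> norm l"
  proof (rule LIMSEQ_le_const[OF tendsto_norm[OF l(2)]], intro exI allI impI)
    fix n
    have "norm (ell2_fun (u (r n)) y - ell2_fun (S (u (r n))) y) \<le> \<delta> / 2"
      using norm_ell2_fun_le[of "u (r n) - S (u (r n))" y] S(2)[OF xX[of "r n"]]
      by (simp add: minus_ell2.rep_eq u_def)
    then show "\<delta> / 2 \<le> norm (ell2_fun (S (u (r n))) y)"
      using xd[of "r n"] norm_triangle_ineq2[of "ell2_fun (u (r n)) y" "ell2_fun (S (u (r n))) y"]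
      by (simp add: u_def)
  qed
  ultimately show False using d by simp
qed

end


section \<open>Ghost projections\<close>

definition ghost_free :: "'h::chilbert_space itself \<Rightarrow> 'a::metric_space set \<Rightarrow> bool" where
  "ghost_free H\<^sub>0 Y \<longleftrightarrow> (\<forall>Y'\<subseteq>Y. sparse_space Y' \<longrightarrow>
      \<not> (\<exists>P\<in>roe_algebra H\<^sub>0 Y'. block_rank_one_ghost_projection Y' P))"

lemma normalise_approx:
  assumes u: "norm (u::'h::chilbert_space) = 1" and c: "norm (u - c) \<le> \<epsilon>" and \<epsilon>: "\<epsilon> \<le> 1/2"
  defines "z \<equiv> (1 / norm c) *\<^sub>R c"
  shows "norm c \<ge> 1/2" "norm z = 1" "norm (z - u) \<le> 2 * \<epsilon>"
proof -
  have *: "\<bar>1 - norm c\<bar> \<le> \<epsilon>" using norm_triangle_ineq3[of u c] u c by simp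
  then show c2: "norm c \<ge> 1/2" using \<epsilon> by linarith
  then have c0: "norm c > 0" by linarith
  then show "norm z = 1" by (simp add: z_def)
  have "z - c = (1 / norm c - 1) *\<^sub>R c" by (simp add: z_def algebra_simps)
  then have "norm (z - c) = \<bar>1 / norm c - 1\<bar> * norm c" by simp
  also have "\<dots> = \<bar>(1 / norm c - 1) * norm c\<bar>" by (simp add: abs_mult)
  also have "(1 / norm c - 1) * norm c = 1 - norm c" using c0 by (simp add: field_simps)
  finally have "norm (z - c) \<le> \<epsilon>" using * by simp
  moreover have "norm (z - u) \<le> norm (z - c) + norm (c - u)"
    using norm_triangle_ineq[of "z - c" "c - u"] by simp
  ultimately show "norm (z - u) \<le> 2 * \<epsilon>" using c by (simp add: norm_minus_commute)
qed

text \<open>Neither projection is a norm convergent sum of its rank-one pieces, but the difference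
  is: corresponding pieces differ in norm by at most \<open>2 * c * (1/2) ^ n\<close>, and each
  piece lies in the algebra.\<close>

lemma pisom_diff_alg:
  assumes E: "entry_class E"
    and on: "onseq \<zeta>" "onseq \<eta>" and \<zeta>: "\<And>n. \<zeta> n \<in> ell2_on Y" and \<eta>: "\<And>n. \<eta> n \<in> ell2_on Y"
    and close: "\<And>n. norm (\<zeta> n - \<eta> n) \<le> c * (1/2) ^ n"
  shows "pisom \<zeta> \<zeta> - pisom \<eta> \<eta> \<in> alg E Y"
proof -
  interpret entry_class E by fact
  define D where "D n = rank1 (\<zeta> n) (\<zeta> n) - rank1 (\<eta> n) (\<eta> n)" for n
  have D: "D n \<in> alg E Y" for n
    unfolding D_def by (intro real_vector.subspace_diff[OF subspace_alg] rank1_alg \<zeta> \<eta>)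
  have nD: "norm (D n) \<le> 2 * c * (1/2) ^ n" for n
  proof -
    have "norm (D n) \<le> norm (rank1 (\<zeta> n - \<eta> n) (\<zeta> n)) + norm (rank1 (\<eta> n) (\<zeta> n - \<eta> n))"
      unfolding D_def rank1_diff by (rule norm_triangle_ineq)
    also have "\<dots> \<le> norm (\<zeta> n - \<eta> n) * norm (\<zeta> n) + norm (\<eta> n) * norm (\<zeta> n - \<eta> n)"
      by (intro add_mono norm_rank1_le)
    also have "\<dots> \<le> 2 * c * (1/2) ^ n"
      using close[of n] by (simp add: onseq_norm on)
    finally show ?thesis .
  qed
  have "summable D"
    by (rule summable_comparison_test'[OF summable_mult[OF summable_geometric[of "1/2 :: real"]], of 0 _ "2 * c"])
      (use nD in auto)
  then have sD: "D sums (suminf D)" by (rule summable_sums)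
  have "(\<Sum>n<N. D n) \<in> alg E Y" for N
    by (intro real_vector.subspace_sum[OF subspace_alg] D)
  moreover have "closed (alg E Y)" by (simp add: alg_def)
  ultimately have "suminf D \<in> alg E Y"
    using sD unfolding sums_def by (metis closed_sequentially)
  moreover have "suminf D = pisom \<zeta> \<zeta> - pisom \<eta> \<eta>"
  proof (rule blinfun_eqI)
    fix v
    have "(\<lambda>n. D n v) sums (suminf D) v"
      using bounded_linear.sums[OF blinfun.bounded_linear_left[of v] sD] .
    moreover have "(\<lambda>n. D n v) sums (pisom \<zeta> \<zeta> v - pisom \<eta> \<eta> v)"
      using sums_diff[OF pisom_sums[OF on(1) on(1), of v] pisom_sums[OF on(2) on(2), of v]]
      by (simp add: D_def minus_blinfun.rep_eq rank1_apply)
    ultimately show "(suminf D) v = (pisom \<zeta> \<zeta> - pisom \<eta> \<eta>) v"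
      using sums_unique2 by (fastforce simp: minus_blinfun.rep_eq)
  qed
  ultimately show ?thesis by simp
qed

text \<open>Disjoint supports make the \<open>\<zeta> n\<close> orthonormal, and at a point of
  \<open>D n\<close> only the \<open>n\<close>-th term of the series for
  \<open>pisom \<zeta> \<zeta>\<close> is nonzero.\<close>

lemma pisom_block_rank_one:
  assumes D: "sparse_decomposition Y D" and \<zeta>: "\<And>n. \<zeta> n \<in> ell2_on (D n)" "\<And>n. norm (\<zeta> n) = 1"
  shows "onseq \<zeta>" "block_rank_one_projection Y D \<zeta> (pisom \<zeta> \<zeta>)"
proof -
  have disj: "D m \<inter> D n = {}" if "m \<noteq> n" for m n
    using D that by (auto simp: sparse_decomposition_def disjoint_family_on_def)
  have sub: "D n \<subseteq> Y" for n using D by (auto simp: sparse_decomposition_def)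
  have zero: "ell2_fun (\<zeta> m) x = 0" if "x \<in> D n" "m \<noteq> n" for m n x
    using \<zeta>(1)[of m] disj[OF that(2)] that(1) by (auto simp: ell2_on_def)
  show on: "onseq \<zeta>"
    unfolding onseq_def
  proof (intro allI)
    fix m n
    have "cinner (ell2_fun (\<zeta> m) x) (ell2_fun (\<zeta> n) x) = 0" if "m \<noteq> n" for x
      using zero[of x n m] that \<zeta>(1)[of n] by (cases "x \<in> D n") (auto simp: ell2_on_def)
    then show "cinner (\<zeta> m) (\<zeta> n) = (if m = n then 1 else 0)"
      by (auto simp: cinner_self \<zeta>(2)) (simp add: cinner_ell2_def)
  qed
  have "pisom \<zeta> \<zeta> = chi Y o\<^sub>L pisom \<zeta> \<zeta> o\<^sub>L chi Y"
  proof (rule pisom_eqI[OF on on])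
    have c: "chi Y (\<zeta> n) = \<zeta> n" for n
      unfolding chi_fixed_iff using \<zeta>(1)[of n] sub[of n] by (auto simp: ell2_on_def)
    show "(chi Y o\<^sub>L pisom \<zeta> \<zeta> o\<^sub>L chi Y) (\<zeta> n) = \<zeta> n" for n
      by (simp add: c pisom_seq[OF on on])
    show "(chi Y o\<^sub>L pisom \<zeta> \<zeta> o\<^sub>L chi Y) v = 0" if "\<And>n. cinner v (\<zeta> n) = 0" for v
      using that pisom_orthogonal[OF on on, of "chi Y v"]
      by (simp add: adjoint_pairD[OF chi_self_adjoint] c)
  qed (intro clinear_op_compose chi_clinear pisom_clinear on)
  then have "pisom \<zeta> \<zeta> \<in> op_on (ell2_on Y)"
    by (intro op_on_ell2_on_entryI pisom_clinear on) (metis matrix_entry_chi)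
  moreover have "ell2_fun (pisom \<zeta> \<zeta> v) x = cinner v (\<zeta> n) *\<^sub>C ell2_fun (\<zeta> n) x"
    if x: "x \<in> D n" for v n x
  proof -
    have "(\<lambda>m. cinner v (\<zeta> m) *\<^sub>C ell2_fun (\<zeta> m) x) sums ell2_fun (pisom \<zeta> \<zeta> v) x"
      using bounded_linear.sums[OF bounded_linear_ell2_fun pisom_sums[OF on on, of v], of x]
      by (simp add: scaleC_ell2.rep_eq)
    also have "(\<lambda>m. cinner v (\<zeta> m) *\<^sub>C ell2_fun (\<zeta> m) x)
      = (\<lambda>m. if m \<in> {n} then cinner v (\<zeta> n) *\<^sub>C ell2_fun (\<zeta> n) x else 0)"
      using zero[OF x] by auto
    finally show ?thesis
      using sums_If_finite_set[of "{n}" "\<lambda>_. cinner v (\<zeta> n) *\<^sub>C ell2_fun (\<zeta> n) x"] sums_unique2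
      by fastforce
  qed
  ultimately show "block_rank_one_projection Y D \<zeta> (pisom \<zeta> \<zeta>)"
    using D \<zeta> by (simp add: block_rank_one_projection_def)
qed

context alg_unitary
begin

lemma U_pisom_V:
  assumes a: "onseq a" "\<And>n. chi X (a n) = a n"
  shows "U o\<^sub>L pisom a a o\<^sub>L V = pisom (\<lambda>n. U (a n)) (\<lambda>n. U (a n))"
proof (rule sym, rule pisom_eqI[OF onseq_U[OF a] onseq_U[OF a]])
  show "clinear_op (U o\<^sub>L pisom a a o\<^sub>L V)" by (intro clinear_op_compose clU clV pisom_clinear a)
  show "(U o\<^sub>L pisom a a o\<^sub>L V) (U (a n)) = U (a n)" for n
    by (simp add: VU a(2) pisom_seq[OF a(1) a(1)])
  show "(U o\<^sub>L pisom a a o\<^sub>L V) v = 0" if "\<And>n. cinner v (U (a n)) = 0" for v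
    using pisom_orthogonal[OF a(1) a(1), of "V v"] that
    by (simp add: adjoint_pairD[OF adjoint_pair_sym[OF adj]])
qed

text \<open>Otherwise there are points \<open>x k\<close> with \<open>U(x k \<otimes> e)\<close> more and more spread out.  A subsequence of
  these vectors is, up to a summable error, supported on finite sets \<open>D n\<close> drifting apart, and their
  normalised restrictions to the \<open>D n\<close> define a ghost projection.\<close>

lemma not_spread_out:
  assumes gf: "ghost_free TYPE('h) Y"
  obtains \<delta> where "\<delta> > 0" "\<And>x. x \<in> X \<Longrightarrow> \<exists>y\<in>Y. \<delta> \<le> norm (ell2_fun (U (ell2_single x e)) y)"
proof (rule ccontr)
  assume not: "\<not> thesis"
  have "\<exists>x\<in>X. \<forall>y\<in>Y. norm (ell2_fun (U (ell2_single x e)) y) < 1 / real (Suc n)" for n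
  proof (rule ccontr)
    assume "\<not> ?thesis"
    then have "\<exists>y\<in>Y. 1 / real (Suc n) \<le> norm (ell2_fun (U (ell2_single x e)) y)" if "x \<in> X" for x
      using that by (meson not_le)
    then show False using not that[of "1 / real (Suc n)"] by simp
  qed
  then obtain x0 where x0: "\<And>n. x0 n \<in> X"
    "\<And>n y. y \<in> Y \<Longrightarrow> norm (ell2_fun (U (ell2_single (x0 n) e)) y) < 1 / real (Suc n)" by metis
  have x0': "norm (ell2_fun (U (ell2_single (x0 n) e)) y) < 1 / real (Suc n)" for n y
    using x0(2)[of y n] U_in[OF x0(1)[of n], of y e] by (cases "y \<in> Y") auto
  \<comment> \<open>The nonzero vector \<open>U(c \<otimes> e)\<close> has a nonzero value
    somewhere, which the bound \<open>1 / real (Suc n)\<close> excludes for large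
    \<open>n\<close>.\<close>
  have fin: "finite {n. x0 n = c}" for c
  proof (cases "c \<in> X")
    case True
    have "U (ell2_single c e) \<noteq> 0" using norm_U_single[OF True, of e] e by auto
    then obtain y where y: "ell2_fun (U (ell2_single c e)) y \<noteq> 0"
      by (metis ell2_eqI zero_ell2.rep_eq)
    obtain N :: nat where N: "1 / norm (ell2_fun (U (ell2_single c e)) y) < real N"
      using reals_Archimedean2 by blast
    have "n < N" if "x0 n = c" for n
    proof -
      have "real (Suc n) < 1 / norm (ell2_fun (U (ell2_single c e)) y)"
        using x0'[of n y] that y by (simp add: field_simps)
      then show ?thesis using N by linarith
    qed
    then have "{n. x0 n = c} \<subseteq> {..<N}" by auto
    then show ?thesis by (rule finite_subset) simp
  next
    case False
    then have "{n. x0 n = c} = {}" using x0(1) by auto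
    then show ?thesis by simp
  qed
  obtain r :: "nat \<Rightarrow> nat" where r: "strict_mono r" "inj (\<lambda>n. x0 (r n))"
    using injective_subsequence[of x0, OF fin] by blast
  define x where "x n = x0 (r n)" for n
  have xX: "x n \<in> X" for n by (simp add: x_def x0)
  have ix: "inj x" using r(2) by (simp add: x_def[abs_def])
  define \<xi> where "\<xi> n = U (ell2_single (x n) e)" for n
  have \<xi>small: "norm (ell2_fun (\<xi> n) y) < 1 / real (Suc n)" for n y
  proof -
    have "norm (ell2_fun (\<xi> n) y) < 1 / real (Suc (r n))" unfolding \<xi>_def x_def by (rule x0')
    also have "\<dots> \<le> 1 / real (Suc n)"
      using strict_mono_imp_increasing[OF r(1), of n] by (intro divide_left_mono) auto
    finally show ?thesis .
  qed
  have n\<xi>: "norm (\<xi> n) = 1" for n unfolding \<xi>_def using norm_U_single[OF xX] e by simp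
  have \<xi>Y: "ell2_fun (\<xi> n) y = 0" if "y \<notin> Y" for n y unfolding \<xi>_def by (rule U_in[OF xX that])
  \<comment> \<open>Normalising doubles the error, so that \<open>\<zeta> n\<close> and
    \<open>\<eta> n\<close> will differ by at most \<open>1/4 * (1/2) ^ n\<close>, which is
    summable; an error of at most 1/2 keeps the truncated vectors away from 0.\<close>
  define \<epsilon> :: "nat \<Rightarrow> real" where "\<epsilon> n = (1/2) ^ n / 8" for n
  have \<epsilon>pos: "\<epsilon> n > 0" for n by (simp add: \<epsilon>_def)
  have \<epsilon>le: "\<epsilon> n \<le> 1/2" for n
    using power_le_one[of "1/2 :: real" n] unfolding \<epsilon>_def by simp
  \<comment> \<open>The points of \<open>Y\<close> within \<open>n\<close> of \<open>G\<close> form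
    a finite set \<open>F\<close>. On it \<open>\<xi> k\<close> has norm at most
    \<open>card F / (k + 1)\<close>, so for large \<open>k\<close> this part can be cut off together
    with the tail outside a finite set.\<close>
  have step: "\<exists>k>m. \<exists>D. finite D \<and> D \<subseteq> Y \<and> norm (\<xi> k - chi D (\<xi> k)) \<le> \<epsilon> n \<and>
      (\<forall>g\<in>G. \<forall>d\<in>D. real n \<le> dist g d)" if G: "finite G" "G \<subseteq> Y" for n m G
  proof -
    define F where "F = (\<Union>g\<in>G. Y \<inter> cball g (real n))"
    obtain N where "\<And>x. x \<in> Y \<Longrightarrow> finite (Y \<inter> cball x (real n))"
      "\<And>x. x \<in> Y \<Longrightarrow> card (Y \<inter> cball x (real n)) \<le> N"
      using bounded_geometryD[OF bgY, where R = "real n"] by metis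
    then have F: "finite F" unfolding F_def using G by blast
    obtain k0 :: nat where k0: "real (card F) * 2 / \<epsilon> n < real k0" using reals_Archimedean2 by blast
    define k where "k = max k0 (Suc m)"
    have "real (card F) * 2 < \<epsilon> n * real (Suc k)"
    proof -
      have "real (card F) * 2 / \<epsilon> n < real (Suc k)" using k0 unfolding k_def by linarith
      then show ?thesis using \<epsilon>pos[of n] by (simp add: field_simps)
    qed
    then have small: "real (card F) * (1 / real (Suc k)) \<le> \<epsilon> n / 2" by (simp add: field_simps)
    have "\<epsilon> n / 2 > 0" using \<epsilon>pos[of n] by simp
    then obtain A where A: "finite A" "norm (\<xi> k - chi A (\<xi> k)) < \<epsilon> n / 2"
      using ell2_finite_approx[of "\<epsilon> n / 2" "\<xi> k"] by (metis order_refl)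
    define D where "D = (A \<inter> Y) - F"
    have "\<xi> k - chi D (\<xi> k) = (\<xi> k - chi A (\<xi> k)) + chi (A \<inter> F) (\<xi> k)"
      by (rule ell2_eqI) (auto simp: D_def minus_ell2.rep_eq plus_ell2.rep_eq chi_apply \<xi>Y)
    then have "norm (\<xi> k - chi D (\<xi> k)) \<le> norm (\<xi> k - chi A (\<xi> k)) + norm (chi (A \<inter> F) (\<xi> k))"
      by (metis norm_triangle_ineq)
    also have "norm (chi (A \<inter> F) (\<xi> k)) \<le> (\<Sum>y\<in>A \<inter> F. norm (ell2_fun (\<xi> k) y))"
      using F by (subst chi_finite_sum) (auto intro!: order_trans[OF norm_sum] simp: norm_ell2_single)
    also have "\<dots> \<le> (\<Sum>y\<in>A \<inter> F. 1 / real (Suc k))"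
      by (intro sum_mono less_imp_le \<xi>small)
    also have "\<dots> \<le> real (card F) * (1 / real (Suc k))"
      using F card_mono[OF F, of "A \<inter> F"] by (simp add: divide_right_mono)
    finally have "norm (\<xi> k - chi D (\<xi> k)) \<le> \<epsilon> n" using A(2) small by linarith
    moreover have "real n \<le> dist g d" if "g \<in> G" "d \<in> D" for g d
    proof (rule ccontr)
      assume "\<not> real n \<le> dist g d"
      then have "d \<in> F" using that unfolding F_def D_def by auto
      then show False using that by (simp add: D_def)
    qed
    moreover have "k > m" "finite D" "D \<subseteq> Y" using A by (auto simp: k_def D_def)
    ultimately show ?thesis by blast
  qed
  \<comment> \<open>\<open>G\<close> accumulates all the blocks chosen so far, so that the next
    block is kept away from all of them and not just from its predecessor \<open>D\<close>.\<close>
  define P where "P n s = (case s of (k :: nat, D, G) \<Rightarrow> finite D \<and> finite G \<and> D \<subseteq> G \<and> G \<subseteq> Y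
      \<and> norm (\<xi> k - chi D (\<xi> k)) \<le> \<epsilon> n)" for n s
  define Q where "Q n s s' = (case (s, s') of ((k :: nat, D :: 'b set, G :: 'b set), (k', D', G')) \<Rightarrow>
      k < k' \<and> G \<subseteq> G' \<and> (\<forall>g\<in>G. \<forall>d\<in>D'. real (Suc n) \<le> dist g d))" for n s s'
  have P0: "\<exists>s. P 0 s"
  proof -
    obtain k D where "finite D" "D \<subseteq> Y" "norm (\<xi> k - chi D (\<xi> k)) \<le> \<epsilon> 0"
      using step[of "{}" 0 0] by auto
    then show ?thesis by (intro exI[of _ "(k, D, D)"]) (simp add: P_def)
  qed
  have PQ: "\<exists>s'. P (Suc n) s' \<and> Q n s s'" if "P n s" for n s
  proof -
    obtain k D G where s: "s = (k, D, G)" by (cases s)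
    have G: "finite G" "G \<subseteq> Y" using that by (auto simp: P_def s)
    obtain k' D' where "k' > k" "finite D'" "D' \<subseteq> Y" "norm (\<xi> k' - chi D' (\<xi> k')) \<le> \<epsilon> (Suc n)"
      "\<forall>g\<in>G. \<forall>d\<in>D'. real (Suc n) \<le> dist g d"
      using step[OF G, of k "Suc n"] by blast
    then show ?thesis using G by (intro exI[of _ "(k', D', G \<union> D')"]) (auto simp: P_def Q_def s)
  qed
  obtain s where s: "\<And>n. P n (s n)" "\<And>n. Q n (s n) (s (Suc n))"
    using dependent_nat_choice[of P Q, OF P0 PQ] by blast
  define k where "k n = fst (s n)" for n
  define D where "D n = fst (snd (s n))" for n
  define G where "G n = snd (snd (s n))" for n
  have sn: "s n = (k n, D n, G n)" for n by (simp add: k_def D_def G_def)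
  have DG: "finite (D n)" "D n \<subseteq> G n" "G n \<subseteq> Y" "norm (\<xi> (k n) - chi (D n) (\<xi> (k n))) \<le> \<epsilon> n" for n
    using s(1)[of n] by (auto simp: P_def sn)
  have kG: "k n < k (Suc n)" "G n \<subseteq> G (Suc n)"
    "\<And>g d. g \<in> G n \<Longrightarrow> d \<in> D (Suc n) \<Longrightarrow> real (Suc n) \<le> dist g d" for n
    using s(2)[of n] by (auto simp: Q_def sn)
  have k: "strict_mono k" using kG(1) by (simp add: strict_mono_Suc_iff)
  have Gmono: "G i \<subseteq> G j" if "i \<le> j" for i j using kG(2) that by (rule lift_Suc_mono_le)
  have far1: "real j \<le> dist g d" if ij: "i < j" "g \<in> D i" "d \<in> D j" for i j g d
  proof -
    obtain j' where j': "j = Suc j'" using ij(1) by (cases j) auto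
    then have "g \<in> G j'" using DG(2)[of i] Gmono[of i j'] ij by auto
    then show ?thesis using kG(3) ij(3) j' by blast
  qed
  have far: "real (max i j) \<le> dist g d" if "i \<noteq> j" "g \<in> D i" "d \<in> D j" for i j g d
    using far1[of i j g d] far1[of j i d g] that by (cases "i < j") (auto simp: dist_commute)
  define \<eta> where "\<eta> n = \<xi> (k n)" for n
  define \<zeta> where "\<zeta> n = (1 / norm (chi (D n) (\<eta> n))) *\<^sub>R chi (D n) (\<eta> n)" for n
  have n\<eta>: "norm (\<eta> n) = 1" for n by (simp add: \<eta>_def n\<xi>)
  note na = normalise_approx[OF n\<eta> DG(4)[folded \<eta>_def] \<epsilon>le, folded \<zeta>_def]
  have \<zeta>D: "\<zeta> n \<in> ell2_on (D n)" for n
    by (simp add: \<zeta>_def ell2_on_def scaleR_ell2.rep_eq chi_apply)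
  have Dne: "D n \<noteq> {}" for n
  proof
    assume "D n = {}"
    then have "\<zeta> n = 0" using \<zeta>D[of n] by (intro ell2_eqI) (simp add: ell2_on_def zero_ell2.rep_eq)
    then show False using na(2)[of n] by simp
  qed
  define Y' where "Y' = (\<Union>n. D n)"
  have Y': "Y' \<subseteq> Y" unfolding Y'_def using DG(2,3) by blast
  have sd: "sparse_decomposition Y' D"
    unfolding sparse_decomposition_def
  proof (intro conjI allI)
    show "disjoint_family D"
      unfolding disjoint_family_on_def
    proof (intro ballI impI)
      fix i j :: nat assume "i \<noteq> j"
      have False if "d \<in> D i" "d \<in> D j" for d
        using far[OF \<open>i \<noteq> j\<close> that] \<open>i \<noteq> j\<close> by simp
      then show "D i \<inter> D j = {}" by blast
    qed
    show "(\<Union>n. D n) = Y'" by (simp add: Y'_def)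
    fix R :: real
    obtain N :: nat where N: "R < real N" using reals_Archimedean2 by blast
    \<comment> \<open>Distances between blocks are bounded below by the larger index, which is at
      least half of \<open>n + m\<close>.\<close>
    have "R \<le> setdist (D n) (D m)" if "n \<noteq> m" "2 * N \<le> n + m" for n m
    proof -
      have "N \<le> max n m" using that(2) by linarith
      then have "R \<le> real (max n m)" using N by linarith
      then show ?thesis
        using far[OF that(1)] Dne unfolding le_setdist_iff by (force intro: order_trans)
    qed
    then show "\<exists>N. \<forall>n m. n \<noteq> m \<and> N \<le> n + m \<longrightarrow> R \<le> setdist (D n) (D m)" by blast
  qed (use DG(1) Dne in auto)
  note block = pisom_block_rank_one[OF sd \<zeta>D na(2)]
  have ik: "inj (\<lambda>n. x (k n))"
    using inj_compose[OF ix strict_mono_imp_inj_on[OF k]] by (simp add: comp_def)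
  have on: "onseq (\<lambda>n. ell2_single (x (k n)) e)"
    by (rule onseq_single[OF ik e])
  have onX: "chi X (ell2_single (x (k n)) e) = ell2_single (x (k n)) e" for n
    using xX by (simp add: chi_single)
  have on\<eta>: "onseq \<eta>" unfolding \<eta>_def[abs_def] \<xi>_def using onseq_U[OF on onX] .
  \<comment> \<open>The projection onto the closed span of the \<open>x (k n) \<otimes> e\<close> is
    a partial translation that moves nothing; conjugation by \<open>U\<close> turns it into the
    projection onto the closed span of the \<open>\<eta> n\<close>, inside the algebra of
    \<open>Y\<close>.\<close>
  obtain V0 where "admissible E V0" "e \<in> V0" using obtain_admissible[of "{e}"] by auto
  then have "pisom (\<lambda>n. ell2_single (x (k n)) e) (\<lambda>n. ell2_single (x (k n)) e) \<in> alg E X"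
    using xX e by (intro partial_translation_alg[OF ik _ ik, where R = 0]) auto
  then have "pisom \<eta> \<eta> \<in> alg E Y"
    using U_alg U_pisom_V[OF on onX] unfolding \<eta>_def[abs_def] \<xi>_def by metis
  moreover have "pisom \<zeta> \<zeta> - pisom \<eta> \<eta> \<in> alg E Y"
  proof (rule pisom_diff_alg[OF _ block(1) on\<eta>, where c = "1/4"])
    show "entry_class E" by unfold_locales
    show "\<zeta> n \<in> ell2_on Y" for n using \<zeta>D[of n] DG(2,3)[of n] by (auto simp: ell2_on_def)
    show "\<eta> n \<in> ell2_on Y" for n by (simp add: ell2_on_def \<eta>_def \<xi>Y)
    show "norm (\<zeta> n - \<eta> n) \<le> 1 / 4 * (1 / 2) ^ n" for n using na(3)[of n] by (simp add: \<epsilon>_def)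
  qed
  ultimately have "pisom \<eta> \<eta> + (pisom \<zeta> \<zeta> - pisom \<eta> \<eta>) \<in> alg E Y"
    by (rule real_vector.subspace_add[OF subspace_alg])
  then have "pisom \<zeta> \<zeta> \<in> alg E Y" by simp
  then have "chi Y' o\<^sub>L pisom \<zeta> \<zeta> o\<^sub>L chi Y' \<in> alg E Y'" using Y' by (rule chi_compress_alg)
  moreover have "pisom \<zeta> \<zeta> \<in> op_on (ell2_on Y')"
    using block(2) by (simp add: block_rank_one_projection_def)
  ultimately have "pisom \<zeta> \<zeta> \<in> roe_algebra TYPE('h) Y'"
    using alg_subset_compact by (auto simp: op_on_ell2_on_iff roe_algebra_alg)
  moreover have "block_rank_one_ghost_projection Y' (pisom \<zeta> \<zeta>)"
    unfolding block_rank_one_ghost_projection_def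
  proof (intro exI conjI)
    show "block_rank_one_projection Y' D \<zeta> (pisom \<zeta> \<zeta>)" by (rule block(2))
    show "(\<lambda>n. SUP x\<in>D n. (norm (ell2_fun (\<zeta> n) x))\<^sup>2) \<longlonglongrightarrow> 0"
    proof (rule tendsto_sandwich[of "\<lambda>_. 0" _ _ "\<lambda>n. (2 * (1 / real (Suc n)))\<^sup>2"])
      \<comment> \<open>The truncated vectors have norm at least 1/2, so normalising at most doubles
        the values.\<close>
      have bound: "(norm (ell2_fun (\<zeta> n) y))\<^sup>2 \<le> (2 * (1 / real (Suc n)))\<^sup>2" for n y
      proof (rule power_mono)
        have "norm (ell2_fun (\<zeta> n) y) \<le> (1 / norm (chi (D n) (\<eta> n))) * norm (ell2_fun (\<eta> n) y)"
          by (simp add: \<zeta>_def scaleR_ell2.rep_eq chi_apply)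
        also have "\<dots> \<le> 2 * (1 / real (Suc n))"
        proof (rule mult_mono)
          have "norm (chi (D n) (\<eta> n)) > 0" using na(1)[of n] by linarith
          then show "1 / norm (chi (D n) (\<eta> n)) \<le> 2"
            using na(1)[of n] by (simp add: divide_le_eq)
          have "norm (ell2_fun (\<eta> n) y) \<le> 1 / real (Suc (k n))"
            unfolding \<eta>_def by (rule less_imp_le[OF \<xi>small])
          also have "\<dots> \<le> 1 / real (Suc n)"
            using strict_mono_imp_increasing[OF k, of n] by (intro divide_left_mono) auto
          finally show "norm (ell2_fun (\<eta> n) y) \<le> 1 / real (Suc n)" .
        qed auto
        finally show "norm (ell2_fun (\<zeta> n) y) \<le> 2 * (1 / real (Suc n))" .
      qed simp
      show "eventually (\<lambda>n. (SUP x\<in>D n. (norm (ell2_fun (\<zeta> n) x))\<^sup>2) \<le> (2 * (1 / real (Suc n)))\<^sup>2) sequentially"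
        by (intro always_eventually allI cSUP_least Dne bound)
      have "0 \<le> (SUP x\<in>D n. (norm (ell2_fun (\<zeta> n) x))\<^sup>2)" for n
      proof -
        obtain d where "d \<in> D n" using Dne by blast
        then show ?thesis
          using DG(1) by (intro cSUP_upper2[where x = d]) auto
      qed
      then show "eventually (\<lambda>n. 0 \<le> (SUP x\<in>D n. (norm (ell2_fun (\<zeta> n) x))\<^sup>2)) sequentially"
        by simp
      have "(\<lambda>n. (2 * (1 / real (Suc n)))\<^sup>2) \<longlonglongrightarrow> (2 * 0)\<^sup>2"
        by (intro tendsto_power tendsto_mult tendsto_const lim_1_over_n[THEN LIMSEQ_Suc])
      then show "(\<lambda>n. (2 * (1 / real (Suc n)))\<^sup>2) \<longlonglongrightarrow> 0" by simp
    qed simp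
  qed
  moreover have "sparse_space Y'" using sd by (auto simp: sparse_space_def)
  ultimately show False using gf Y' unfolding ghost_free_def by blast
qed

end

lemma le_setdistD: "R \<le> setdist A B \<Longrightarrow> a \<in> A \<Longrightarrow> b \<in> B \<Longrightarrow> R \<le> dist a b"
  using setdist_le_dist order_trans by blast

text \<open>A block-rank-one ghost projection on a subspace of \<open>X\<close> is transported to \<open>Y\<close>; finitely many blocks
  are dropped to make the images of the remaining ones disjoint.\<close>

lemma ghost_free_coarse_embedding:
  fixes X :: "'a::metric_space set" and Y :: "'b::metric_space set" and H\<^sub>0 :: "'h::chilbert_space itself"
    and e :: "nat \<Rightarrow> 'h"
  assumes e: "total_onseq e" and bg: "bounded_geometry X" and f: "coarse_embedding X Y f"
    and gf: "ghost_free H\<^sub>0 Y"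
  shows "ghost_free H\<^sub>0 X"
  unfolding ghost_free_def
proof (intro allI impI notI)
  fix X' assume X': "X' \<subseteq> X" and "\<exists>P\<in>roe_algebra H\<^sub>0 X'. block_rank_one_ghost_projection X' P"
  then obtain P :: "('a, 'h) ell2 \<Rightarrow>\<^sub>L ('a, 'h) ell2" and D and \<xi> :: "nat \<Rightarrow> ('a, 'h) ell2"
    where P: "P \<in> alg compact_class X'" "block_rank_one_projection X' D \<xi> P"
    and ghost: "(\<lambda>n. SUP x\<in>D n. (norm (ell2_fun (\<xi> n) x))\<^sup>2) \<longlonglongrightarrow> 0"
    unfolding roe_algebra_alg block_rank_one_ghost_projection_def by blast
  have sd: "sparse_decomposition X' D" and \<xi>: "\<And>n. \<xi> n \<in> ell2_on (D n)" "\<And>n. norm (\<xi> n) = 1"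
    and Papp: "\<And>v n x. x \<in> D n \<Longrightarrow> ell2_fun (P v) x = cinner v (\<xi> n) *\<^sub>C ell2_fun (\<xi> n) x"
    using P(2) by (auto simp: block_rank_one_projection_def)
  have D: "disjoint_family D" "(\<Union>n. D n) = X'" "\<And>n. finite (D n)" "\<And>n. D n \<noteq> {}"
    "\<And>R. \<exists>N. \<forall>n m. n \<noteq> m \<and> N \<le> n + m \<longrightarrow> R \<le> setdist (D n) (D m)"
    using sd by (auto simp: sparse_decomposition_def)
  have DX: "D n \<subseteq> X" for n using D(2) X' by blast
  have far: "\<exists>N. \<forall>n m. n \<noteq> m \<and> N \<le> n + m \<longrightarrow> (\<forall>x\<in>D n. \<forall>x'\<in>D m. R < dist (f x) (f x'))" for R
  proof -
    obtain S where S: "\<And>x x'. x \<in> X \<Longrightarrow> x' \<in> X \<Longrightarrow> dist (f x) (f x') \<le> R \<Longrightarrow> dist x x' \<le> S"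
      using coarse_embedding_control(3)[OF f, of R] by blast
    obtain N where N: "\<And>n m. n \<noteq> m \<Longrightarrow> N \<le> n + m \<Longrightarrow> S + 1 \<le> setdist (D n) (D m)"
      using D(5)[of "S + 1"] by blast
    have "R < dist (f x) (f x')" if "n \<noteq> m" "N \<le> n + m" "x \<in> D n" "x' \<in> D m" for n m x x'
    proof (rule ccontr)
      assume "\<not> R < dist (f x) (f x')"
      then have "dist x x' \<le> S" using S DX that(3,4) by (meson not_less subsetD)
      moreover have "S + 1 \<le> dist x x'" using le_setdistD[OF N[OF that(1,2)] that(3,4)] .
      ultimately show False by simp
    qed
    then show ?thesis by blast
  qed
  obtain N where N: "\<And>n m x x'. n \<noteq> m \<Longrightarrow> N \<le> n + m \<Longrightarrow> x \<in> D n \<Longrightarrow> x' \<in> D m \<Longrightarrow> 0 < dist (f x) (f x')"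
    using far[of 0] by blast
  define Z where "Z = (\<Union>n. D (n + N))"
  have ZX: "Z \<subseteq> X" "Z \<subseteq> X'" unfolding Z_def using DX D(2) by auto
  have Zne: "Z \<noteq> {}" unfolding Z_def using D(4) by blast
  define D' where "D' n = f ` D (n + N)" for n
  define Z' where "Z' = f ` Z"
  have bgZ: "bounded_geometry Z" by (rule bounded_geometry_subset[OF bg ZX(1)])
  have cs: "coarse_surjection Z Z' f" unfolding Z'_def by (rule coarse_embedding_surjection[OF f ZX(1)])
  obtain W :: "('a, 'h) ell2 \<Rightarrow>\<^sub>L ('b, 'h) ell2" and W' and S :: "'a \<Rightarrow> ('h \<Rightarrow>\<^sub>L 'h)"
    where W: "partial_unitary (chi Z) (chi Z') W W'"
    "\<And>T. T \<in> alg compact_class Z \<Longrightarrow> W o\<^sub>L T o\<^sub>L W' \<in> alg compact_class Z'"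
    "\<And>T. T \<in> alg compact_class Z' \<Longrightarrow> W' o\<^sub>L T o\<^sub>L W \<in> alg compact_class Z"
    "\<And>\<eta> z. ell2_fun (W \<eta>) z = (\<Sum>y\<in>fiber Z f z. S y (ell2_fun \<eta> y))"
    "\<And>y. y \<in> Z \<Longrightarrow> clinear_op (S y)" "\<And>y v. y \<in> Z \<Longrightarrow> norm (S y v) \<le> norm v"
    by (rule coarse_surjection_unitary[OF entry_class_compact e bgZ Zne cs]) (rule that; blast)
  have adj: "adjoint_pair W W'" using W(1) by (simp add: partial_unitary_def)
  obtain k where kf: "\<And>z. finite (fiber Z f z)" "\<And>z. card (fiber Z f z) \<le> k"
    using coarse_surjection_fibers[OF bgZ cs] by metis
  define \<zeta> where "\<zeta> n = W (\<xi> (n + N))" for n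
  \<comment> \<open>Points of different remaining blocks have different images, so a fibre never
    mixes blocks and \<open>P\<close> acts on a whole fibre by a single coefficient.\<close>
  have fib: "fiber Z f z \<subseteq> D (n + N)" if z: "z \<in> D' n" for z n
  proof
    fix y assume "y \<in> fiber Z f z"
    then obtain m where m: "y \<in> D (m + N)" "f y = z" by (auto simp: fiber_def Z_def)
    obtain y' where y': "y' \<in> D (n + N)" "z = f y'" using z by (auto simp: D'_def)
    have "m = n" using N[OF _ _ m(1) y'(1)] m(2) y'(2) by (cases "m = n") auto
    then show "y \<in> D (n + N)" using m by simp
  qed
  define R where "R = W o\<^sub>L (chi Z o\<^sub>L P o\<^sub>L chi Z) o\<^sub>L W'"
  have R: "R \<in> alg compact_class Z'"
    unfolding R_def by (intro W(2) entry_class.chi_compress_alg[OF entry_class_compact P(1)] ZX)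
  have \<xi>Z: "chi Z (\<xi> (n + N)) = \<xi> (n + N)" for n
    unfolding chi_fixed_iff using \<xi>(1)[of "n + N"] by (auto simp: ell2_on_def Z_def)
  have Rapp: "ell2_fun (R v) z = cinner v (\<zeta> n) *\<^sub>C ell2_fun (\<zeta> n) z" if z: "z \<in> D' n" for v z n
  proof -
    have "ell2_fun (R v) z = (\<Sum>y\<in>fiber Z f z. S y (ell2_fun (P (chi Z (W' v))) y))"
      unfolding R_def by (simp add: W(4)) (auto simp: chi_apply fiber_def intro!: sum.cong)
    also have "\<dots> = (\<Sum>y\<in>fiber Z f z. cinner (chi Z (W' v)) (\<xi> (n + N)) *\<^sub>C S y (ell2_fun (\<xi> (n + N)) y))"
    proof (intro sum.cong refl)
      fix y assume y: "y \<in> fiber Z f z"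
      then have "y \<in> D (n + N)" "y \<in> Z" using fib[OF z] by (auto simp: fiber_def)
      then show "S y (ell2_fun (P (chi Z (W' v))) y)
        = cinner (chi Z (W' v)) (\<xi> (n + N)) *\<^sub>C S y (ell2_fun (\<xi> (n + N)) y)"
        by (simp add: Papp clinear_op_scaleC W(5))
    qed
    also have "\<dots> = cinner (chi Z (W' v)) (\<xi> (n + N)) *\<^sub>C ell2_fun (\<zeta> n) z"
      by (simp add: \<zeta>_def W(4) scaleC_sum_right)
    also have "cinner (chi Z (W' v)) (\<xi> (n + N)) = cinner v (\<zeta> n)"
      by (simp add: adjoint_pairD[OF chi_self_adjoint] \<xi>Z \<zeta>_def adjoint_pairD[OF adjoint_pair_sym[OF adj]])
    finally show ?thesis .
  qed
  have n\<zeta>: "norm (\<zeta> n) = 1" for n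
  proof -
    have "cinner (\<zeta> n) (\<zeta> n) = cinner (\<xi> (n + N)) (\<xi> (n + N))"
      by (simp add: \<zeta>_def adjoint_pairD[OF adj] partial_unitary_apply[OF W(1)] \<xi>Z)
    then show ?thesis
      using \<xi>(2)[of "n + N"] by (simp add: cinner_self power2_eq_iff_nonneg flip: of_real_power)
        (metis abs_norm_cancel abs_square_eq_1)
  qed
  have \<zeta>D: "\<zeta> n \<in> ell2_on (D' n)" for n
    unfolding ell2_on_def
  proof (intro CollectI allI impI)
    fix z assume z: "z \<notin> D' n"
    have "ell2_fun (\<xi> (n + N)) y = 0" if "y \<in> fiber Z f z" for y
      using z that \<xi>(1)[of "n + N"] by (auto simp: D'_def fiber_def ell2_on_def)
    then show "ell2_fun (\<zeta> n) z = 0" by (simp add: \<zeta>_def W(4))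
  qed
  have D'ne: "D' n \<noteq> {}" "finite (D' n)" for n using D(3,4) by (auto simp: D'_def)
  have sd': "sparse_decomposition Z' D'"
    unfolding sparse_decomposition_def
  proof (intro conjI allI)
    show "disjoint_family D'"
      unfolding disjoint_family_on_def
    proof (intro ballI impI)
      fix i j :: nat assume "i \<noteq> j"
      have False if "x \<in> D (i + N)" "x' \<in> D (j + N)" "f x = f x'" for x x'
        using N[OF _ _ that(1,2)] that(3) \<open>i \<noteq> j\<close> by simp
      then show "D' i \<inter> D' j = {}" unfolding D'_def by blast
    qed
    show "(\<Union>n. D' n) = Z'" unfolding D'_def Z'_def Z_def by blast
    fix r :: real
    obtain M where M: "\<And>n m x x'. n \<noteq> m \<Longrightarrow> M \<le> n + m \<Longrightarrow> x \<in> D n \<Longrightarrow> x' \<in> D m \<Longrightarrow> r < dist (f x) (f x')"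
      using far[of r] by blast
    have "r \<le> setdist (D' n) (D' m)" if "n \<noteq> m" "M \<le> n + m" for n m
      unfolding le_setdist_iff using M[of "n + N" "m + N"] that D'ne
      by (auto simp: D'_def intro: less_imp_le)
    then show "\<exists>M. \<forall>n m. n \<noteq> m \<and> M \<le> n + m \<longrightarrow> r \<le> setdist (D' n) (D' m)" by blast
  qed (use D'ne in auto)
  have bdd: "bdd_above ((\<lambda>x. (norm (ell2_fun (\<xi> n) x))\<^sup>2) ` D n)" for n
    using D(3) by auto
  have "(\<lambda>n. SUP z\<in>D' n. (norm (ell2_fun (\<zeta> n) z))\<^sup>2) \<longlonglongrightarrow> 0"
  proof (rule tendsto_sandwich)
    let ?s = "\<lambda>n. SUP x\<in>D n. (norm (ell2_fun (\<xi> n) x))\<^sup>2"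
    have s0: "0 \<le> ?s n" for n
    proof -
      obtain d where "d \<in> D n" using D(4) by blast
      then show ?thesis by (intro cSUP_upper2[OF bdd, where x = d]) auto
    qed
    \<comment> \<open>A value of \<open>\<zeta> n\<close> is a sum of at most \<open>k\<close>
      contractions applied to values of \<open>\<xi> (n + N)\<close>, so collapsing enlarges the
      largest value by a factor of at most \<open>k\<close>.\<close>
    have "(norm (ell2_fun (\<zeta> n) z))\<^sup>2 \<le> (real k)\<^sup>2 * ?s (n + N)" if z: "z \<in> D' n" for n z
    proof -
      have "norm (ell2_fun (\<zeta> n) z) \<le> (\<Sum>y\<in>fiber Z f z. norm (S y (ell2_fun (\<xi> (n + N)) y)))"
        unfolding \<zeta>_def W(4) by (rule norm_sum)
      also have "\<dots> \<le> (\<Sum>y\<in>fiber Z f z. sqrt (?s (n + N)))"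
      proof (rule sum_mono)
        fix y assume y: "y \<in> fiber Z f z"
        have "norm (S y (ell2_fun (\<xi> (n + N)) y)) \<le> norm (ell2_fun (\<xi> (n + N)) y)"
          using y by (intro W(6)) (simp add: fiber_def)
        also have "\<dots> \<le> sqrt (?s (n + N))"
          using fib[OF z] y by (intro real_le_rsqrt cSUP_upper[OF _ bdd]) auto
        finally show "norm (S y (ell2_fun (\<xi> (n + N)) y)) \<le> sqrt (?s (n + N))" .
      qed
      also have "\<dots> \<le> real k * sqrt (?s (n + N))"
        using kf(2)[of z] s0 by (simp add: mult_right_mono)
      finally have "(norm (ell2_fun (\<zeta> n) z))\<^sup>2 \<le> (real k * sqrt (?s (n + N)))\<^sup>2"
        by (rule power_mono) simp
      then show ?thesis using s0 by (simp add: power_mult_distrib)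
    qed
    then show "eventually (\<lambda>n. (SUP z\<in>D' n. (norm (ell2_fun (\<zeta> n) z))\<^sup>2) \<le> (real k)\<^sup>2 * ?s (n + N)) sequentially"
      by (intro always_eventually allI cSUP_least D'ne)
    have "0 \<le> (SUP z\<in>D' n. (norm (ell2_fun (\<zeta> n) z))\<^sup>2)" for n
    proof -
      obtain d where "d \<in> D' n" using D'ne by blast
      then show ?thesis using D'ne by (intro cSUP_upper2[where x = d]) auto
    qed
    then show "eventually (\<lambda>n. 0 \<le> (SUP z\<in>D' n. (norm (ell2_fun (\<zeta> n) z))\<^sup>2)) sequentially"
      by simp
    show "(\<lambda>n. (real k)\<^sup>2 * ?s (n + N)) \<longlonglongrightarrow> 0"
      using tendsto_mult_right_zero[OF LIMSEQ_ignore_initial_segment[OF ghost, of N]] by blast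
  qed simp
  moreover have "block_rank_one_projection Z' D' \<zeta> R"
    using sd' \<zeta>D n\<zeta> Rapp alg_op_on[OF R] by (simp add: block_rank_one_projection_def)
  ultimately have "block_rank_one_ghost_projection Z' R"
    by (auto simp: block_rank_one_ghost_projection_def)
  moreover have "R \<in> roe_algebra H\<^sub>0 Z'" using R by (simp add: roe_algebra_alg)
  moreover have "Z' \<subseteq> Y" using coarse_embedding_control(1)[OF f] ZX(1) by (auto simp: Z'_def)
  moreover have "sparse_space Z'" using sd' by (auto simp: sparse_space_def)
  ultimately show False using gf unfolding ghost_free_def by blast
qed


section \<open>Assembling the coarse equivalence\<close>

lemma coarse_embeddingI:
  fixes X :: "'a::metric_space set" and Y :: "'b::metric_space set"
  assumes fXY: "f ` X \<subseteq> Y"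
    and up: "\<And>R. \<exists>S. \<forall>x\<in>X. \<forall>x'\<in>X. dist x x' \<le> R \<longrightarrow> dist (f x) (f x') \<le> S"
    and lo: "\<And>R. \<exists>S. \<forall>x\<in>X. \<forall>x'\<in>X. dist (f x) (f x') \<le> R \<longrightarrow> dist x x' \<le> S"
  shows "coarse_embedding X Y f"
proof -
  \<comment> \<open>The element 0 keeps the set nonempty for empty \<open>X\<close> and for negative
    \<open>r\<close>.\<close>
  define A where "A r = insert 0 {dist (f x) (f x') |x x'. x \<in> X \<and> x' \<in> X \<and> dist x x' \<le> r}" for r
  \<comment> \<open>The summand \<open>r\<close> makes \<open>\<rho>2\<close> unbounded even when
    the image of \<open>f\<close> is bounded.\<close>
  define \<rho>2 where "\<rho>2 r = r + Sup (A r)" for r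
  \<comment> \<open>When no two points are at distance \<open>r\<close> or more, the condition on
    pairs is void; the cap \<open>s \<le> r\<close> then keeps the set bounded, and its supremum
    \<open>r\<close> still grows.\<close>
  define B where "B r = {s. 0 \<le> s \<and> s \<le> r \<and> (\<forall>x\<in>X. \<forall>x'\<in>X. r \<le> dist x x' \<longrightarrow> s \<le> dist (f x) (f x'))}" for r
  define \<rho>1 where "\<rho>1 r = Sup (B r)" for r
  have bA: "bdd_above (A r)" for r
  proof -
    obtain S where "\<And>x x'. x \<in> X \<Longrightarrow> x' \<in> X \<Longrightarrow> dist x x' \<le> r \<Longrightarrow> dist (f x) (f x') \<le> S"
      using up[of r] by blast
    then show ?thesis unfolding A_def by (intro bdd_aboveI[of _ "max 0 S"]) (auto simp: le_max_iff_disj)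
  qed
  have Amono: "A r \<subseteq> A s" if "r \<le> s" for r s
    unfolding A_def using order_trans[OF _ that] by blast
  have A0: "0 \<le> Sup (A r)" for r by (rule cSup_upper[OF _ bA]) (simp add: A_def)
  have bB: "bdd_above (B r)" for r by (intro bdd_aboveI[of _ r]) (auto simp: B_def)
  have B0: "0 \<in> B r" if "r \<ge> 0" for r using that by (simp add: B_def)
  have c1: "control_function \<rho>1"
    unfolding control_function_def
  proof (intro conjI)
    show "\<rho>1 ` {0..} \<subseteq> {0..}" unfolding \<rho>1_def using cSup_upper[OF B0 bB] by auto
    show "mono_on {0..} \<rho>1"
      unfolding \<rho>1_def
      by (intro mono_onI cSup_subset_mono bB) (use B0 in \<open>auto simp: B_def\<close>)
    show "\<not> bdd_above (\<rho>1 ` {0..})"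
    proof
      assume "bdd_above (\<rho>1 ` {0..})"
      then obtain K where K: "\<And>r. r \<ge> 0 \<Longrightarrow> \<rho>1 r \<le> K" by (auto simp: bdd_above_def)
      define R where "R = max K 0 + 1"
      obtain S where S: "\<And>x x'. x \<in> X \<Longrightarrow> x' \<in> X \<Longrightarrow> dist (f x) (f x') \<le> R \<Longrightarrow> dist x x' \<le> S"
        using lo[of R] by blast
      define r where "r = max (S + 1) R"
      have "R \<le> dist (f x) (f x')" if "x \<in> X" "x' \<in> X" "r \<le> dist x x'" for x x'
        using S[OF that(1,2)] that(3) unfolding r_def by (cases "dist (f x) (f x') \<le> R") auto
      then have "R \<in> B r" by (auto simp: B_def r_def R_def)
      then have "R \<le> \<rho>1 r" unfolding \<rho>1_def by (rule cSup_upper[OF _ bB])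
      moreover have "\<rho>1 r \<le> K" by (rule K) (simp add: r_def R_def)
      ultimately show False by (simp add: R_def)
    qed
  qed
  have c2: "control_function \<rho>2"
    unfolding control_function_def
  proof (intro conjI)
    show "\<rho>2 ` {0..} \<subseteq> {0..}" unfolding \<rho>2_def using A0 by auto
    show "mono_on {0..} \<rho>2"
      unfolding \<rho>2_def
      using Amono by (intro mono_onI add_mono cSup_subset_mono bA) (auto simp: A_def)
    show "\<not> bdd_above (\<rho>2 ` {0..})"
    proof
      assume "bdd_above (\<rho>2 ` {0..})"
      then obtain K where K: "\<And>r. r \<ge> 0 \<Longrightarrow> \<rho>2 r \<le> K" by (auto simp: bdd_above_def)
      show False using K[of "max K 0 + 1"] A0[of "max K 0 + 1"] by (simp add: \<rho>2_def)
    qed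
  qed
  have "\<rho>1 (dist x x') \<le> dist (f x) (f x') \<and> dist (f x) (f x') \<le> \<rho>2 (dist x x')"
    if x: "x \<in> X" "x' \<in> X" for x x'
  proof
    show "\<rho>1 (dist x x') \<le> dist (f x) (f x')"
      unfolding \<rho>1_def
    proof (rule cSup_least)
      show "B (dist x x') \<noteq> {}" using B0[of "dist x x'"] by auto
    qed (use x in \<open>auto simp: B_def\<close>)
    have "dist (f x) (f x') \<le> Sup (A (dist x x'))"
      by (rule cSup_upper[OF _ bA]) (use x in \<open>auto simp: A_def\<close>)
    then show "dist (f x) (f x') \<le> \<rho>2 (dist x x')" by (simp add: \<rho>2_def add_increasing)
  qed
  with c1 c2 fXY show ?thesis unfolding coarse_embedding_def by blast
qed

lemma injective_subsequence2:
  assumes "\<And>c. finite {n. z n = c}" "\<And>c. finite {n. z' n = c}"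
  shows "\<exists>r :: nat \<Rightarrow> nat. strict_mono r \<and> inj (\<lambda>n. z (r n)) \<and> inj (\<lambda>n. z' (r n))"
proof -
  obtain r :: "nat \<Rightarrow> nat" where r: "strict_mono r" "inj (\<lambda>n. z (r n))"
    using injective_subsequence[of z, OF assms(1)] by blast
  have ir: "inj r" using r(1) by (rule strict_mono_imp_inj_on)
  have "finite {n. z' (r n) = c}" for c
    using finite_vimageI[OF assms(2)[of c] ir] by (simp add: vimage_def)
  then obtain q :: "nat \<Rightarrow> nat" where q: "strict_mono q" "inj (\<lambda>n. z' (r (q n)))"
    using injective_subsequence[of "\<lambda>n. z' (r n)"] by blast
  have "inj (\<lambda>n. z (r (q n)))"
    using inj_compose[OF r(2) strict_mono_imp_inj_on[OF q(1)]] by (simp add: comp_def)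
  then show ?thesis
    using q r(1) by (intro exI[of _ "\<lambda>n. r (q n)"]) (auto simp: strict_mono_def)
qed

text \<open>Only finitely many values of \<open>g\<close> occur on the pairs from \<open>A\<close>
  and \<open>B\<close>, and each of them bounds the index.\<close>

lemma finite_indices:
  fixes g :: "'a \<Rightarrow> 'b \<Rightarrow> real"
  assumes "finite A" "finite B" "\<And>n. n \<in> I \<Longrightarrow> x n \<in> A \<and> x' n \<in> B \<and> real n < g (x n) (x' n)"
  shows "finite I"
proof -
  have "finite {n. real n < c}" for c
    by (rule finite_subset[of _ "{..nat \<lceil>c\<rceil>}"]) (auto, linarith)
  then have "finite (\<Union>a\<in>A. \<Union>b\<in>B. {n. real n < g a b})" using assms by blast
  moreover have "I \<subseteq> (\<Union>a\<in>A. \<Union>b\<in>B. {n. real n < g a b})" using assms(3) by blast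
  ultimately show ?thesis by (rule finite_subset[rotated])
qed

lemma at_top_subsequence:
  assumes "strict_mono (r :: nat \<Rightarrow> nat)" "\<And>n. real n < g n"
  shows "filterlim (\<lambda>n. g (r n) :: real) at_top sequentially"
proof (rule filterlim_at_top_mono[OF filterlim_real_sequentially])
  have "real n \<le> g (r n)" for n
    using assms(2)[of "r n"] strict_mono_imp_increasing[OF assms(1), of n] by linarith
  then show "eventually (\<lambda>n. real n \<le> g (r n)) sequentially" by simp
qed

lemma bounded_geometry_finite_cball: "bounded_geometry X \<Longrightarrow> x \<in> X \<Longrightarrow> finite (X \<inter> cball x R)"
  using bounded_geometryD[of X R] by metis

text \<open>The coarse equivalence \<open>f\<close> sends \<open>x\<close> to a point where \<open>U(x \<otimes> e)\<close> is not small.  It is a coarse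
  embedding by the separation lemma, so that \<open>X\<close> inherits the absence of ghosts from \<open>Y\<close>.  This
  makes the inverse of \<open>U\<close> non-spreading as well, and \<open>f\<close> has coarsely dense image.\<close>

proposition star_isomorphic_coarsely_equivalent:
  fixes X :: "'a::metric_space set" and Y :: "'b::metric_space set"
    and E :: "('h::chilbert_space \<Rightarrow>\<^sub>L 'h) set set" and e0 :: "nat \<Rightarrow> 'h"
  assumes E: "entry_class E" and e0: "total_onseq e0"
    and bgX: "bounded_geometry X" and bgY: "bounded_geometry Y" and X: "X \<noteq> {}"
    and gf: "ghost_free TYPE('h) Y" and iso: "star_isomorphic (alg E X) (alg E Y)"
  shows "coarsely_equivalent X Y"
proof -
  define e where "e = e0 0"
  have e: "norm e = 1" unfolding e_def by (rule onseq_norm[OF total_onseq_onseq[OF e0]])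
  obtain U :: "('a, 'h) ell2 \<Rightarrow>\<^sub>L ('b, 'h) ell2" and V where UV: "partial_unitary (chi X) (chi Y) U V"
    "\<And>T. T \<in> alg E X \<Longrightarrow> U o\<^sub>L T o\<^sub>L V \<in> alg E Y"
    "\<And>T. T \<in> alg E Y \<Longrightarrow> V o\<^sub>L T o\<^sub>L U \<in> alg E X"
    by (rule alg_spatial[OF E iso X e]) (rule that; blast)
  interpret A: alg_unitary E X Y U V e
    using E UV bgX bgY e by (simp add: alg_unitary_def alg_unitary_axioms_def)
  interpret B: alg_unitary E Y X V U e by (rule A.swap)
  obtain \<delta> where \<delta>: "\<delta> > 0" "\<And>x. x \<in> X \<Longrightarrow> \<exists>y\<in>Y. \<delta> \<le> norm (ell2_fun (U (ell2_single x e)) y)"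
    using A.not_spread_out[OF gf] by blast
  obtain V0 where V0: "admissible E V0" "e \<in> V0"
    "\<And>x. x \<in> X \<Longrightarrow> \<exists>y\<in>Y. \<exists>v\<in>V0. norm v = 1 \<and>
      \<delta> / 2 \<le> cmod (cinner (U (ell2_single x e)) (ell2_single y v))"
    using A.localise[OF \<delta>] by blast
  then obtain f v where f: "\<And>x. x \<in> X \<Longrightarrow> f x \<in> Y" "\<And>x. x \<in> X \<Longrightarrow> v x \<in> V0"
    "\<And>x. x \<in> X \<Longrightarrow> norm (v x) = 1"
    "\<And>x. x \<in> X \<Longrightarrow> \<delta> / 2 \<le> cmod (cinner (U (ell2_single x e)) (ell2_single (f x) (v x)))"
    by metis
  have \<delta>2: "\<delta> / 2 > 0" using \<delta>(1) by simp
  have cU: "cmod (cinner (U p) q) = cmod (cinner (V q) p)" for p q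
    using cinner_commute[of "U p" q] by (simp add: adjoint_pairD[OF B.adj])
  have fin_f: "finite {x \<in> X. f x = y}" for y
  proof (rule finite_subset[OF _ A.finite_preimages[OF \<delta>2, of y]], safe)
    fix x assume x: "x \<in> X"
    have "\<delta> / 2 \<le> cmod (cinner (ell2_fun (U (ell2_single x e)) (f x)) (v x))"
      using f(4)[OF x] by (simp add: cinner_single_right)
    also have "\<dots> \<le> norm (ell2_fun (U (ell2_single x e)) (f x))"
      using cinner_Cauchy_Schwarz[of "ell2_fun (U (ell2_single x e)) (f x)" "v x"] f(3)[OF x] by simp
    finally show "\<delta> / 2 \<le> norm (ell2_fun (U (ell2_single x e)) (f x))" .
  qed
  have up: "\<exists>S. \<forall>x\<in>X. \<forall>x'\<in>X. dist x x' \<le> R \<longrightarrow> dist (f x) (f x') \<le> S" for R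
  proof (rule ccontr)
    assume "\<not> ?thesis"
    then have "\<exists>x\<in>X. \<exists>x'\<in>X. dist x x' \<le> R \<and> real n < dist (f x) (f x')" for n :: nat
      by (meson not_le)
    then obtain x x' where x: "\<And>n. x n \<in> X" "\<And>n. x' n \<in> X" "\<And>n. dist (x n) (x' n) \<le> R"
      and far: "\<And>n::nat. real n < dist (f (x n)) (f (x' n))" by metis
    have finx': "finite (\<Union>a\<in>{a \<in> X. f a = y}. X \<inter> cball a R)" for y
      using fin_f[of y] bounded_geometry_finite_cball[OF bgX] by blast
    \<comment> \<open>A value \<open>y\<close> leaves finitely many choices for \<open>x n\<close>
      and, by bounded geometry, for \<open>x' n\<close>; finitely many distances between images
      result, while these exceed \<open>n\<close>. So the sequences can be thinned out to injective
      ones, as the separation argument demands.\<close>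
    have "finite {n. f (x n) = y}" for y
      by (rule finite_indices[OF fin_f[of y] finx'[of y], where x = x and x' = x'
            and g = "\<lambda>a b. dist (f a) (f b)"])
        (use x far in auto)
    moreover have "finite {n. x n = c}" for c
      by (rule finite_subset[OF _ \<open>finite {n. f (x n) = f c}\<close>]) auto
    moreover have "finite {n. x' n = c}" for c
    proof (cases "c \<in> X")
      case True
      have "finite (\<Union>a\<in>X \<inter> cball c R. {n. x n = a})"
        using bounded_geometry_finite_cball[OF bgX True] \<open>\<And>c. finite {n. x n = c}\<close> by blast
      then show ?thesis
        by (rule finite_subset[rotated]) (use x in \<open>auto simp: dist_commute\<close>)
    next
      case False
      then have "{n. x' n = c} = {}" using x(2) by auto
      then show ?thesis by simp
    qed
    ultimately obtain r :: "nat \<Rightarrow> nat"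
      where r: "strict_mono r" "inj (\<lambda>n. f (x (r n)))" "inj (\<lambda>n. x' (r n))"
      using injective_subsequence2[of "\<lambda>n. f (x n)" x'] by blast
    have ix: "inj (\<lambda>n. x (r n))" using r(2) by (auto simp: inj_def)
    show False
    proof (rule A.separation[OF ix _ r(3) _ x(3) V0(1) _ _ _ _ r(2) _ _ \<delta>2])
      show "filterlim (\<lambda>n. dist (f (x' (r n))) (f (x (r n)))) at_top sequentially"
        using at_top_subsequence[OF r(1), of "\<lambda>n. dist (f (x' n)) (f (x n))"] far
        by (simp add: dist_commute)
      show "\<delta> / 2 \<le> cmod (cinner (U (ell2_single (x (r n)) e)) (ell2_single (f (x (r n))) (v (x (r n)))))" for n
        by (rule f(4)[OF x(1)])
      show "\<delta> / 2 \<le> cmod (cinner (U (ell2_single (x' (r n)) e)) (ell2_single (f (x' (r n))) (v (x' (r n)))))" for n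
        by (rule f(4)[OF x(2)])
    qed (use x f e V0 in auto)
  qed
  have lo: "\<exists>S. \<forall>x\<in>X. \<forall>x'\<in>X. dist (f x) (f x') \<le> R \<longrightarrow> dist x x' \<le> S" for R
  proof (rule ccontr)
    assume "\<not> ?thesis"
    then have "\<exists>x\<in>X. \<exists>x'\<in>X. dist (f x) (f x') \<le> R \<and> real n < dist x x'" for n :: nat
      by (meson not_le)
    then obtain x x' where x: "\<And>n. x n \<in> X" "\<And>n. x' n \<in> X" "\<And>n. dist (f (x n)) (f (x' n)) \<le> R"
      and far: "\<And>n::nat. real n < dist (x n) (x' n)" by metis
    have fin2: "finite (\<Union>z\<in>Y \<inter> cball y R. {a \<in> X. f a = z})" if "y \<in> Y" for y
      using fin_f bounded_geometry_finite_cball[OF bgY that] by blast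
    have ne: "{n. f (x n) = y} = {}" "{n. f (x' n) = y} = {}" if "y \<notin> Y" for y
      using f(1) x(1,2) that by auto
    have "finite {n. f (x n) = y}" for y
    proof (cases "y \<in> Y")
      case True
      show ?thesis
        by (rule finite_indices[OF fin_f[of y] fin2[OF True], where x = x and x' = x' and g = dist])
          (use x f(1) far in auto)
    qed (simp add: ne)
    moreover have "finite {n. f (x' n) = y}" for y
    proof (cases "y \<in> Y")
      case True
      show ?thesis
        by (rule finite_indices[OF fin2[OF True] fin_f[of y], where x = x and x' = x' and g = dist])
          (use x f(1) far in \<open>auto simp: dist_commute\<close>)
    qed (simp add: ne)
    ultimately obtain r :: "nat \<Rightarrow> nat"
      where r: "strict_mono r" "inj (\<lambda>n. f (x (r n)))" "inj (\<lambda>n. f (x' (r n)))"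
      using injective_subsequence2[of "\<lambda>n. f (x n)" "\<lambda>n. f (x' n)"] by blast
    have ix: "inj (\<lambda>n. x (r n))" using r(2) by (auto simp: inj_def)
    \<comment> \<open>The separation argument now runs for \<open>V\<close>: as \<open>V\<close> is
      adjoint to \<open>U\<close>, the vector \<open>V(f x \<otimes> v x)\<close> has a large
      coefficient at \<open>x \<otimes> e\<close>.\<close>
    show False
    proof (rule B.separation[OF r(2) _ r(3) _ x(3) V0(1) _ _ _ _ ix _ _ \<delta>2])
      show "filterlim (\<lambda>n. dist (x' (r n)) (x (r n))) at_top sequentially"
        using at_top_subsequence[OF r(1), of "\<lambda>n. dist (x' n) (x n)"] far
        by (simp add: dist_commute)
      show "\<delta> / 2 \<le> cmod (cinner (V (ell2_single (f (x (r n))) (v (x (r n))))) (ell2_single (x (r n)) e))" for n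
        using f(4)[OF x(1)] by (simp add: cU)
      show "\<delta> / 2 \<le> cmod (cinner (V (ell2_single (f (x' (r n))) (v (x' (r n))))) (ell2_single (x' (r n)) e))" for n
        using f(4)[OF x(2)] by (simp add: cU)
    qed (use x f e V0 in auto)
  qed
  have ce: "coarse_embedding X Y f"
    by (rule coarse_embeddingI[OF _ up lo]) (use f(1) in auto)
  have gfX: "ghost_free TYPE('h) X" by (rule ghost_free_coarse_embedding[OF e0 bgX ce gf])
  obtain \<delta>' where \<delta>': "\<delta>' > 0" "\<And>y. y \<in> Y \<Longrightarrow> \<exists>x\<in>X. \<delta>' \<le> norm (ell2_fun (V (ell2_single y e)) x)"
    using B.not_spread_out[OF gfX] by blast
  obtain V1 where V1: "admissible E V1" "e \<in> V1"
    "\<And>y. y \<in> Y \<Longrightarrow> \<exists>x\<in>X. \<exists>u\<in>V1. norm u = 1 \<and>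
      \<delta>' / 2 \<le> cmod (cinner (V (ell2_single y e)) (ell2_single x u))"
    using B.localise[OF \<delta>'] by blast
  then obtain g u where g: "\<And>y. y \<in> Y \<Longrightarrow> g y \<in> X" "\<And>y. y \<in> Y \<Longrightarrow> u y \<in> V1"
    "\<And>y. y \<in> Y \<Longrightarrow> norm (u y) = 1"
    "\<And>y. y \<in> Y \<Longrightarrow> \<delta>' / 2 \<le> cmod (cinner (V (ell2_single y e)) (ell2_single (g y) (u y)))"
    by metis
  have \<delta>'2: "\<delta>' / 2 > 0" using \<delta>'(1) by simp
  have fin_g: "finite {y \<in> Y. g y = x}" for x
  proof (rule finite_subset[OF _ B.finite_preimages[OF \<delta>'2, of x]], safe)
    fix y assume y: "y \<in> Y"
    have "\<delta>' / 2 \<le> cmod (cinner (ell2_fun (V (ell2_single y e)) (g y)) (u y))"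
      using g(4)[OF y] by (simp add: cinner_single_right)
    also have "\<dots> \<le> norm (ell2_fun (V (ell2_single y e)) (g y))"
      using cinner_Cauchy_Schwarz[of "ell2_fun (V (ell2_single y e)) (g y)" "u y"] g(3)[OF y] by simp
    finally show "\<delta>' / 2 \<le> norm (ell2_fun (V (ell2_single y e)) (g y))" .
  qed
  have "\<exists>C>0. \<forall>y\<in>Y. \<exists>x\<in>X. dist y (f x) \<le> C"
  proof (rule ccontr)
    assume not: "\<not> ?thesis"
    have "\<exists>y\<in>Y. \<forall>x\<in>X. real n < dist y (f x)" for n :: nat
    proof (rule ccontr)
      assume "\<not> ?thesis"
      \<comment> \<open>\<open>n + 1\<close> because the constant of coarse density has to be
        positive, also for \<open>n = 0\<close>.\<close>
      then have "\<forall>y\<in>Y. \<exists>x\<in>X. dist y (f x) \<le> real n + 1" by (meson not_le add_increasing2 zero_le_one)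
      then show False using not by (metis of_nat_0_le_iff add_nonneg_pos zero_less_one)
    qed
    then obtain y where y: "\<And>n. y n \<in> Y" and far: "\<And>(n::nat) x. x \<in> X \<Longrightarrow> real n < dist (y n) (f x)"
      by metis
    obtain x0 where x0: "x0 \<in> X" using X by blast
    have finy: "finite {n. y n = c}" for c
      by (rule finite_indices[of "{c}" "{x0}" _ y "\<lambda>_. x0" "\<lambda>a b. dist a (f b)"])
        (use far[OF x0] in auto)
    have "finite {n. g (y n) = c}" for c
    proof -
      have "finite (\<Union>a\<in>{a \<in> Y. g a = c}. {n. y n = a})" using fin_g finy by blast
      then show ?thesis by (rule finite_subset[rotated]) (use y in auto)
    qed
    then obtain r :: "nat \<Rightarrow> nat"
      where r: "strict_mono r" "inj (\<lambda>n. g (y (r n)))" "inj (\<lambda>n. y (r n))"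
      using injective_subsequence2[of "\<lambda>n. g (y n)" y] finy by blast
    have "min (\<delta> / 2) (\<delta>' / 2) > 0" using \<delta>2 \<delta>'2 by simp
    \<comment> \<open>The two sequences of points coincide here: the partial translation has
      propagation 0 and only changes the coefficient vector at \<open>g y\<close> from
      \<open>u y\<close> to \<open>e\<close>. The first vector is seen by \<open>U\<close> at
      \<open>y\<close> and the second at \<open>f (g y)\<close>, so these two points cannot drift
      apart.\<close>
    show False
    proof (rule A.separation[OF r(2) _ r(2) _ _ V1(1) _ _ _ _ r(3) _ _ \<open>min (\<delta> / 2) (\<delta>' / 2) > 0\<close>])
      show "dist (g (y (r n))) (g (y (r n))) \<le> 0" for n by simp
      show "filterlim (\<lambda>n. dist (f (g (y (r n)))) (y (r n))) at_top sequentially"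
        using at_top_subsequence[OF r(1), of "\<lambda>n. dist (f (g (y n))) (y n)"] far[OF g(1)[OF y]]
        by (simp add: dist_commute)
      show "min (\<delta> / 2) (\<delta>' / 2) \<le> cmod (cinner (U (ell2_single (g (y (r n))) (u (y (r n))))) (ell2_single (y (r n)) e))" for n
        using g(4)[OF y] by (simp add: cU min.coboundedI2)
      show "min (\<delta> / 2) (\<delta>' / 2) \<le> cmod (cinner (U (ell2_single (g (y (r n))) e))
          (ell2_single (f (g (y (r n)))) (v (g (y (r n))))))" for n
        using f(4)[OF g(1)[OF y]] by (simp add: min.coboundedI1)
    qed (use y g f e V1 in auto)
  qed
  with ce show ?thesis unfolding coarsely_equivalent_def by blast
qed


section \<open>Stabilisation\<close>

lemma stabilization_least:
  assumes "closed S" "subspace S"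
    and "\<And>a k T. a \<in> A \<Longrightarrow> k \<in> compact_operators \<Longrightarrow> is_tensor_op a k T \<Longrightarrow> T \<in> S"
  shows "stabilization A \<subseteq> S"
  unfolding stabilization_def
  by (intro closure_minimal real_vector.span_minimal assms(1,2)) (use assms(3) in blast)

lemma uniform_roe_algebra_op_on:
  assumes "T \<in> uniform_roe_algebra X" shows "T \<in> op_on (ell2_on X)"
proof -
  have "uniform_roe_algebra X \<subseteq> op_on (ell2_on X)"
    unfolding uniform_roe_algebra_def by (rule closure_minimal) (auto simp: closed_op_on_ell2_on)
  then show ?thesis using assms by blast
qed

lemma ell2_tensor_apply: "ell2_fun (ell2_tensor v \<eta>) n = ell2_fun \<eta> n *\<^sub>C v"
  by (simp add: ell2_tensor.rep_eq)

lemma ell2_tensor_scaleC: "ell2_tensor (c *\<^sub>C v) \<eta> = c *\<^sub>C ell2_tensor v \<eta>"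
  "ell2_tensor v (c *\<^sub>C \<eta>) = c *\<^sub>C ell2_tensor v \<eta>"
  by (rule ell2_eqI, simp add: ell2_tensor_apply scaleC_ell2.rep_eq scaleC_scaleC scaleC_complex_def
      mult.commute)+

lemma single_eq_tensor: "ell2_single n v = ell2_tensor v (ell2_single n 1)"
  by (rule ell2_eqI) (simp add: ell2_tensor_apply single_apply)

lemma ell2_map_tensor:
  "clinear_op a \<Longrightarrow> ell2_map a (ell2_tensor v \<eta>) = ell2_tensor (blinfun_apply a v) \<eta>"
  by (rule ell2_eqI) (simp add: ell2_map_apply ell2_tensor_apply clinear_op_scaleC)

text \<open>The elementary tensor among the functions with values in the coefficient space.
  \<open>ell2_tensor\<close> has its factors the other way round, and the unitary of the
  stabilisation passes from one form to the other.\<close>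

definition simple_tensor :: "('a, complex) ell2 \<Rightarrow> 'h::chilbert_space \<Rightarrow> ('a, 'h) ell2" where
  "simple_tensor w h = ell2_map (rank1 h 1) w"

lemma simple_tensor_apply: "ell2_fun (simple_tensor w h) x = ell2_fun w x *\<^sub>C h"
  by (simp add: simple_tensor_def ell2_map_apply rank1_apply cinner_complex_def)

lemma simple_tensor_scaleC: "simple_tensor (c *\<^sub>C w) h = c *\<^sub>C simple_tensor w h"
  by (rule ell2_eqI) (simp add: simple_tensor_apply scaleC_ell2.rep_eq scaleC_scaleC scaleC_complex_def)

lemma single_eq_simple_tensor: "ell2_single x h = simple_tensor (ell2_single x 1) h"
  by (rule ell2_eqI) (simp add: simple_tensor_apply single_apply)

lemma chi_simple_tensor: "chi S (simple_tensor w h) = simple_tensor (chi S w) h"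
  by (rule ell2_eqI) (simp add: simple_tensor_apply chi_apply)

lemma ell2_map_simple_tensor:
  "clinear_op K \<Longrightarrow> ell2_map K (simple_tensor w h) = simple_tensor w (blinfun_apply K h)"
  by (rule ell2_eqI) (simp add: ell2_map_apply simple_tensor_apply clinear_op_scaleC)

lemma bounded_linear_ell2_map: "bounded_linear ell2_map"
proof (rule bounded_linear_intro[where K = 1])
  show "ell2_map (S + T) = ell2_map S + ell2_map T" for S T :: "'h::chilbert_space \<Rightarrow>\<^sub>L 'k::chilbert_space"
    by (rule blinfun_eqI, rule ell2_eqI)
      (simp add: plus_blinfun.rep_eq plus_ell2.rep_eq ell2_map_apply)
  show "ell2_map (r *\<^sub>R T) = r *\<^sub>R ell2_map T" for r and T :: "'h::chilbert_space \<Rightarrow>\<^sub>L 'k::chilbert_space"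
    by (rule blinfun_eqI, rule ell2_eqI)
      (simp add: scaleR_blinfun.rep_eq scaleR_ell2.rep_eq ell2_map_apply)
qed (simp add: norm_ell2_map_le)

lemma closed_linear_preimage:
  assumes f: "bounded_linear f" and S: "closed S" "subspace S"
  shows "closed {T. f T \<in> S}" "subspace {T. f T \<in> S}"
proof -
  show "closed {T. f T \<in> S}"
    using continuous_closed_vimage[OF S(1), of f] linear_continuous_at[OF f] by (simp add: vimage_def)
  interpret bounded_linear f by fact
  show "subspace {T. f T \<in> S}"
    using S(2) by (simp add: real_vector.subspace_def add scaleR zero)
qed

lemma norm_le_unit_ball:
  assumes "\<And>v. norm v \<le> 1 \<Longrightarrow> norm (blinfun_apply T v) \<le> b" "b \<ge> 0"
  shows "norm T \<le> b"
proof (rule norm_blinfun_bound[OF assms(2)])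
  fix v
  show "norm (T v) \<le> b * norm v"
  proof (cases "v = 0")
    case False
    have "norm (T (v /\<^sub>R norm v)) \<le> b" using False by (intro assms(1)) simp
    then show ?thesis using False by (simp add: blinfun.scaleR_right divide_le_eq field_simps)
  qed simp
qed

text \<open>Finite coordinate projections converge strongly to the identity, and a finite net makes
  this uniform on the relatively compact image of the unit ball. Truncation confines only the range;
  the vectors representing the coordinate functionals are added to \<open>F\<close> so that the
  operator also vanishes on the orthogonal complement.\<close>

lemma compact_finite_rank_approx:
  fixes e :: "nat \<Rightarrow> 'h::chilbert_space" and K :: "'h \<Rightarrow>\<^sub>L 'h"
  assumes e: "total_onseq e" and K: "K \<in> compact_operators"
  shows "K \<in> closure (\<Union>F\<in>Collect finite. op_on (cspan F))"
  unfolding closure_approachable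
proof (intro allI impI)
  fix d :: real assume d: "d > 0"
  note oe = total_onseq_onseq[OF e]
  define P where "P m = (\<Sum>n<m. rank1 (e n) (e n))" for m :: nat
  have P: "P m v = (\<Sum>n<m. cinner v (e n) *\<^sub>C e n)" for m v
    by (simp add: P_def blinfun_sum_apply rank1_apply)
  have nP: "norm (P m v) \<le> norm v" for m v
    by (rule power2_le_imp_le) (simp_all add: P norm_onseq_sum[OF oe] Bessel[OF oe])
  have limP: "(\<lambda>m. P m v) \<longlonglongrightarrow> v" for v
    using total_onseq_sums[OF e, of v] by (simp add: P sums_def)
  have clK: "clinear_op K" by (rule compact_operators_clinear[OF K])
  obtain C where C: "compact C" "K ` cball 0 1 \<subseteq> C" using K by (auto simp: compact_operators_iff)
  obtain N :: "'h set" where N: "finite N" "C \<subseteq> (\<Union>t\<in>N. ball t (d/4))"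
    using C(1) d unfolding compact_eq_totally_bounded by (meson zero_less_divide_iff zero_less_numeral)
  have "eventually (\<lambda>m. \<forall>t\<in>N. dist (P m t) t < d/4) sequentially"
    using limP d N(1) by (intro eventually_ball_finite ballI tendstoD) auto
  then obtain m where m: "\<And>t. t \<in> N \<Longrightarrow> dist (P m t) t < d/4"
    by (auto simp: eventually_sequentially)
  \<comment> \<open>Three errors of \<open>d/4\<close>: from \<open>K v\<close> to the net, from the
    net to its truncation, and back.\<close>
  have "norm (K - (P m o\<^sub>L K)) \<le> 3/4 * d"
  proof (rule norm_le_unit_ball)
    fix v :: 'h assume "norm v \<le> 1"
    then have "K v \<in> C" using C(2) by auto
    then obtain t where t: "t \<in> N" "dist t (K v) < d/4" using N(2) by auto
    have "K v - P m (K v) = (K v - t) + (t - P m t) + P m (t - K v)"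
      by (simp add: blinfun.diff_right)
    then have "norm (K v - P m (K v)) \<le> norm (K v - t) + norm (t - P m t) + norm (P m (t - K v))"
      by (metis norm_triangle_ineq norm_triangle_mono order_refl)
    also have "\<dots> \<le> d/4 + d/4 + d/4"
      using t(2) m[OF t(1)] nP[of m "t - K v"]
      by (intro add_mono) (auto simp: dist_norm norm_minus_commute)
    finally show "norm ((K - (P m o\<^sub>L K)) v) \<le> 3/4 * d" by (simp add: minus_blinfun.rep_eq)
  qed (use d in simp)
  then have "dist (P m o\<^sub>L K) K < d" using d by (simp add: dist_norm norm_minus_commute)
  moreover have "\<exists>F. finite F \<and> P m o\<^sub>L K \<in> op_on (cspan F)"
  proof -
    have "\<exists>c. \<forall>v. cinner (K v) (e n) = cinner v c" for n
    proof -
      obtain c where "\<And>v. (cinner_functional (e n) o\<^sub>L K) v = cinner v c"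
        using Riesz_representation[OF e clinear_op_compose[OF cinner_functional_clinear clK]] by metis
      then show ?thesis by (auto simp: cinner_functional.rep_eq)
    qed
    then obtain c where c: "\<And>n v. cinner (K v) (e n) = cinner v (c n)" by metis
    let ?F = "e ` {..<m} \<union> c ` {..<m}"
    have PK: "(P m o\<^sub>L K) v = (\<Sum>n<m. cinner v (c n) *\<^sub>C e n)" for v by (simp add: P c)
    have "(P m o\<^sub>L K) v \<in> cspan ?F" for v
      unfolding PK
      by (intro complex_vector.span_sum complex_vector.span_scale complex_vector.span_base) auto
    moreover have "(P m o\<^sub>L K) v = 0" if "\<And>w. w \<in> cspan ?F \<Longrightarrow> cinner v w = 0" for v
    proof -
      have "cinner v (c n) = 0" if "n < m" for n
        using that \<open>\<And>w. w \<in> cspan ?F \<Longrightarrow> cinner v w = 0\<close>[OF complex_vector.span_base] by blast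
      then show ?thesis unfolding PK by simp
    qed
    moreover have "clinear_op (P m o\<^sub>L K)"
      unfolding P_def by (intro clinear_op_compose clinear_op_sum rank1_clinear clK)
    ultimately have "P m o\<^sub>L K \<in> op_on (cspan ?F)"
      unfolding op_on_def bounded_operators_iff by blast
    then show ?thesis by (intro exI[of _ ?F]) simp
  qed
  ultimately show "\<exists>T\<in>\<Union>F\<in>Collect finite. op_on (cspan F). dist T K < d" by blast
qed

lemma op_on_scaleC: "T \<in> op_on V \<Longrightarrow> complex_vector.subspace V \<Longrightarrow> op_scaleC c T \<in> op_on V"
  by (auto simp: op_on_def bounded_operators_def op_scaleC_apply scaleC_scaleC mult.commute
      complex_vector.subspace_scale)

lemma total_standard_basis: "total_onseq (\<lambda>n. ell2_single n 1 :: (nat, complex) ell2)"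
  unfolding total_onseq_def
proof (intro conjI allI impI onseq_single)
  fix v :: "(nat, complex) ell2" assume "\<forall>n. cinner v (ell2_single n 1) = 0"
  then show "v = 0"
    by (intro ell2_eqI) (simp add: cinner_single_right cinner_complex_def zero_ell2.rep_eq)
qed auto

text \<open>The unitary is \<open>\<ell>\<^sup>2(\<nat>; \<ell>\<^sup>2(X)) \<cong> \<ell>\<^sup>2(X; H\<^sub>0)\<close>, \<open>w \<otimes> \<eta> \<mapsto> (x \<mapsto> w(x) J \<eta>)\<close>, where \<open>J\<close> identifies
  \<open>\<ell>\<^sup>2(\<nat>)\<close> with \<open>H\<^sub>0\<close>.\<close>

proposition stabilization_uniform_roe_algebra:
  fixes X :: "'a::metric_space set" and e :: "nat \<Rightarrow> 'h::chilbert_space"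
  assumes e: "total_onseq e" and bg: "bounded_geometry X" and X: "X \<noteq> {}"
  shows "star_isomorphic (stabilization (uniform_roe_algebra X)) (alg (corner_class :: ('h \<Rightarrow>\<^sub>L 'h) set set) X)"
    (is "star_isomorphic ?A ?B")
    and "star_isomorphic (alg (corner_class :: ('h \<Rightarrow>\<^sub>L 'h) set set) X) (stabilization (uniform_roe_algebra X))"
proof -
  interpret entry_class "corner_class :: ('h \<Rightarrow>\<^sub>L 'h) set set" by (rule entry_class_corner)
  note oe = total_onseq_onseq[OF e]
  note od = total_onseq_onseq[OF total_standard_basis]
  define J where "J = pisom (\<lambda>n. ell2_single n 1 :: (nat, complex) ell2) e"
  define J' where "J' = pisom e (\<lambda>n. ell2_single n 1 :: (nat, complex) ell2)"
  have adjJ: "adjoint_pair J J'" unfolding J_def J'_def by (rule pisom_adjoint[OF od oe])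
  have clJ: "clinear_op J" "clinear_op J'"
    using adjoint_pair_clinear[OF adjJ] adjoint_pair_clinear[OF adjoint_pair_sym[OF adjJ]] by auto
  have "J o\<^sub>L J' = id_blinfun"
    unfolding J_def J'_def by (simp add: pisom_compose oe od pisom_total[OF e])
  then have JJ': "J (J' h) = h" for h by (metis blinfun_apply_blinfun_compose blinfun_apply_id_blinfun id_apply)
  have J'e: "J' (e m) = ell2_single m 1" for m unfolding J'_def by (rule pisom_seq[OF oe od])
  obtain \<kappa> :: "nat \<Rightarrow> 'a \<times> nat" where \<kappa>: "inj \<kappa>" "range \<kappa> = X \<times> UNIV"
    using enumerate_product[OF bounded_geometry_countable[OF bg] X] by blast
  have \<kappa>X: "fst (\<kappa> n) \<in> X" for n using \<kappa>(2) by (metis mem_Times_iff rangeI)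
  define c where "c n = ell2_single (fst (\<kappa> n)) (e (snd (\<kappa> n)))" for n
  define a where "a n = ell2_single (snd (\<kappa> n)) (ell2_single (fst (\<kappa> n)) (1::complex))" for n
  have oc: "onseq c" and cc: "pisom c c = chi X"
    using basis_enumeration[OF e \<kappa>] by (simp_all add: c_def[abs_def])
  have oa: "onseq a"
    unfolding onseq_def
  proof (intro allI)
    fix m n
    have "m = n" if "fst (\<kappa> m) = fst (\<kappa> n)" "snd (\<kappa> m) = snd (\<kappa> n)"
      using that \<kappa>(1) by (metis prod_eqI injD)
    then show "cinner (a m) (a n) = (if m = n then 1 else 0)"
      by (auto simp: a_def cinner_single_left single_apply cinner_complex_def zero_ell2.rep_eq)
  qed
  define Q :: "(nat, ('a, complex) ell2) ell2 \<Rightarrow>\<^sub>L (nat, ('a, complex) ell2) ell2"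
    where "Q = ell2_map (chi X)"
  have aa: "pisom a a = Q"
  proof (rule pisom_eqI[OF oa oa])
    show "clinear_op Q" unfolding Q_def by (intro ell2_map_clinear chi_clinear)
    show "Q (a n) = a n" for n
      by (rule ell2_eqI) (auto simp: Q_def a_def ell2_map_apply single_apply chi_single \<kappa>X)
    fix v :: "(nat, ('a, complex) ell2) ell2" assume v: "\<And>n. cinner v (a n) = 0"
    have "ell2_fun (ell2_fun v m) x = 0" if "x \<in> X" for m x
    proof -
      have "(x, m) \<in> range \<kappa>" using that \<kappa>(2) by simp
      then obtain n where n: "\<kappa> n = (x, m)" by (metis rangeE)
      then show ?thesis using v[of n] by (simp add: a_def cinner_single_right cinner_complex_def)
    qed
    then show "Q v = 0"
      by (intro ell2_eqI) (simp add: Q_def ell2_map_apply chi_apply zero_ell2.rep_eq)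
  qed
  define U where "U = pisom a c"
  define V where "V = pisom c a"
  have adj: "adjoint_pair U V" unfolding U_def V_def by (rule pisom_adjoint[OF oa oc])
  have clU: "clinear_op U" "clinear_op V"
    using adjoint_pair_clinear[OF adj] adjoint_pair_clinear[OF adjoint_pair_sym[OF adj]] by auto
  have UV: "partial_unitary Q (chi X) U V"
    unfolding partial_unitary_def U_def V_def
    by (simp add: pisom_adjoint pisom_compose oa oc aa cc)
  have chiU: "chi X (U v) = U v" for v
    unfolding cc[symmetric] U_def using pisom_compose[OF oa oc oc]
    by (metis blinfun_apply_blinfun_compose)
  have Vchi: "V (chi X v) = V v" for v
    unfolding cc[symmetric] V_def using pisom_compose[OF oc oc oa]
    by (metis blinfun_apply_blinfun_compose)
  have Vsingle: "V (ell2_single x (e m)) = ell2_single m (ell2_single x 1)" if "x \<in> X" for x m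
  proof -
    have "(x, m) \<in> range \<kappa>" using that \<kappa>(2) by simp
    then obtain n where n: "\<kappa> n = (x, m)" by (metis rangeE)
    show ?thesis using pisom_seq[OF oc oa, of n] by (simp add: V_def a_def c_def n)
  qed
  have Uten: "U (ell2_tensor w \<eta>) = simple_tensor (chi X w) (J \<eta>)" for w \<eta>
  proof (rule ell2_eqI)
    fix x
    show "ell2_fun (U (ell2_tensor w \<eta>)) x = ell2_fun (simple_tensor (chi X w) (J \<eta>)) x"
    proof (cases "x \<in> X")
      case True
      show ?thesis
      proof (rule cinner_total_eqI[of e])
        show "\<And>v. (\<And>n. cinner v (e n) = 0) \<Longrightarrow> v = 0" by (rule total_onseq_orthogonal[OF e])
        fix m
        have "cinner (ell2_fun (U (ell2_tensor w \<eta>)) x) (e m)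
          = cinner (ell2_tensor w \<eta>) (V (ell2_single x (e m)))"
          by (simp add: cinner_single_right[symmetric] adjoint_pairD[OF adj])
        also have "\<dots> = ell2_fun \<eta> m * ell2_fun w x"
          by (simp add: Vsingle[OF True] cinner_single_right ell2_tensor_apply scaleC_ell2.rep_eq
              scaleC_complex_def cinner_complex_def)
        also have "\<dots> = cinner (ell2_fun (simple_tensor (chi X w) (J \<eta>)) x) (e m)"
          by (simp add: simple_tensor_apply chi_apply True cinner_scaleC_left adjoint_pairD[OF adjJ]
              J'e cinner_single_right cinner_complex_def)
        finally show "cinner (ell2_fun (U (ell2_tensor w \<eta>)) x) (e m)
          = cinner (ell2_fun (simple_tensor (chi X w) (J \<eta>)) x) (e m)" .
      qed
    next
      case False
      then show ?thesis using chiU[of "ell2_tensor w \<eta>"]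
        by (metis chi_apply simple_tensor_apply scaleC_zero_left)
    qed
  qed
  have Vten: "V (simple_tensor w h) = ell2_tensor (chi X w) (J' h)" for w h
  proof -
    have "V (simple_tensor w h) = V (U (ell2_tensor w (J' h)))"
      by (simp add: Uten JJ' Vchi flip: chi_simple_tensor)
    also have "\<dots> = ell2_tensor (chi X w) (J' h)"
      by (simp add: partial_unitary_apply[OF UV] Q_def ell2_map_tensor chi_clinear)
    finally show ?thesis .
  qed
  have closedB: "closed ?B" by (simp add: alg_def)
  \<comment> \<open>This is \<open>b \<otimes> 1\<close> on the functions with values in the
    coefficient space.\<close>
  define amp where "amp b = U o\<^sub>L ell2_map b o\<^sub>L V" for b :: "('a, complex) ell2 \<Rightarrow>\<^sub>L ('a, complex) ell2"
  have amp: "amp b (simple_tensor w h) = simple_tensor (b w) h" if "b \<in> op_on (ell2_on X)" for b w h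
    using op_on_ell2_on_apply[OF that] op_on_ell2_on_clinear[OF that]
    by (simp add: amp_def Vten ell2_map_tensor Uten JJ')
  \<comment> \<open>For \<open>b\<close> of finite propagation and \<open>k\<close> in a
    finite-dimensional corner, the entries of \<open>b \<otimes> k\<close> are scalar multiples of
    \<open>k\<close>. Continuity in each factor then reaches all \<open>b\<close> of the uniform Roe
    algebra and all compact \<open>k\<close>.\<close>
  have amp1: "amp b o\<^sub>L ell2_map k \<in> ?B"
    if b: "b \<in> op_on (ell2_on X)" "finite_propagation b" and k: "finite F" "k \<in> op_on (cspan F)" for b k F
  proof (rule pre_alg_alg)
    have clk: "clinear_op k" using k(2) by (simp add: op_on_def bounded_operators_iff)
    have ent: "matrix_entry (amp b o\<^sub>L ell2_map k) x y = op_scaleC (matrix_entry b x y 1) k" for x y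
      by (rule blinfun_eqI)
        (simp add: matrix_entry_apply single_eq_simple_tensor[of y "_ :: 'h"] ell2_map_simple_tensor
          clk amp[OF b(1)] simple_tensor_apply op_scaleC_apply)
    have zero: "op_scaleC 0 k = 0" by (rule blinfun_eqI) (simp add: op_scaleC_apply)
    have "amp b o\<^sub>L ell2_map k \<in> op_on (ell2_on X)"
    proof (rule op_on_ell2_on_entryI)
      show "clinear_op (amp b o\<^sub>L ell2_map k)"
        unfolding amp_def using op_on_ell2_on_clinear[OF b(1)] clk
        by (intro clinear_op_compose clU ell2_map_clinear)
    qed (simp add: ent op_on_ell2_on_entry_0[OF b(1)] zero)
    moreover have "finite_propagation (amp b o\<^sub>L ell2_map k)"
      using b(2) zero unfolding finite_propagation_iff ent
      by (metis zero_blinfun.rep_eq)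
    moreover have "matrix_entry (amp b o\<^sub>L ell2_map k) x y \<in> op_on (cspan F)" for x y
      unfolding ent by (intro op_on_scaleC k complex_vector.subspace_span)
    moreover have "op_on (cspan F) \<in> corner_class" using k(1) by (auto simp: corner_class_def)
    ultimately show "amp b o\<^sub>L ell2_map k \<in> pre_alg corner_class X" unfolding pre_alg_def by blast
  qed
  have amp2: "amp b o\<^sub>L ell2_map k \<in> ?B"
    if b: "b \<in> uniform_roe_algebra X" and k: "finite F" "k \<in> op_on (cspan F)" for b k F
  proof -
    have "bounded_linear (\<lambda>b. amp b o\<^sub>L ell2_map k)"
      unfolding amp_def
      by (intro bounded_linear_compose[OF bounded_linear_compose_left]
          bounded_linear_compose[OF bounded_linear_conj bounded_linear_ell2_map])
    from closed_linear_preimage(1)[OF this closedB subspace_alg]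
    have "closure {T \<in> op_on (ell2_on X). finite_propagation T} \<subseteq> {b. amp b o\<^sub>L ell2_map k \<in> ?B}"
      by (rule closure_minimal[rotated]) (use amp1 k in auto)
    then show ?thesis using b unfolding uniform_roe_algebra_def by blast
  qed
  have amp3: "amp b o\<^sub>L ell2_map k \<in> ?B"
    if b: "b \<in> uniform_roe_algebra X" and k: "k \<in> compact_operators" for b and k :: "'h \<Rightarrow>\<^sub>L 'h"
  proof -
    have "bounded_linear (\<lambda>k. amp b o\<^sub>L ell2_map k)"
      by (rule bounded_linear_compose[OF bounded_linear_compose_right bounded_linear_ell2_map])
    from closed_linear_preimage(1)[OF this closedB subspace_alg]
    have "closure (\<Union>F\<in>Collect finite. op_on (cspan F)) \<subseteq> {k. amp b o\<^sub>L ell2_map k \<in> ?B}"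
      by (rule closure_minimal[rotated]) (use amp2 b in auto)
    then show ?thesis using compact_finite_rank_approx[OF e k] by blast
  qed
  have tensor_eqI: "S = T" if "\<And>w \<eta>. S (ell2_tensor w \<eta>) = T (ell2_tensor w \<eta>)"
    for S T :: "(nat, ('a, complex) ell2) ell2 \<Rightarrow>\<^sub>L 'y::real_normed_vector"
    by (rule ell2_blinfun_eqI) (metis single_eq_tensor that)
  have simple_eqI: "S = T" if "\<And>w h. S (simple_tensor w h) = T (simple_tensor w h)"
    for S T :: "('a, 'h) ell2 \<Rightarrow>\<^sub>L ('a, 'h) ell2"
    by (rule ell2_blinfun_eqI) (metis single_eq_simple_tensor that)
  have AB: "U o\<^sub>L T o\<^sub>L V \<in> ?B" if "T \<in> ?A" for T
  proof -
    have "?A \<subseteq> {T. U o\<^sub>L T o\<^sub>L V \<in> ?B}"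
    proof (rule stabilization_least)
      show "closed {T. U o\<^sub>L T o\<^sub>L V \<in> ?B}" "subspace {T. U o\<^sub>L T o\<^sub>L V \<in> ?B}"
        by (rule closed_linear_preimage[OF bounded_linear_conj closedB subspace_alg])+
      fix b and k :: "(nat, complex) ell2 \<Rightarrow>\<^sub>L (nat, complex) ell2" and T
      assume b: "b \<in> uniform_roe_algebra X" and k: "k \<in> compact_operators"
        and T: "is_tensor_op b k T"
      have bX: "b \<in> op_on (ell2_on X)" by (rule uniform_roe_algebra_op_on[OF b])
      have k': "J o\<^sub>L k o\<^sub>L J' \<in> compact_operators" by (rule compact_operators_compose[OF k clJ])
      have "U o\<^sub>L T o\<^sub>L V = amp b o\<^sub>L ell2_map (J o\<^sub>L k o\<^sub>L J')"
      proof (rule simple_eqI)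
        fix w h
        have "(U o\<^sub>L T o\<^sub>L V) (simple_tensor w h) = simple_tensor (b w) (J (k (J' h)))"
          using T op_on_ell2_on_apply[OF bX] by (simp add: Vten is_tensor_op_def Uten)
        then show "(U o\<^sub>L T o\<^sub>L V) (simple_tensor w h)
          = (amp b o\<^sub>L ell2_map (J o\<^sub>L k o\<^sub>L J')) (simple_tensor w h)"
          by (simp add: ell2_map_simple_tensor compact_operators_clinear[OF k'] amp[OF bX])
      qed
      then show "T \<in> {T. U o\<^sub>L T o\<^sub>L V \<in> ?B}" using amp3[OF b k'] by simp
    qed
    then show ?thesis using that by blast
  qed
  have QA: "Q o\<^sub>L T = T \<and> T o\<^sub>L Q = T" if "T \<in> ?A" for T
  proof -
    \<comment> \<open>Writing the equations as preimages of \<open>{0}\<close> under bounded linear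
      maps gives closedness and linearity together.\<close>
    let ?S = "{T. (Q o\<^sub>L T) - T \<in> {0}} \<inter> {T. (T o\<^sub>L Q) - T \<in> {0}}"
    have "bounded_linear (\<lambda>T. (Q o\<^sub>L T) - T)" "bounded_linear (\<lambda>T. (T o\<^sub>L Q) - T)"
      by (intro bounded_linear_sub bounded_linear_compose_right bounded_linear_compose_left
          bounded_linear_ident)+
    note c = this[THEN closed_linear_preimage(1), OF closed_singleton real_vector.subspace_single_0]
      this[THEN closed_linear_preimage(2), OF closed_singleton real_vector.subspace_single_0]
    have "?A \<subseteq> ?S"
    proof (rule stabilization_least)
      show "closed ?S" by (intro closed_Int c)
      show "subspace ?S" by (intro real_vector.subspace_inter c)
      fix b and k :: "(nat, complex) ell2 \<Rightarrow>\<^sub>L (nat, complex) ell2" and T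
      assume b: "b \<in> uniform_roe_algebra X" and T: "is_tensor_op b k T"
      have bX: "b \<in> op_on (ell2_on X)" by (rule uniform_roe_algebra_op_on[OF b])
      have "Q o\<^sub>L T = T" "T o\<^sub>L Q = T"
        using T op_on_ell2_on_apply[OF bX]
        by (auto intro!: tensor_eqI simp: is_tensor_op_def Q_def ell2_map_tensor chi_clinear)
      then show "T \<in> ?S" by simp
    qed
    then show ?thesis using that by auto
  qed
  have preBA: "V o\<^sub>L T o\<^sub>L U \<in> ?A" if T: "T \<in> pre_alg corner_class X" for T
  proof -
    obtain M where M: "T \<in> op_on (ell2_on X)" "M \<in> corner_class" "\<And>x y. matrix_entry T x y \<in> M"
      "finite_propagation T"
      using T by (auto simp: pre_alg_def)
    obtain F where F: "finite F" "M = op_on (cspan F)" by (rule corner_classE[OF M(2)])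
    obtain B where B: "finite B" "onset B" "F \<subseteq> cspan B" using Gram_Schmidt[OF F(1)] .
    have FB: "cspan F \<subseteq> cspan B"
      using B(3) complex_vector.span_minimal complex_vector.subspace_span by blast
    have clT: "clinear_op T" by (rule op_on_ell2_on_clinear[OF M(1)])
    \<comment> \<open>\<open>t p q\<close> is a coefficient matrix of \<open>T\<close>, with scalar
      entries \<open>cinner (matrix_entry T x y q) p\<close>, and \<open>s p q\<close> is this
      matrix tensored with \<open>rank1 p q\<close>. As all the entries of \<open>T\<close> live on
      \<open>cspan B\<close>, \<open>T\<close> is the finite sum of the
      \<open>s p q\<close>.\<close>
    define t :: "'h \<Rightarrow> 'h \<Rightarrow> (('a, complex) ell2 \<Rightarrow>\<^sub>L ('a, complex) ell2)"
      where "t p q = ell2_map (rank1 1 p) o\<^sub>L T o\<^sub>L ell2_map (rank1 q 1)" for p q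
    define s where "s p q = ell2_map (rank1 p 1) o\<^sub>L t p q o\<^sub>L ell2_map (rank1 1 q)" for p q
    have ent_t: "matrix_entry (t p q) x y = rank1 1 p o\<^sub>L matrix_entry T x y o\<^sub>L rank1 q 1" for p q x y
      unfolding t_def by (rule matrix_entry_ell2_map)
    have ent_s: "matrix_entry (s p q) x y = rank1 p p o\<^sub>L matrix_entry T x y o\<^sub>L rank1 q q" for p q x y
      unfolding s_def matrix_entry_ell2_map ent_t
      by (rule blinfun_eqI) (simp add: rank1_apply cinner_complex_def scaleC_complex_def
          clinear_op_scaleC[OF matrix_entry_clinear[OF clT]] cinner_scaleC_left)
    have "T = (\<Sum>(p, q)\<in>B \<times> B. s p q)"
    proof (rule matrix_entry_eqI)
      fix x y
      let ?K = "matrix_entry T x y"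
      have K: "?K v \<in> cspan B" "(\<And>w. w \<in> cspan F \<Longrightarrow> cinner v w = 0) \<Longrightarrow> ?K v = 0" for v
        using M(3)[of x y] F(2) FB by (auto simp: op_on_def)
      have Kproj: "?K v = ?K (\<Sum>q\<in>B. cinner v q *\<^sub>C q)" for v
      proof -
        have "?K (v - (\<Sum>q\<in>B. cinner v q *\<^sub>C q)) = 0"
          using onset_orthogonal_cspan[OF B(2,1)] FB by (intro K(2)) blast
        then show ?thesis by (simp add: blinfun.diff_right)
      qed
      show "?K = matrix_entry (\<Sum>(p, q)\<in>B \<times> B. s p q) x y"
      proof (rule blinfun_eqI)
        fix v
        have "?K v = (\<Sum>p\<in>B. cinner (?K v) p *\<^sub>C p)" by (rule onset_expansion[OF B(2,1) K(1)])
        also have "\<dots> = (\<Sum>p\<in>B. \<Sum>q\<in>B. cinner v q *\<^sub>C cinner (?K q) p *\<^sub>C p)"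
          by (subst Kproj)
            (simp add: blinfun.sum_right clinear_op_scaleC[OF matrix_entry_clinear[OF clT]]
              cinner_sum_left cinner_scaleC_left complex_vector.scale_sum_left scaleC_scaleC)
        also have "\<dots> = matrix_entry (\<Sum>(p, q)\<in>B \<times> B. s p q) x y v"
          by (simp add: matrix_entry_sum blinfun_sum_apply ent_s rank1_apply sum.cartesian_product
              case_prod_beta clinear_op_scaleC[OF matrix_entry_clinear[OF clT]] cinner_scaleC_left
              scaleC_scaleC)
        finally show "?K v = matrix_entry (\<Sum>(p, q)\<in>B \<times> B. s p q) x y v" .
      qed
    qed
    then have VTU: "V o\<^sub>L T o\<^sub>L U = (\<Sum>(p, q)\<in>B \<times> B. V o\<^sub>L s p q o\<^sub>L U)"
      by (auto intro!: blinfun_eqI simp: blinfun_sum_apply blinfun.sum_right case_prod_beta)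
    have "V o\<^sub>L s p q o\<^sub>L U \<in> {T. \<exists>a\<in>uniform_roe_algebra X. \<exists>k\<in>compact_operators. is_tensor_op a k T}"
      for p q
    proof -
      have cl_t: "clinear_op (t p q)"
        unfolding t_def by (intro clinear_op_compose ell2_map_clinear rank1_clinear clT)
      have "t p q \<in> op_on (ell2_on X)"
        by (rule op_on_ell2_on_entryI[OF cl_t]) (simp add: ent_t op_on_ell2_on_entry_0[OF M(1)])
      moreover have "finite_propagation (t p q)"
        using M(4) unfolding finite_propagation_iff ent_t by (metis blinfun_compose_zero)
      ultimately have tX: "t p q \<in> op_on (ell2_on X)" "t p q \<in> uniform_roe_algebra X"
        using subsetD[OF closure_subset, of "t p q"] by (simp_all add: uniform_roe_algebra_def)
      have "is_tensor_op (t p q) (rank1 (J' p) (J' q)) (V o\<^sub>L s p q o\<^sub>L U)"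
        unfolding is_tensor_op_def bounded_operators_iff
      proof (intro conjI allI)
        show "clinear_op (V o\<^sub>L s p q o\<^sub>L U)"
          unfolding s_def by (intro clinear_op_compose ell2_map_clinear rank1_clinear cl_t clU)
        fix w \<eta>
        have "ell2_map (rank1 1 q) (simple_tensor (chi X w) (J \<eta>)) = cinner (J \<eta>) q *\<^sub>C chi X w"
          by (rule ell2_eqI)
            (simp add: ell2_map_apply rank1_apply simple_tensor_apply scaleC_ell2.rep_eq
              cinner_scaleC_left scaleC_complex_def mult.commute)
        then have "s p q (U (ell2_tensor w \<eta>)) = cinner (J \<eta>) q *\<^sub>C simple_tensor (t p q w) p"
          using op_on_ell2_on_apply[OF tX(1)]
          by (simp add: Uten s_def clinear_op_scaleC[OF cl_t] simple_tensor_scaleC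
              flip: simple_tensor_def)
        then have "(V o\<^sub>L s p q o\<^sub>L U) (ell2_tensor w \<eta>)
          = cinner (J \<eta>) q *\<^sub>C ell2_tensor (t p q w) (J' p)"
          using op_on_ell2_on_apply[OF tX(1)] by (simp add: clinear_op_scaleC[OF clU(2)] Vten)
        then show "(V o\<^sub>L s p q o\<^sub>L U) (ell2_tensor w \<eta>)
          = ell2_tensor (t p q w) (rank1 (J' p) (J' q) \<eta>)"
          by (simp add: rank1_apply ell2_tensor_scaleC adjoint_pairD[OF adjJ])
      qed
      then show ?thesis using tX(2) rank1_compact by blast
    qed
    then have "V o\<^sub>L T o\<^sub>L U
      \<in> span {T. \<exists>a\<in>uniform_roe_algebra X. \<exists>k\<in>compact_operators. is_tensor_op a k T}"
      unfolding VTU by (intro real_vector.span_sum) (auto intro!: real_vector.span_base)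
    then show ?thesis unfolding stabilization_def using closure_subset by blast
  qed
  have "subspace ?A" unfolding stabilization_def by (intro subspace_closure real_vector.subspace_span)
  moreover have "closed ?A" by (simp add: stabilization_def)
  ultimately have "closure (pre_alg corner_class X) \<subseteq> {T. V o\<^sub>L T o\<^sub>L U \<in> ?A}"
    by (intro closure_minimal closed_linear_preimage(1)[OF bounded_linear_conj])
      (use preBA in auto)
  then have BA: "V o\<^sub>L T o\<^sub>L U \<in> ?A" if "T \<in> ?B" for T
    using that unfolding alg_def by blast
  have QB: "chi X o\<^sub>L T = T \<and> T o\<^sub>L chi X = T" if "T \<in> ?B" for T
    using alg_op_on[OF that] by (simp add: op_on_ell2_on_iff)
  show "star_isomorphic ?A ?B"
    unfolding star_isomorphic_def
    using partial_unitary_star_isomorphism[OF UV QA QB AB BA] by blast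
  show "star_isomorphic ?B ?A"
    unfolding star_isomorphic_def
    using partial_unitary_star_isomorphism[OF partial_unitary_sym[OF UV] QB QA BA AB] by blast
qed


theorem proposition3p9:
  fixes X :: "'a::metric_space set" and Y :: "'b::metric_space set"
    and H\<^sub>0 :: "'h::chilbert_space itself"
  assumes H\<^sub>0_separable: "separable_space (euclidean :: 'h topology)"
    and H\<^sub>0_infinite_dimensional: "\<not> (\<exists>F :: 'h set. finite F \<and> cspan F = UNIV)"
    and "X \<noteq> {}" and "Y \<noteq> {}"
    and "bounded_geometry X" and "bounded_geometry Y"
    and no_ghosts: "\<forall>Y'\<subseteq>Y. sparse_space Y' \<longrightarrow>
      \<not> (\<exists>P\<in>roe_algebra H\<^sub>0 Y'. block_rank_one_ghost_projection Y' P)"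
  shows
    "(coarsely_equivalent X Y \<longleftrightarrow>
        stably_star_isomorphic (uniform_roe_algebra X) (uniform_roe_algebra Y)) \<and>
     (coarsely_equivalent X Y \<longleftrightarrow>
        star_isomorphic (stable_roe_algebra H\<^sub>0 X) (stable_roe_algebra H\<^sub>0 Y)) \<and>
     (coarsely_equivalent X Y \<longleftrightarrow>
        star_isomorphic (uniform_algebra H\<^sub>0 X) (uniform_algebra H\<^sub>0 Y)) \<and>
     (coarsely_equivalent X Y \<longleftrightarrow>
        star_isomorphic (roe_algebra H\<^sub>0 X) (roe_algebra H\<^sub>0 Y))"
proof -
  obtain e :: "nat \<Rightarrow> 'h" where e: "total_onseq e"
    using exists_total_onseq[OF H\<^sub>0_separable H\<^sub>0_infinite_dimensional] by blast
  have gf: "ghost_free TYPE('h) Y"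
    using no_ghosts by (simp add: ghost_free_def roe_algebra_alg)
  have eq: "coarsely_equivalent X Y \<longleftrightarrow> star_isomorphic (alg E X) (alg E Y)"
    if E: "entry_class E" for E :: "('h \<Rightarrow>\<^sub>L 'h) set set"
    using coarsely_equivalent_star_isomorphic[OF E e assms(5,6,3)]
      star_isomorphic_coarsely_equivalent[OF E e assms(5,6,3) gf] by blast
  let ?A = "alg (corner_class :: ('h \<Rightarrow>\<^sub>L 'h) set set) X"
  let ?B = "alg (corner_class :: ('h \<Rightarrow>\<^sub>L 'h) set set) Y"
  note stab = stabilization_uniform_roe_algebra[OF e]
  \<comment> \<open>Replacing both stabilisations by stable Roe algebras turns condition (2) into
    condition (3), so the uniform Roe algebra needs no rigidity argument of its own.\<close>
  have "stably_star_isomorphic (uniform_roe_algebra X) (uniform_roe_algebra Y)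
    \<longleftrightarrow> star_isomorphic ?A ?B"
    unfolding stably_star_isomorphic_def
    using stab[OF assms(5,3)] stab[OF assms(6,4)] star_isomorphic_trans by metis
  then show ?thesis
    using eq[OF entry_class_corner] eq[OF entry_class_rank] eq[OF entry_class_compact]
    by (simp add: roe_algebra_alg uniform_algebra_alg stable_roe_algebra_alg)
qed

end
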